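(* There is a polynomial-time algorithm that, given a graph $G$ with $n$ vertices and minimum degree $\delta(G)$, outputs a partition $\mathcal{P}$ of $V(G)$ with $\mathrm{opt}(G)/d(\mathcal{P})\le \frac{n-1}{\delta(G)+1}$, where $\mathrm{opt}(G)$ is the maximum density of a partition of $V(G)$.
   Context: All graphs are finite, simple, undirected. For $S\subseteq V$, $d(S)=|E(S)|/|S|$ where $E(S)$ is the set of edges with both endpoints in $S$. For a partition $\mathcal{P}=\{V_1,\dots,V_k\}$ ($k\ge1$) of $V$ into nonempty parts, $d(\mathcal{P})=\sum_i d(V_i)$; the problem is to maximize $d(\mathcal{P})$ over all partitions with any number of parts.
   Formalization: The ratio bound is proved as max(1, (n-1)/(δ(G)+1)), since (n-1)/(δ(G)+1) < 1 is impossible for complete graphs with n ≥ 2 (e.g. K_2); for every non-complete graph it is the stated bound, and for complete graphs the output is optimal. *)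

theory Defs
  imports Complex_Main "HOL-Library.Disjoint_Sets" "HOL-Computational_Algebra.Polynomial"
begin

section \<open>Graphs and dense partitions\<close>

definition simple_graph :: "'a set \<Rightarrow> 'a set set \<Rightarrow> bool" where
  "simple_graph V E \<longleftrightarrow> finite V \<and> (\<forall>e\<in>E. e \<subseteq> V \<and> card e = 2)"

definition degree_in :: "'a set set \<Rightarrow> 'a \<Rightarrow> nat" where
  "degree_in E v = card {e \<in> E. v \<in> e}"

definition min_degree :: "'a set \<Rightarrow> 'a set set \<Rightarrow> nat" where
  "min_degree V E = Min (degree_in E ` V)"

definition density :: "'a set set \<Rightarrow> 'a set \<Rightarrow> real" where
  "density E S = real (card {e \<in> E. e \<subseteq> S}) / real (card S)"

definition partition_density :: "'a set set \<Rightarrow> 'a set set \<Rightarrow> real" where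
  "partition_density E P = (\<Sum>S\<in>P. density E S)"

definition opt_density :: "'a set \<Rightarrow> 'a set set \<Rightarrow> real" where
  "opt_density V E = Max {partition_density E P | P. partition_on V P}"


section \<open>Random access programs and their running time\<close>

text \<open>
  Algorithms are programs of a while-language with random access memory. The memory consists of
  named unbounded arrays of natural numbers; a scalar variable is cell 0 of an array. The only
  arithmetic operations are addition and truncated subtraction, so one operation increases the
  bit length of the largest number in memory by at most one. With these operations, counting
  every elementary operation as one step is polynomially equivalent to the running time of
  a Turing machine (this would fail if multiplication were a single step).
\<close>

type_synonym memory = "string \<Rightarrow> nat \<Rightarrow> nat"

datatype aexp = N nat | Cell string aexp | Plus aexp aexp | Minus aexp aexp

datatype bexp = Less aexp aexp | Eq aexp aexp | Not bexp | And bexp bexp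

datatype com =
    Skip
  | Assign string aexp aexp  \<comment> \<open>\<open>Assign x i a\<close> stores the value of \<open>a\<close> in cell \<open>i\<close> of array \<open>x\<close>\<close>
  | Seq com com
  | If bexp com com
  | While bexp com

fun aval :: "aexp \<Rightarrow> memory \<Rightarrow> nat" where
  "aval (N k) s = k"
| "aval (Cell x i) s = s x (aval i s)"
| "aval (Plus a b) s = aval a s + aval b s"
| "aval (Minus a b) s = aval a s - aval b s"

fun bval :: "bexp \<Rightarrow> memory \<Rightarrow> bool" where
  "bval (Less a b) s \<longleftrightarrow> aval a s < aval b s"
| "bval (Eq a b) s \<longleftrightarrow> aval a s = aval b s"
| "bval (Not b) s \<longleftrightarrow> \<not> bval b s"
| "bval (And b c) s \<longleftrightarrow> bval b s \<and> bval c s"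

fun acost :: "aexp \<Rightarrow> nat" where
  "acost (N k) = 1"
| "acost (Cell x i) = 1 + acost i"
| "acost (Plus a b) = 1 + acost a + acost b"
| "acost (Minus a b) = 1 + acost a + acost b"

fun bcost :: "bexp \<Rightarrow> nat" where
  "bcost (Less a b) = 1 + acost a + acost b"
| "bcost (Eq a b) = 1 + acost a + acost b"
| "bcost (Not b) = 1 + bcost b"
| "bcost (And b c) = 1 + bcost b + bcost c"

text \<open>\<open>exec c s t s'\<close>: started in \<open>s\<close>, program \<open>c\<close> halts in \<open>s'\<close> after exactly \<open>t\<close> steps.\<close>

inductive exec :: "com \<Rightarrow> memory \<Rightarrow> nat \<Rightarrow> memory \<Rightarrow> bool" where
  exec_Skip: "exec Skip s 1 s"
| exec_Assign:
    "exec (Assign x i a) s (1 + acost i + acost a) (s(x := (s x)(aval i s := aval a s)))"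
| exec_Seq: "exec c s t s' \<Longrightarrow> exec d s' u s'' \<Longrightarrow> exec (Seq c d) s (t + u) s''"
| exec_IfTrue: "bval b s \<Longrightarrow> exec c s t s' \<Longrightarrow> exec (If b c d) s (1 + bcost b + t) s'"
| exec_IfFalse: "\<not> bval b s \<Longrightarrow> exec d s t s' \<Longrightarrow> exec (If b c d) s (1 + bcost b + t) s'"
| exec_WhileFalse: "\<not> bval b s \<Longrightarrow> exec (While b c) s (1 + bcost b) s"
| exec_WhileTrue: "bval b s \<Longrightarrow> exec c s t s' \<Longrightarrow> exec (While b c) s' u s'' \<Longrightarrow>
    exec (While b c) s (1 + bcost b + t + u) s''"

inductive_cases exec_SkipE: "exec Skip s t s'"
inductive_cases exec_AssignE: "exec (Assign x i a) s t s'"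
inductive_cases exec_SeqE: "exec (Seq c d) s t s'"
inductive_cases exec_IfE: "exec (If b c d) s t s'"

text \<open>Programs are deterministic: final memory and running time are unique.\<close>

lemma exec_deterministic:
  "exec c s t s' \<Longrightarrow> exec c s u s'' \<Longrightarrow> u = t \<and> s'' = s'"
proof (induction arbitrary: u s'' rule: exec.induct)
  case exec_Skip
  then show ?case by (auto elim: exec_SkipE)
next
  case exec_Assign
  then show ?case by (auto elim: exec_AssignE)
next
  case (exec_Seq c s t s' d v r)
  from exec_Seq.prems obtain t' q v' where
    "exec c s t' q" "exec d q v' s''" "u = t' + v'" by (rule exec_SeqE)
  then show ?case using exec_Seq.IH by metis
next
  case (exec_IfTrue b s c t s' d)
  from exec_IfTrue.prems exec_IfTrue.hyps(1) obtain t' where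
    "exec c s t' s''" "u = 1 + bcost b + t'" by (auto elim: exec_IfE)
  then show ?case using exec_IfTrue.IH by metis
next
  case (exec_IfFalse b s d t s' c)
  from exec_IfFalse.prems exec_IfFalse.hyps(1) obtain t' where
    "exec d s t' s''" "u = 1 + bcost b + t'" by (auto elim: exec_IfE)
  then show ?case using exec_IfFalse.IH by metis
next
  case (exec_WhileFalse b s c)
  from exec_WhileFalse.prems exec_WhileFalse.hyps show ?case
    by (cases rule: exec.cases) simp_all
next
  case (exec_WhileTrue b s c t s' v r)
  from exec_WhileTrue.prems exec_WhileTrue.hyps(1) obtain t' q v' where
    "exec c s t' q" "exec (While b c) q v' s''" "u = 1 + bcost b + t' + v'"
    by (cases rule: exec.cases) simp_all
  then show ?case using exec_WhileTrue.IH by metis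
qed


section \<open>Graphs as inputs, partitions as outputs\<close>

text \<open>
  A graph on the vertices \<open>0, \<dots>, n - 1\<close> is given by \<open>n\<close> and its adjacency matrix in row-major
  order; all remaining cells are 0. The input has size of order \<open>n\<^sup>2\<close>, so a time bound
  polynomial in \<open>n\<close> is the same as one polynomial in the size of the input.
\<close>

definition graph_input :: "nat \<Rightarrow> nat set set \<Rightarrow> memory" where
  "graph_input n E = (\<lambda>x k.
     if x = ''n'' \<and> k = 0 then n
     else if x = ''adj'' \<and> k < n * n \<and> {k div n, k mod n} \<in> E then 1
     else 0)"

text \<open>Cell \<open>v\<close> of the output array holds the label of the part that contains vertex \<open>v\<close>.\<close>

definition output_partition :: "nat \<Rightarrow> memory \<Rightarrow> nat set set" where
  "output_partition n s = (\<lambda>v. {u. u < n \<and> s ''part'' u = s ''part'' v}) ` {..<n}"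

end

(*
  Write H for the complement of G, and let c be its maximum degree (but at least 1), so that
  c = n - 1 - delta unless G is complete. A clique partition of G into c parts, i.e. a proper
  c-colouring of H, has density (n - c) / 2, while opt(G) <= (n - 1) / 2; this is the claimed
  ratio. By Brooks' theorem such a colouring exists up to the components of H that are complete
  graphs on c + 1 vertices (or odd cycles, if c = 2). The algorithm colours H one vertex at a time
  with a token argument for Brooks' theorem: an uncoloured vertex is a token that can be moved to
  any neighbour; if no position on certain two-coloured (Kempe) walks offers a free colour, then
  the token sits in one of the exceptional components and is given up. Finally the given-up vertices
  join the largest colour class. Each of them costs little there, and its component lowers the
  upper bound on opt(G) by at least as much as the ratio requires.
*)
theory Submission
  imports Defs
begin

section \<open>Token walks and Brooks' theorem\<close>

text \<open>Everything rests on one counting fact: with degrees at most \<open>c\<close>, a vertex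
  that sees all \<open>c\<close> colours sees each of them exactly once. So a stuck token moves
  deterministically and keeps the colouring proper, and a vertex with two equally coloured
  neighbours has a colour to spare. Hence a two-coloured walk that never meets a free colour cannot
  run into itself except at its start, and it closes up to an odd cycle.

  The obstacle is to recognise an exceptional component by a search of bounded depth. Two closed
  walks in succession suffice: if two neighbours of the start are nonadjacent, a first walk
  recolours one of them, and what two different second walks reveal afterwards is contradictory.
  Closed walks can be undone, so all quadruples of colours are tried from the same colouring.

  For the densities, each given-up vertex costs both bounds a term of order \<open>1 / n\<close>. In
  the clique case the comparison of these losses reduces to 2 (n - 1) \<le> (n - c) (c + 1), which
  can fail only for n = c + 1, and then G has no edges. Odd cycles need a separate upper bound,
  because a partition may split such a cycle cheaply.\<close>

locale bounded_degree =
  fixes V :: "'a set" and adj :: "'a \<Rightarrow> 'a \<Rightarrow> bool" and c :: nat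
  assumes finite_V: "finite V"
    and adj_V: "adj x y \<Longrightarrow> y \<in> V"
    and adj_sym: "adj x y \<Longrightarrow> adj y x"
    and adj_irrefl: "\<not> adj x x"
    and degree_le: "card {y. adj x y} \<le> c"
begin

section \<open>Saturated vertices: no colour is free\<close>

definition saturated :: "('a \<Rightarrow> nat) \<Rightarrow> 'a \<Rightarrow> bool" where
  "saturated f w \<longleftrightarrow> (\<forall>i<c. \<exists>v. adj w v \<and> f v = i)"

lemma finite_nbrs: "finite {y. adj x y}"
  using adj_V finite_V by (auto intro: finite_subset[of _ V])

text \<open>At most \<open>c\<close> neighbours have to show \<open>c\<close> colours, so none of
  them can share a colour. This makes each move of the token forced.\<close>

lemma saturated_bij:
  assumes "saturated f w"
  shows "bij_betw f {y. adj w y} {..<c}"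
proof -
  have sub: "{..<c} \<subseteq> f ` {y. adj w y}"
    using assms by (auto simp: saturated_def image_iff)
  have "card (f ` {y. adj w y}) \<le> c"
    using card_image_le[OF finite_nbrs] degree_le le_trans by blast
  then have eq: "f ` {y. adj w y} = {..<c}"
    using card_seteq[OF _ sub] finite_nbrs by simp
  have "inj_on f {y. adj w y}"
    using eq degree_le[of w] card_image_le[OF finite_nbrs, of f w]
    by (intro eq_card_imp_inj_on finite_nbrs) auto
  with eq show ?thesis by (simp add: bij_betw_def)
qed

lemma saturated_unique:
  assumes "saturated f w" "adj w v" "adj w v'" "f v = f v'"
  shows "v = v'"
  using saturated_bij[OF assms(1)] assms by (auto simp: bij_betw_def inj_on_def)

lemma saturated_less: "saturated f w \<Longrightarrow> adj w v \<Longrightarrow> f v < c"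
  using saturated_bij by (fastforce simp: bij_betw_def)

lemma saturated_card: "saturated f w \<Longrightarrow> card {y. adj w y} = c"
  using bij_betw_same_card[OF saturated_bij] by simp

section \<open>Alternating walks of the token\<close>

definition alt :: "nat \<Rightarrow> nat \<Rightarrow> nat \<Rightarrow> nat" where
  "alt i j k = (if even k then i else j)"

text \<open>An uncoloured vertex (colour \<open>c\<close>) is a token. Moving it to a neighbour of colour \<open>i\<close>
  transfers the colour \<open>i\<close> backwards along the edge, so that nothing but the position of the
  token is lost. A walk moves the token along the colours \<open>i\<close>, \<open>j\<close>, \<open>i\<close>, \<open>j\<close>, \<dots>\<close>

definition move :: "nat \<Rightarrow> ('a \<Rightarrow> nat) \<times> 'a \<Rightarrow> ('a \<Rightarrow> nat) \<times> 'a" where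
  "move i = (\<lambda>(f, w). let v = (SOME v. adj w v \<and> f v = i) in (f(w := i, v := c), v))"

primrec walk :: "('a \<Rightarrow> nat) \<Rightarrow> 'a \<Rightarrow> nat \<Rightarrow> nat \<Rightarrow> nat \<Rightarrow> ('a \<Rightarrow> nat) \<times> 'a" where
  "walk f u i j 0 = (f, u)"
| "walk f u i j (Suc k) = move (alt i j k) (walk f u i j k)"

declare walk.simps(2) [simp del]

abbreviation "colr f u i j k \<equiv> fst (walk f u i j k)"
abbreviation "tok f u i j k \<equiv> snd (walk f u i j k)"

abbreviation "saturated_at f u i j k \<equiv> saturated (colr f u i j k) (tok f u i j k)"

lemma move_eq:
  assumes "saturated f w" "adj w v" "f v = i"
  shows "move i (f, w) = (f(w := i, v := c), v)"
proof -
  have "(SOME v. adj w v \<and> f v = i) = v"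
    using saturated_unique[OF assms(1)] assms(2,3) by (intro some_equality) auto
  then show ?thesis by (simp add: move_def)
qed

lemma alt_less: "i < c \<Longrightarrow> j < c \<Longrightarrow> alt i j k < c"
  by (simp add: alt_def)

lemma walk_Suc_obtain:
  assumes "saturated_at f u i j k" "i < c" "j < c"
  obtains v where "adj (tok f u i j k) v" "colr f u i j k v = alt i j k"
    "walk f u i j (Suc k) = ((colr f u i j k)(tok f u i j k := alt i j k, v := c), v)"
proof -
  obtain v where v: "adj (tok f u i j k) v" "colr f u i j k v = alt i j k"
    using assms alt_less unfolding saturated_def by blast
  from move_eq[OF assms(1) v] show ?thesis
    using that v by (simp add: walk.simps(2))
qed

lemma walk_SucI:
  assumes "saturated_at f u i j k" "adj (tok f u i j k) v" "colr f u i j k v = alt i j k"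
  shows "walk f u i j (Suc k) = ((colr f u i j k)(tok f u i j k := alt i j k, v := c), v)"
  using move_eq[OF assms] by (simp add: walk.simps(2))

text \<open>Saturation prevents the walk from crossing itself. If step \<open>Suc l\<close> hit an
  earlier position m > 0, then already at time m that vertex would have had two neighbours of one
  colour: its predecessor, which had just been recoloured, and the position at time
  \<open>l\<close>, which still had its original colour. So the walk can close only at
  \<open>u\<close>, and until then it merely shifts the colours by one place along a path.\<close>

lemma walk_path:
  assumes ij: "i < c" "j < c" "i \<noteq> j" and "f u = c"
    and "\<And>m. m < k \<Longrightarrow> saturated_at f u i j m"
    and "\<And>m. 0 < m \<Longrightarrow> m \<le> k \<Longrightarrow> tok f u i j m \<noteq> u"
  shows "inj_on (tok f u i j) {..k} \<and> colr f u i j k (tok f u i j k) = c \<and>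
    (\<forall>m<k. colr f u i j k (tok f u i j m) = alt i j m) \<and>
    (\<forall>y. y \<notin> tok f u i j ` {..k} \<longrightarrow> colr f u i j k y = f y) \<and>
    (\<forall>m<k. f (tok f u i j (Suc m)) = alt i j m \<and> adj (tok f u i j m) (tok f u i j (Suc m)))"
  using assms(5,6)
proof (induction k rule: less_induct)
  case (less k)
  let ?x = "tok f u i j" and ?g = "colr f u i j"
  show ?case
  proof (cases k)
    case 0
    then show ?thesis using \<open>f u = c\<close> by simp
  next
    case (Suc l)
    have IH: "inj_on ?x {..m}" "?g m (?x m) = c" "\<And>p. p < m \<Longrightarrow> ?g m (?x p) = alt i j p"
      "\<And>y. y \<notin> ?x ` {..m} \<Longrightarrow> ?g m y = f y"
      "\<And>p. p < m \<Longrightarrow> f (?x (Suc p)) = alt i j p \<and> adj (?x p) (?x (Suc p))" if "m \<le> l" for m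
      using less.IH[of m] less.prems that Suc by auto
    have sat: "saturated (?g m) (?x m)" if "m \<le> l" for m
      using less.prems(1) that Suc by simp
    obtain v where v: "adj (?x l) v" "?g l v = alt i j l"
      and w: "walk f u i j (Suc l) = ((?g l)(?x l := alt i j l, v := c), v)"
      using walk_Suc_obtain[OF sat ij(1,2)] by blast
    have xv: "?x (Suc l) = v" and gv: "?g (Suc l) = (?g l)(?x l := alt i j l, v := c)"
      using w by simp_all
    have new: "v \<noteq> ?x m" if "m \<le> l" for m
    proof
      assume vm: "v = ?x m"
      show False
      proof (cases "m = 0")
        case True
        then show False using less.prems(2)[of "Suc l"] Suc xv vm by simp
      next
        case False
        have "m \<noteq> l" using v(1) vm adj_irrefl by auto
        then have ml: "m < l" using that by simp
        \<comment> \<open>The vertex at position \<open>m\<close> has held \<open>alt i j m\<close>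
          since the token left it; meeting it at step \<open>l\<close> forces \<open>m\<close> and
          \<open>l\<close> to have the same parity.\<close>
        have "alt i j m = alt i j l" using IH(3)[of l m] ml v(2) vm by simp
        then have "alt i j (l - 1) = alt i j (m - 1)"
          using ij(3) False ml by (cases l; cases m) (auto simp: alt_def split: if_splits)
        moreover have "?x l \<noteq> ?x p" if "p \<le> m" for p
          using inj_on_eq_iff[OF IH(1)[of l], of l p] ml that by simp
        then have "?x l \<notin> ?x ` {..m}" by blast
        then have "?g m (?x l) = alt i j (l - 1)"
          using IH(4)[of m "?x l"] IH(5)[of l "l - 1"] ml by simp
        moreover have "?g m (?x (m - 1)) = alt i j (m - 1)"
          using IH(3)[of m "m - 1"] False ml by simp
        moreover have "adj (?x m) (?x (m - 1))"
          using IH(5)[of m "m - 1"] False ml adj_sym by simp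
        moreover have "adj (?x m) (?x l)" using v(1) vm adj_sym by simp
        ultimately have "?x l = ?x (m - 1)"
          using saturated_unique[OF sat[of m]] ml by simp
        then have "l = m - 1" using IH(1)[of l] ml by (auto simp: inj_on_def)
        then show False using ml by simp
      qed
    qed
    have vnew: "v \<notin> ?x ` {..l}" using new by blast
    then have fv: "f v = alt i j l"
      using IH(4)[of l v] v(2) by simp
    have inj: "inj_on ?x {..Suc l}"
      using IH(1)[of l] vnew xv by (auto simp: atMost_Suc)
    have "?g (Suc l) (?x m) = alt i j m" if "m < Suc l" for m
    proof (cases "m = l")
      case True
      then show ?thesis using gv new[of l] by auto
    next
      case False
      then have "m < l" using that by simp
      then have "?x m \<noteq> ?x l" using IH(1)[of l] by (auto simp: inj_on_def)
      then show ?thesis using gv new[of m] IH(3)[of l m] \<open>m < l\<close> by (metis fun_upd_other le_refl less_imp_le)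
    qed
    moreover have "?g (Suc l) (?x (Suc l)) = c" using gv xv by simp
    moreover have "?g (Suc l) y = f y" if "y \<notin> ?x ` {..Suc l}" for y
      using that gv xv IH(4)[of l y] by (auto simp: atMost_Suc)
    moreover have "f (?x (Suc m)) = alt i j m \<and> adj (?x m) (?x (Suc m))" if "m < Suc l" for m
      using that IH(5)[of l m] fv v(1) xv by (cases "m = l") auto
    ultimately show ?thesis using inj Suc by blast
  qed
qed

text \<open>A converse of \<open>walk_path\<close>: vertices ahead of the token still have their
  original colours, so an alternating path of \<open>f\<close> predicts the route. Later arguments
  thus compute walks from known paths and never look at the choice inside
  \<open>move\<close>.\<close>

lemma walk_follow:
  assumes ij: "i < c" "j < c" "i \<noteq> j" and "f u = c"
    and sat: "\<And>m. m < M \<Longrightarrow> saturated_at f u i j m"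
    and y: "y 0 = u" "inj_on y {..M}"
    and step: "\<And>m. m < M \<Longrightarrow> adj (y m) (y (Suc m)) \<and> f (y (Suc m)) = alt i j m"
    and "m \<le> M"
  shows "tok f u i j m = y m"
  using \<open>m \<le> M\<close>
proof (induction m rule: less_induct)
  case (less m)
  show ?case
  proof (cases m)
    case 0
    then show ?thesis using y by simp
  next
    case (Suc l)
    have IH: "tok f u i j p = y p" if "p \<le> l" for p using less that Suc by simp
    have "tok f u i j p \<noteq> u" if "0 < p" "p \<le> l" for p
      using IH[of p] y that less.prems Suc by (auto simp: inj_on_def)
    then have P: "\<And>z. z \<notin> tok f u i j ` {..l} \<Longrightarrow> colr f u i j l z = f z"
      using walk_path[where k = l and f = f and u = u, OF ij \<open>f u = c\<close>] sat less.prems Suc by simp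
    have "y (Suc l) \<notin> tok f u i j ` {..l}"
    proof -
      have "tok f u i j p \<noteq> y (Suc l)" if "p \<le> l" for p
        using IH[OF that] inj_on_eq_iff[OF y(2), of "Suc l" p] less.prems Suc that by auto
      then show ?thesis by (metis (no_types, lifting) atMost_iff imageE)
    qed
    then have "colr f u i j l (y (Suc l)) = alt i j l"
      using P step[of l] less.prems Suc by simp
    moreover have "adj (tok f u i j l) (y (Suc l))"
      using IH[of l] step[of l] less.prems Suc by simp
    ultimately have "walk f u i j (Suc l) = ((colr f u i j l)(tok f u i j l := alt i j l, y (Suc l) := c), y (Suc l))"
      using walk_SucI[OF sat[of l]] less.prems Suc by simp
    then show ?thesis using Suc by simp
  qed
qed

section \<open>Closed walks and their reversal\<close>

definition returns :: "('a \<Rightarrow> nat) \<Rightarrow> 'a \<Rightarrow> nat \<Rightarrow> nat \<Rightarrow> nat \<Rightarrow> bool" where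
  "returns f u i j K \<longleftrightarrow> 0 < K \<and> (\<forall>m<K. saturated_at f u i j m) \<and> tok f u i j K = u \<and>
     (\<forall>m. 0 < m \<and> m < K \<longrightarrow> tok f u i j m \<noteq> u)"

definition cycle_run :: "('a \<Rightarrow> nat) \<Rightarrow> 'a \<Rightarrow> nat \<Rightarrow> nat \<Rightarrow> ('a \<Rightarrow> nat) \<Rightarrow> bool" where
  "cycle_run f u i j f' \<longleftrightarrow> (\<exists>K. returns f u i j K \<and> f' = colr f u i j K)"

text \<open>Pigeonhole: \<open>card V + 1\<close> different positions do not fit into
  \<open>V\<close>. Saturation is demanded only while the walk has not come home, which is what an
  unsuccessful run of the program guarantees.\<close>

lemma returns_within:
  assumes ij: "i < c" "j < c" "i \<noteq> j" and "f u = c" "u \<in> V"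
    and sat: "\<And>m. m \<le> card V \<Longrightarrow> (\<And>p. 0 < p \<Longrightarrow> p \<le> m \<Longrightarrow> tok f u i j p \<noteq> u) \<Longrightarrow> saturated_at f u i j m"
  shows "\<exists>K \<le> card V. returns f u i j K"
proof -
  have ex: "\<exists>K. 0 < K \<and> K \<le> card V \<and> tok f u i j K = u"
  proof (rule ccontr)
    assume "\<not> ?thesis"
    then have no: "tok f u i j p \<noteq> u" if "0 < p" "p \<le> card V" for p using that by blast
    then have P: "inj_on (tok f u i j) {..card V}"
      "\<And>m. m < card V \<Longrightarrow> adj (tok f u i j m) (tok f u i j (Suc m))"
      using walk_path[where k = "card V" and f = f and u = u, OF ij \<open>f u = c\<close>] sat by auto
    have "tok f u i j m \<in> V" if "m \<le> card V" for m
    proof (cases m)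
      case (Suc p)
      then show ?thesis using P(2)[of p] adj_V that by auto
    qed (use \<open>u \<in> V\<close> in simp)
    then have "card (tok f u i j ` {..card V}) \<le> card V"
      using finite_V by (intro card_mono) auto
    then show False using card_image[OF P(1)] by simp
  qed
  define K where "K = (LEAST K. 0 < K \<and> K \<le> card V \<and> tok f u i j K = u)"
  have K: "0 < K" "K \<le> card V" "tok f u i j K = u"
    using LeastI_ex[OF ex] unfolding K_def by auto
  have first: "tok f u i j m \<noteq> u" if "0 < m" "m < K" for m
    using not_less_Least[of m "\<lambda>K. 0 < K \<and> K \<le> card V \<and> tok f u i j K = u"] that K
    unfolding K_def[symmetric] by auto
  have "saturated_at f u i j m" if "m < K" for m
    using sat[of m] first that K by auto
  then show ?thesis using K first unfolding returns_def by blast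
qed

text \<open>\<open>k\<close> is even because the last move looks for \<open>alt i j k\<close> and
  finds it on \<open>u\<close>, which received \<open>i\<close> in the first move. So the cycle has
  odd length \<open>k + 1\<close>, and the net effect is an exchange of \<open>i\<close> and
  \<open>j\<close> on its vertices other than \<open>u\<close>.\<close>

lemma returnsE:
  assumes R: "returns f u i j K" and ij: "i < c" "j < c" "i \<noteq> j" and u: "f u = c"
  obtains k where "K = Suc k" "even k" "2 \<le> k" "inj_on (tok f u i j) {..k}"
    "\<And>m. m < k \<Longrightarrow> f (tok f u i j (Suc m)) = alt i j m"
    "\<And>m. m < k \<Longrightarrow> adj (tok f u i j m) (tok f u i j (Suc m))"
    "adj (tok f u i j k) u"
    "\<And>m. 0 < m \<Longrightarrow> m \<le> k \<Longrightarrow> colr f u i j K (tok f u i j m) = alt i j m"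
    "\<And>y. y \<notin> tok f u i j ` {1..k} \<Longrightarrow> colr f u i j K y = f y"
proof -
  let ?x = "tok f u i j" and ?g = "colr f u i j"
  obtain k where K: "K = Suc k" using R by (cases K) (auto simp: returns_def)
  have sat: "\<And>m. m \<le> k \<Longrightarrow> saturated (?g m) (?x m)" and xK: "?x (Suc k) = u"
    and first: "\<And>m. 0 < m \<Longrightarrow> m \<le> k \<Longrightarrow> ?x m \<noteq> u"
    using R unfolding returns_def K by auto
  have P: "inj_on ?x {..k}" "?g k (?x k) = c" "\<And>m. m < k \<Longrightarrow> ?g k (?x m) = alt i j m"
    "\<And>y. y \<notin> ?x ` {..k} \<Longrightarrow> ?g k y = f y"
    "\<And>m. m < k \<Longrightarrow> f (?x (Suc m)) = alt i j m"
    "\<And>m. m < k \<Longrightarrow> adj (?x m) (?x (Suc m))"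
    using walk_path[where k = k and f = f and u = u, OF ij u] sat first by auto
  obtain v where v: "adj (?x k) v" "?g k v = alt i j k"
    and w: "walk f u i j (Suc k) = ((?g k)(?x k := alt i j k, v := c), v)"
    using walk_Suc_obtain[OF sat ij(1,2)] by blast
  have vu: "v = u" using w xK by simp
  have k0: "k \<noteq> 0"
  proof
    assume "k = 0"
    then show False using v vu adj_irrefl by simp
  qed
  have "?g k u = i" using P(3)[of 0] k0 by (simp add: alt_def)
  then have ev: "even k" using v vu ij by (auto simp: alt_def split: if_splits)
  have gK: "?g K = (?g k)(?x k := alt i j k, u := c)" using w vu K by simp
  have "?g K (?x m) = alt i j m" if "0 < m" "m \<le> k" for m
  proof (cases "m = k")
    case True
    then show ?thesis using gK first[of k] that by simp
  next
    case False
    then have "?x m \<noteq> ?x k" using P(1) that by (auto simp: inj_on_def)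
    then show ?thesis using gK first[of m] P(3)[of m] that False by simp
  qed
  moreover have "?g K y = f y" if "y \<notin> ?x ` {1..k}" for y
  proof (cases "y = u")
    case True
    then show ?thesis using gK u by simp
  next
    case False
    have "{..k} = insert 0 {1..k}" by auto
    then have "y \<notin> ?x ` {..k}" using that False by simp
    then show ?thesis using gK False P(4) by auto
  qed
  moreover have "2 \<le> k" using k0 ev by (cases k; cases "k - 1") auto
  ultimately show ?thesis
    using that[OF K ev _ P(1) P(5,6)] v(1) vu by auto
qed

lemma returns_follow:
  assumes R: "returns f u i j K" and ij: "i < c" "j < c" "i \<noteq> j" and u: "f u = c"
    and y: "y 0 = u" "inj_on y {..M}"
    and step: "\<And>m. m < M \<Longrightarrow> adj (y m) (y (Suc m)) \<and> f (y (Suc m)) = alt i j m"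
  shows "M < K" "\<And>m. m \<le> M \<Longrightarrow> tok f u i j m = y m"
proof -
  have sat: "\<And>m. m < K \<Longrightarrow> saturated_at f u i j m" and K: "0 < K" "tok f u i j K = u"
    using R unfolding returns_def by auto
  show *: "M < K"
  proof (rule ccontr)
    assume "\<not> M < K"
    then have "K \<le> M" by simp
    have "inj_on y {..K}" using y(2) \<open>K \<le> M\<close> by (auto intro: inj_on_subset)
    then have "tok f u i j K = y K"
      using \<open>K \<le> M\<close> y(1) step by (intro walk_follow[OF ij u sat, of K y K]) auto
    then show False using K y \<open>K \<le> M\<close> by (auto simp: inj_on_def)
  qed
  show "tok f u i j m = y m" if "m \<le> M" for m
    using that * y step by (intro walk_follow[OF ij u sat, of M y m]) auto
qed

text \<open>A closed walk exchanges the colours \<open>i\<close> and \<open>j\<close> on its cycle; repeating it goes around the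
  same cycle in the opposite direction and so undoes the exchange.\<close>

lemma cycle_run_twice:
  assumes r: "cycle_run f u i j f'" "cycle_run f' u i j f''"
    and ij: "i < c" "j < c" "i \<noteq> j" and u: "f u = c"
  shows "f'' = f"
proof -
  let ?x = "tok f u i j"
  obtain K where R: "returns f u i j K" and f': "f' = colr f u i j K"
    using r(1) unfolding cycle_run_def by blast
  obtain K' where R': "returns f' u i j K'" and f'': "f'' = colr f' u i j K'"
    using r(2) unfolding cycle_run_def by blast
  obtain k where k: "K = Suc k" "even k" "2 \<le> k" and inj: "inj_on ?x {..k}"
    and fx: "\<And>m. m < k \<Longrightarrow> f (?x (Suc m)) = alt i j m"
    and ad: "\<And>m. m < k \<Longrightarrow> adj (?x m) (?x (Suc m))" "adj (?x k) u"
    and f'x: "\<And>m. 0 < m \<Longrightarrow> m \<le> k \<Longrightarrow> f' (?x m) = alt i j m"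
    and f'y: "\<And>y. y \<notin> ?x ` {1..k} \<Longrightarrow> f' y = f y"
    using returnsE[OF R ij u] unfolding f' by metis
  \<comment> \<open>The same cycle in the opposite direction. As \<open>k\<close> is even, the
    exchanged colours read backwards alternate again and begin with \<open>i\<close>, so
    \<open>y\<close> is a legal route in \<open>f'\<close>.\<close>
  define y where "y m = (if m = 0 then u else ?x (Suc k - m))" for m
  have x0: "?x 0 = u" by simp
  have "?x m \<noteq> u" if "0 < m" "m \<le> k" for m
    using inj_on_eq_iff[OF inj, of m 0] that by simp
  then have "u \<notin> ?x ` {1..k}" by (metis (no_types, lifting) atLeastAtMost_iff image_iff less_le_trans zero_less_one)
  then have u': "f' u = c" using f'y u by simp
  have injy: "inj_on y {..k}"
  proof (rule inj_onI)
    fix a b assume ab: "a \<in> {..k}" "b \<in> {..k}" "y a = y b"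
    have "y m = ?x (if m = 0 then 0 else Suc k - m)" for m
      unfolding y_def using x0 by simp
    then have "(if a = 0 then 0 else Suc k - a) = (if b = 0 then 0 else Suc k - b)"
      using ab inj by (intro inj_onD[OF inj]) auto
    then show "a = b" using ab by (auto split: if_splits)
  qed
  have stepy: "adj (y m) (y (Suc m)) \<and> f' (y (Suc m)) = alt i j m" if "m < k" for m
  proof -
    have "f' (y (Suc m)) = alt i j (k - m)" using f'x[of "k - m"] that by (simp add: y_def)
    moreover have "alt i j (k - m) = alt i j m" using k(2) that by (simp add: alt_def)
    moreover have "adj (y m) (y (Suc m))"
    proof (cases "m = 0")
      case True
      then show ?thesis using ad(2) adj_sym by (simp add: y_def)
    next
      case False
      then have "Suc (k - m) = Suc k - m" using that by simp
      then show ?thesis using ad(1)[of "k - m"] that False adj_sym by (simp add: y_def del: walk.simps)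
    qed
    ultimately show ?thesis by simp
  qed
  note fol = returns_follow[OF R' ij u' _ injy stepy]
  have y0: "y 0 = u" by (simp add: y_def)
  have xy: "tok f' u i j m = y m" if "m \<le> k" for m using fol(2)[OF y0] that by simp
  have kK: "k < K'" using fol(1)[OF y0] .
  have first: "tok f' u i j m \<noteq> u" if "0 < m" "m \<le> k" for m
    using xy[of m] injy y0 that by (auto simp: inj_on_def)
  have sat': "\<And>m. m < K' \<Longrightarrow> saturated_at f' u i j m" using R' by (simp add: returns_def)
  \<comment> \<open>This closes the second walk after exactly \<open>k + 1\<close> moves: from its
    last position the colour \<open>i\<close> is to be found on \<open>u\<close>, where the first
    move put it.\<close>
  have P: "colr f' u i j k u = i"
  proof -
    have "\<forall>m<k. colr f' u i j k (tok f' u i j m) = alt i j m"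
      using walk_path[where k = k and f = f' and u = u, OF ij u'] sat' kK first by simp
    from this[rule_format, of 0] show ?thesis using k(3) by (simp add: alt_def)
  qed
  have yk: "y k = ?x 1" using k by (simp add: y_def)
  have "adj (?x 1) u" using ad(1)[of 0] adj_sym k x0 by simp
  then have "walk f' u i j (Suc k) = ((colr f' u i j k)(tok f' u i j k := alt i j k, u := c), u)"
    using walk_SucI[OF sat'[OF kK], of u] P k(2) xy[of k] yk by (simp add: alt_def)
  then have tk: "tok f' u i j (Suc k) = u" by simp
  have "K' = Suc k"
    using R' tk kK unfolding returns_def by (metis Suc_lessI zero_less_Suc)
  obtain k' where k': "K' = Suc k'"
    and f''x: "\<And>m. 0 < m \<Longrightarrow> m \<le> k' \<Longrightarrow> f'' (tok f' u i j m) = alt i j m"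
    and f''y: "\<And>y. y \<notin> tok f' u i j ` {1..k'} \<Longrightarrow> f'' y = f' y"
    using returnsE[OF R' ij u'] unfolding f'' by metis
  have kk: "k' = k" using k' \<open>K' = Suc k\<close> by simp
  have img: "tok f' u i j ` {1..k} = ?x ` {1..k}"
  proof -
    have "tok f' u i j ` {1..k} = (\<lambda>m. ?x (Suc k - m)) ` {1..k}"
      using xy by (intro image_cong) (auto simp: y_def)
    also have "\<dots> = ?x ` ((\<lambda>m. Suc k - m) ` {1..k})" by (simp add: image_image)
    also have "(\<lambda>m. Suc k - m) ` {1..k} = {1..k}"
    proof (intro equalityI subsetI)
      fix m assume "m \<in> {1..k}"
      then show "m \<in> (\<lambda>m. Suc k - m) ` {1..k}"
        by (intro image_eqI[where x = "Suc k - m"]) auto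
    qed auto
    finally show ?thesis .
  qed
  show "f'' = f"
  proof
    fix z
    show "f'' z = f z"
    proof (cases "z \<in> ?x ` {1..k}")
      case False
      then show ?thesis using f''y[of z] f'y[of z] img kk by simp
    next
      case True
      then obtain m where m: "1 \<le> m" "m \<le> k" "z = ?x m" by auto
      then have "z = tok f' u i j (Suc k - m)" using xy[of "Suc k - m"] by (simp add: y_def)
      then have "f'' z = alt i j (Suc k - m)" using f''x[of "Suc k - m"] m kk by simp
      also have "\<dots> = alt i j (m - 1)" using k(2) m by (auto simp: alt_def)
      also have "\<dots> = f z" using fx[of "m - 1"] m by simp
      finally show ?thesis .
    qed
  qed
qed

text \<open>Let \<open>a\<close> and \<open>b\<close> have colours \<open>p\<close> and
  \<open>q\<close>, and let \<open>s\<close> be a third colour. The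
  \<open>p\<close>-\<open>q\<close> walk is a cycle through \<open>u\<close>, \<open>a\<close>,
  \<open>x 2\<close>, ..., \<open>b\<close>. The \<open>p\<close>-\<open>s\<close> walk gives
  \<open>a\<close> the colour \<open>s\<close> and leaves the rest of this cycle alone. From there
  the \<open>s\<close>-\<open>q\<close> walk reaches \<open>x 2\<close> through \<open>a\<close> and
  shows that \<open>x 2\<close> has another neighbour \<open>z'\<close> of colour \<open>s\<close>;
  the \<open>q\<close>-\<open>p\<close> walk reaches \<open>x 2\<close> from the side of
  \<open>b\<close> while \<open>a\<close> and \<open>z'\<close> both still have colour
  \<open>s\<close>, against saturation.\<close>

lemma saturated_nbrs_adjacent:
  assumes sat: "saturated f u" and u: "f u = c" and c3: "3 \<le> c"
    and runs: "\<And>i j k l. i < c \<Longrightarrow> j < c \<Longrightarrow> k < c \<Longrightarrow> l < c \<Longrightarrow> i \<noteq> j \<Longrightarrow> k \<noteq> l \<Longrightarrow>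
      \<exists>f'. cycle_run f u i j f' \<and> (\<exists>f''. cycle_run f' u k l f'')"
    and ab: "adj u a" "adj u b" "a \<noteq> b"
  shows "adj a b"
proof (rule ccontr)
  assume nab: "\<not> adj a b"
  define p where "p = f a"
  define q where "q = f b"
  have pq: "p < c" "q < c" "p \<noteq> q"
    using saturated_less[OF sat] saturated_unique[OF sat] ab unfolding p_def q_def by auto
  obtain s where s: "s < c" "s \<noteq> p" "s \<noteq> q"
  proof -
    have "\<not> {..<c} \<subseteq> {p, q}"
    proof
      assume "{..<c} \<subseteq> {p, q}"
      then have "card {..<c} \<le> card {p, q}" by (intro card_mono) auto
      also have "\<dots> \<le> 2" using card_insert_le_m1[of 2 "{q}" p] by simp
      finally show False using c3 by simp
    qed
    then show ?thesis using that by auto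
  qed
  have ps: "p \<noteq> s" using s by simp

  let ?x = "tok f u p q"
  obtain K where R: "returns f u p q K"
    using runs[OF pq(1,2) pq(1,2) pq(3) pq(3)] unfolding cycle_run_def by blast
  obtain k where k: "K = Suc k" "even k" "2 \<le> k" and inj: "inj_on ?x {..k}"
    and fx: "\<And>m. m < k \<Longrightarrow> f (?x (Suc m)) = alt p q m"
    and ad: "\<And>m. m < k \<Longrightarrow> adj (?x m) (?x (Suc m))" "adj (?x k) u"
    using returnsE[OF R pq u] by metis
  note xeq = inj_on_eq_iff[OF inj]
  have x0: "?x 0 = u" by simp
  have fx': "f (?x m) = (if odd m then p else q)" if "0 < m" "m \<le> k" for m
    using fx[of "m - 1"] that by (auto simp: alt_def)
  have x1: "?x 1 = a"
    using saturated_unique[OF sat, of "?x 1" a] ad(1)[of 0] fx[of 0] k ab by (simp add: alt_def p_def)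
  have xk: "?x k = b"
    using saturated_unique[OF sat, of "?x k" b] ad(2) adj_sym fx'[of k] k ab by (simp add: q_def)
  \<comment> \<open>For \<open>k = 2\<close> the cycle would be a triangle and join \<open>a\<close>
    to \<open>b\<close>. From \<open>k = 4\<close> on, \<open>x 2\<close> is different from
    \<open>b\<close>.\<close>
  have k4: "4 \<le> k"
  proof -
    have "k \<noteq> 2" using ad(1)[of 1] x1 xk nab k(3) by (auto simp: numeral_2_eq_2)
    moreover have "k \<noteq> 3" using k(2) by auto
    ultimately show ?thesis using k(3) by linarith
  qed
  have x2u: "\<not> adj (?x 2) u"
  proof
    assume "adj (?x 2) u"
    then have "?x 2 = ?x k"
      using saturated_unique[OF sat, of "?x 2" "?x k"] ad(2) adj_sym fx'[of k] fx'[of 2] k by simp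
    then show False using xeq[of 2 k] k4 by simp
  qed

  let ?z = "tok f u p s"
  obtain f' where f': "cycle_run f u p s f'"
    and r3: "\<exists>f''. cycle_run f' u s q f''"
    using runs[OF pq(1) s(1) s(1) pq(2) ps s(3)] by blast
  obtain f'2 where f'2: "cycle_run f u p s f'2" and "\<exists>f''. cycle_run f'2 u q p f''"
    using runs[OF pq(1) s(1) pq(2,1) ps pq(3)[symmetric]] by blast
  obtain L where Rz: "returns f u p s L" and f'L: "f' = colr f u p s L"
    using f' unfolding cycle_run_def by blast
  obtain L2 where Rz2: "returns f u p s L2" and f'L2: "f'2 = colr f u p s L2"
    using f'2 unfolding cycle_run_def by blast
  \<comment> \<open>First return times are unique, so both second walks start from the same
    colouring \<open>f'\<close>.\<close>
  have "L2 = L"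
    using Rz Rz2 unfolding returns_def by (metis linorder_neqE_nat)
  then have r4: "\<exists>f''. cycle_run f' u q p f''"
    using \<open>\<exists>f''. cycle_run f'2 u q p f''\<close> f'L f'L2 by simp
  obtain l where l: "L = Suc l" "even l" "2 \<le> l" and injz: "inj_on ?z {..l}"
    and fz: "\<And>m. m < l \<Longrightarrow> f (?z (Suc m)) = alt p s m"
    and adz: "\<And>m. m < l \<Longrightarrow> adj (?z m) (?z (Suc m))" "adj (?z l) u"
    and f'z: "\<And>m. 0 < m \<Longrightarrow> m \<le> l \<Longrightarrow> f' (?z m) = alt p s m"
    and f'y: "\<And>y. y \<notin> ?z ` {1..l} \<Longrightarrow> f' y = f y"
    using returnsE[OF Rz pq(1) s(1) ps u] unfolding f'L by metis
  have fz': "f (?z m) = (if odd m then p else s)" if "0 < m" "m \<le> l" for m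
    using fz[of "m - 1"] that by (auto simp: alt_def)
  have z0: "?z 0 = u" by simp
  have z1: "?z 1 = a"
    using saturated_unique[OF sat, of "?z 1" a] adz(1)[of 0] fz[of 0] l ab by (simp add: alt_def p_def)
  have zq: "y \<notin> ?z ` {1..l}" if "f y = q" for y
  proof
    assume "y \<in> ?z ` {1..l}"
    then obtain r where "1 \<le> r" "r \<le> l" "y = ?z r" by auto
    then show False using fz'[of r] that s(3) pq(3) by (auto split: if_splits)
  qed
  \<comment> \<open>Vertices of colour \<open>q\<close> never lie on a
    \<open>p\<close>-\<open>s\<close> walk. A vertex \<open>x m\<close> of colour \<open>p\<close>
    on it would see colour \<open>q\<close> on both \<open>x (m - 1)\<close> and
    \<open>x (Suc m)\<close> when the token arrives. This spares only \<open>x 1\<close>, whose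
    predecessor is \<open>u\<close>.\<close>
  have zx: "?x m \<notin> ?z ` {1..l}" if m: "2 \<le> m" "m \<le> k" for m
  proof (cases "even m")
    case True
    then show ?thesis using fx'[of m] m zq by simp
  next
    case False
    show ?thesis
    proof
      assume "?x m \<in> ?z ` {1..l}"
      then obtain r where r: "1 \<le> r" "r \<le> l" "?x m = ?z r" by auto
      have satr: "saturated_at f u p s r" using Rz r l unfolding returns_def by simp
      have mk: "m < k" using False m k(2) by (cases "m = k") auto
      have P: "\<And>y. y \<notin> ?z ` {..r} \<Longrightarrow> colr f u p s r y = f y"
        using walk_path[where k = r and f = f and u = u and i = p and j = s] Rz r l pq s ps u
        unfolding returns_def by simp
      have unv: "?x h \<notin> ?z ` {..r}" if h: "0 < h" "h \<le> k" "even h" for h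
      proof
        assume "?x h \<in> ?z ` {..r}"
        then obtain d where d: "d \<le> r" "?x h = ?z d" by auto
        show False
        proof (cases "d = 0")
          case True
          then show False using d z0 xeq[of h 0] h by simp
        next
          case False
          then show False using zq[of "?x h"] fx'[of h] h d r by auto
        qed
      qed
      have "colr f u p s r (?x (m - 1)) = q" "colr f u p s r (?x (Suc m)) = q"
        using P[OF unv[of "m - 1"]] P[OF unv[of "Suc m"]] fx'[of "m - 1"] fx'[of "Suc m"] False m mk
        by auto
      moreover have "adj (?x m) (?x (m - 1))" "adj (?x m) (?x (Suc m))"
        using ad(1)[of "m - 1"] ad(1)[of m] m mk adj_sym by auto
      ultimately have "?x (m - 1) = ?x (Suc m)"
        using saturated_unique[OF satr] r by simp
      moreover have "m - 1 \<le> k" "Suc m \<le> k" using mk by auto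
      ultimately have "m - 1 = Suc m" using xeq by blast
      then show False by simp
    qed
  qed
  have f'x: "f' (?x m) = f (?x m)" if "2 \<le> m" "m \<le> k" for m
    using f'y[OF zx[OF that]] .
  have f'x1: "f' (?x 1) = s" using f'z[of 1] x1 z1 l by (simp add: alt_def)
  have "u \<notin> ?z ` {1..l}"
  proof
    assume "u \<in> ?z ` {1..l}"
    then obtain r where "1 \<le> r" "r \<le> l" "?z 0 = ?z r" by auto
    then show False using inj_on_eq_iff[OF injz, of 0 r] by simp
  qed
  then have u': "f' u = c" using f'y u by simp

  obtain M where RM: "returns f' u s q M" using r3 unfolding cycle_run_def by blast
  have ad': "adj u (?x 1)" "adj (?x 1) (?x 2)"
    using ad(1)[of 0] ad(1)[of 1] k by (simp_all add: numeral_2_eq_2)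
  have f2: "f' (?x 2) = q" using f'x[of 2] fx'[of 2] k by simp
  have step3: "adj (?x m) (?x (Suc m)) \<and> f' (?x (Suc m)) = alt s q m" if "m < 2" for m
  proof -
    have "m = 0 \<or> m = 1" using that by auto
    then show ?thesis using ad' f2 f'x1 by (auto simp: alt_def numeral_2_eq_2[symmetric])
  qed
  have inj3: "inj_on ?x {..2}" using inj k by (auto intro: inj_on_subset)
  note fol3 = returns_follow[OF RM s(1) pq(2) s(3) u' x0 inj3 step3]
  have tok3: "tok f' u s q m = ?x m" if "m \<le> 2" for m using fol3(2) that by simp
  have sat3: "saturated_at f' u s q m" if "m \<le> 2" for m
    using RM fol3(1) that unfolding returns_def by simp
  have first3: "tok f' u s q m \<noteq> u" if "0 < m" "m \<le> 2" for m
    using tok3[of m] xeq[of m 0] that k by simp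
  have P3: "\<And>y. y \<notin> tok f' u s q ` {..2} \<Longrightarrow> colr f' u s q 2 y = f' y"
    "\<And>m. m < 2 \<Longrightarrow> colr f' u s q 2 (tok f' u s q m) = alt s q m"
    "colr f' u s q 2 (tok f' u s q 2) = c"
    using walk_path[where k = 2 and f = f' and u = u and i = s and j = q] s(1,3) pq(2) u' sat3 first3
    by simp_all
  \<comment> \<open>By now \<open>x 1\<close> holds \<open>q\<close>, so the colour \<open>s\<close>
    that \<open>x 2\<close> must see is on a vertex off the route, which had it before the
    walk.\<close>
  obtain z' where z': "adj (?x 2) z'" "colr f' u s q 2 z' = s"
    using sat3[of 2] tok3[of 2] s(1) unfolding saturated_def by auto
  have z'x1: "z' \<noteq> ?x 1" using P3(2)[of 1] tok3[of 1] z' s(3) by (auto simp: alt_def)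
  have z'u: "z' \<noteq> u" using x2u z' by auto
  have z'2: "z' \<noteq> ?x 2" using P3(3) tok3[of 2] z' s(1) by auto
  have "z' \<noteq> tok f' u s q m" if "m \<le> 2" for m
  proof -
    have "m = 0 \<or> m = 1 \<or> m = 2" using that by auto
    then show ?thesis using tok3[of m] z'x1 z'u z'2 by auto
  qed
  then have f'z': "f' z' = s" using P3(1)[of z'] z'(2) by auto

  obtain M4 where RM4: "returns f' u q p M4" using r4 unfolding cycle_run_def by blast
  \<comment> \<open>The old cycle entered at \<open>b\<close> and followed backwards. It ends at
    \<open>x 2\<close> after \<open>k - 1\<close> moves; \<open>x 1\<close> is left out because it
    now has colour \<open>s\<close>.\<close>
  define y where "y m = ?x (if m = 0 then 0 else Suc k - m)" for m
  have y0: "y 0 = u" by (simp add: y_def)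
  have injy: "inj_on y {..k - 1}"
  proof (rule inj_onI)
    fix d e assume de: "d \<in> {..k - 1}" "e \<in> {..k - 1}" "y d = y e"
    moreover have "(if d = 0 then 0 else Suc k - d) \<le> k" "(if e = 0 then 0 else Suc k - e) \<le> k"
      by auto
    ultimately have "(if d = 0 then 0 else Suc k - d) = (if e = 0 then 0 else Suc k - e)"
      using xeq unfolding y_def by blast
    then show "d = e" using de k(3) by (auto split: if_splits)
  qed
  have f'yk: "f' (y m) = (if odd m then q else p)" if "0 < m" "m \<le> k - 1" for m
    using f'x[of "Suc k - m"] fx'[of "Suc k - m"] that k(2,3) by (auto simp: y_def)
  have step4: "adj (y m) (y (Suc m)) \<and> f' (y (Suc m)) = alt q p m" if "m < k - 1" for m
  proof -
    have "adj (y m) (y (Suc m))"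
    proof (cases "m = 0")
      case True
      then show ?thesis using ad(2) adj_sym by (simp add: y_def)
    next
      case False
      then have "Suc (k - m) = Suc k - m" using that by simp
      then show ?thesis using ad(1)[of "k - m"] that False adj_sym by (simp add: y_def)
    qed
    then show ?thesis using f'yk[of "Suc m"] that by (simp add: alt_def)
  qed
  note fol4 = returns_follow[OF RM4 pq(2,1) pq(3)[symmetric] u' y0 injy step4]
  have tok4: "tok f' u q p m = y m" if "m \<le> k - 1" for m using fol4(2) that by simp
  have sat4: "saturated_at f' u q p m" if "m \<le> k - 1" for m
    using RM4 fol4(1) that unfolding returns_def by simp
  have first4: "tok f' u q p m \<noteq> u" if "0 < m" "m \<le> k - 1" for m
    using tok4[of m] inj_on_eq_iff[OF injy, of m 0] y0 that by simp
  have P4: "\<And>y. y \<notin> tok f' u q p ` {..k - 1} \<Longrightarrow> colr f' u q p (k - 1) y = f' y"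
    using walk_path[where k = "k - 1" and f = f' and u = u and i = q and j = p] pq u' sat4 first4
    by simp
  have unv4: "v \<notin> tok f' u q p ` {..k - 1}" if "f' v = s" for v
  proof
    assume "v \<in> tok f' u q p ` {..k - 1}"
    then obtain m where m: "m \<le> k - 1" "v = y m" using tok4 by auto
    show False
    proof (cases "m = 0")
      case True
      then show False using m y0 u' that s(1) by simp
    next
      case False
      then show False using f'yk[of m] m that s by (auto split: if_splits)
    qed
  qed
  have "colr f' u q p (k - 1) (?x 1) = s" "colr f' u q p (k - 1) z' = s"
    using P4 unv4 f'x1 f'z' by auto
  moreover have "tok f' u q p (k - 1) = ?x 2"
    using tok4[of "k - 1"] k by (simp add: y_def numeral_2_eq_2 Suc_diff_le)
  ultimately have "?x 1 = z'"
    using saturated_unique[OF sat4[of "k - 1"], of "?x 1" z'] z'(1) ad'(2) adj_sym by simp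
  then show False using z'x1 by simp
qed

section \<open>The exceptional components and how a failed search finds them\<close>

definition nbr_closed :: "'a set \<Rightarrow> bool" where
  "nbr_closed Z \<longleftrightarrow> (\<forall>x\<in>Z. \<forall>y. adj x y \<longrightarrow> y \<in> Z)"

text \<open>The exceptional components of Brooks' theorem; minimality among the nonempty neighbour-closed
  sets expresses connectedness.\<close>

definition obstruction :: "'a set \<Rightarrow> bool" where
  "obstruction Z \<longleftrightarrow> Z \<subseteq> V \<and> nbr_closed Z \<and> (\<forall>Y. nbr_closed Y \<longrightarrow> Y \<inter> Z \<noteq> {} \<longrightarrow> Z \<subseteq> Y) \<and>
     (if c = 2
      then 3 \<le> card Z \<and> (\<forall>x\<in>Z. card {y. adj x y} = 2) \<and>
        (\<forall>S. \<exists>x\<in>Z. \<exists>y\<in>Z. adj x y \<and> (x \<in> S \<longleftrightarrow> y \<in> S))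
      else card Z = c + 1 \<and> (\<forall>x\<in>Z. \<forall>y\<in>Z. x \<noteq> y \<longrightarrow> adj x y))"

text \<open>That \<open>u\<close> is the only uncoloured vertex of \<open>Z\<close> makes the
  components of different given-up vertices disjoint. Injectivity limits the conflicts of
  \<open>u\<close> with any single colour class to one.\<close>

definition blocked :: "('a \<Rightarrow> nat) \<Rightarrow> 'a \<Rightarrow> bool" where
  "blocked f u \<longleftrightarrow> (\<exists>Z. obstruction Z \<and> {x \<in> Z. f x = c} = {u} \<and> inj_on f {y. adj u y})"

text \<open>The closed neighbourhood of \<open>u\<close> is a clique on \<open>c + 1\<close>
  vertices, so each of its vertices spends its whole degree inside and the clique is a
  component.\<close>

lemma obstruction_clique:
  assumes "saturated f u" "u \<in> V" "c \<noteq> 2"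
    and cl: "\<And>a b. adj u a \<Longrightarrow> adj u b \<Longrightarrow> a \<noteq> b \<Longrightarrow> adj a b"
  shows "obstruction (insert u {y. adj u y})"
proof -
  let ?Z = "insert u {y. adj u y}"
  have card: "card ?Z = c + 1"
    using saturated_card[OF assms(1)] finite_nbrs adj_irrefl by simp
  have clq: "adj x y" if "x \<in> ?Z" "y \<in> ?Z" "x \<noteq> y" for x y
    using that cl adj_sym[of u] by blast
  have nb: "{y. adj x y} = ?Z - {x}" if "x \<in> ?Z" for x
  proof -
    have "?Z - {x} \<subseteq> {y. adj x y}" using clq[OF that] by blast
    moreover have "card {y. adj x y} \<le> card (?Z - {x})"
      using degree_le[of x] card that finite_nbrs by simp
    ultimately show ?thesis using card_seteq[OF finite_nbrs] by blast
  qed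
  have "nbr_closed ?Z" unfolding nbr_closed_def using nb by blast
  moreover have "?Z \<subseteq> Y" if Y: "nbr_closed Y" "Y \<inter> ?Z \<noteq> {}" for Y
  proof -
    obtain x where "x \<in> Y" "x \<in> ?Z" using Y by blast
    then show ?thesis using Y(1) clq unfolding nbr_closed_def by (metis subsetI)
  qed
  moreover have "?Z \<subseteq> V" using assms(2) adj_V by blast
  moreover have "\<forall>x\<in>?Z. \<forall>y\<in>?Z. x \<noteq> y \<longrightarrow> adj x y" using clq by blast
  ultimately show ?thesis
    unfolding obstruction_def using assms(3) card by presburger
qed

text \<open>For two colours a single closed walk is enough: its vertices have degree at most 2 and
  two neighbours on the cycle, so the cycle is the whole component.\<close>

lemma obstruction_odd_cycle:
  assumes c2: "c = 2" and R: "returns f u 0 1 K" and u: "f u = c" "u \<in> V"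
  shows "\<exists>Z. obstruction Z \<and> {x \<in> Z. f x = c} = {u}"
proof -
  let ?x = "tok f u 0 1"
  obtain k where k: "K = Suc k" "even k" "2 \<le> k" and inj: "inj_on ?x {..k}"
    and fx: "\<And>m. m < k \<Longrightarrow> f (?x (Suc m)) = alt 0 1 m"
    and ad: "\<And>m. m < k \<Longrightarrow> adj (?x m) (?x (Suc m))" "adj (?x k) u"
    using returnsE[OF R _ _ _ u(1)] c2 by (metis one_less_numeral_iff semiring_norm(76) zero_less_numeral zero_neq_one)
  note xeq = inj_on_eq_iff[OF inj]
  have x0: "?x 0 = u" by simp
  define Z where "Z = ?x ` {..k}"
  define nx where "nx m = (if m = k then 0 else Suc m)" for m
  define pv where "pv m = (if m = 0 then k else m - 1)" for m
  have nxpv: "nx m \<le> k" "pv m \<le> k" "nx m \<noteq> pv m" if "m \<le> k" for m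
    using that k by (auto simp: nx_def pv_def)
  have adn: "adj (?x m) (?x (nx m))" if "m \<le> k" for m
    using ad(1)[of m] ad(2) that x0 by (auto simp: nx_def)
  have adp: "adj (?x m) (?x (pv m))" if "m \<le> k" for m
  proof -
    have "nx (pv m) = m" using that k(3) by (auto simp: nx_def pv_def)
    then show ?thesis using adn[of "pv m"] nxpv[OF that] adj_sym by metis
  qed
  have nb: "{y. adj (?x m) y} = {?x (nx m), ?x (pv m)}" if "m \<le> k" for m
  proof -
    have "card {?x (nx m), ?x (pv m)} = 2" using xeq[of "nx m" "pv m"] nxpv[OF that] by simp
    moreover have "{?x (nx m), ?x (pv m)} \<subseteq> {y. adj (?x m) y}" using adn adp that by simp
    ultimately have "{?x (nx m), ?x (pv m)} = {y. adj (?x m) y}"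
      using degree_le[of "?x m"] c2 by (intro card_seteq finite_nbrs) auto
    then show ?thesis by simp
  qed
  have card2: "card {y. adj (?x m) y} = 2" if "m \<le> k" for m
    using nb[OF that] xeq[of "nx m" "pv m"] nxpv[OF that] by simp
  have "nbr_closed Z"
    unfolding nbr_closed_def
  proof (intro ballI allI impI)
    fix z y assume "z \<in> Z" "adj z y"
    then obtain m where m: "m \<le> k" "z = ?x m" unfolding Z_def by auto
    then have "y \<in> {?x (nx m), ?x (pv m)}" using nb[OF m(1)] \<open>adj z y\<close> by blast
    then show "y \<in> Z" unfolding Z_def using nxpv[OF m(1)] by auto
  qed
  moreover have "Z \<subseteq> Y" if Y: "nbr_closed Y" "Y \<inter> Z \<noteq> {}" for Y
  proof -
    obtain m where m: "m \<le> k" "?x m \<in> Y" using Y(2) unfolding Z_def by auto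
    have down: "?x (m - d) \<in> Y" for d
    proof (induction d)
      case (Suc d)
      show ?case
      proof (cases "m - d = 0")
        case False
        then have "Suc (m - Suc d) = m - d" by simp
        then have "adj (?x (m - d)) (?x (m - Suc d))"
          using ad(1)[of "m - Suc d"] m(1) False adj_sym[of "?x (m - Suc d)"] by simp
        then show ?thesis using Suc Y(1) unfolding nbr_closed_def by blast
      qed (use Suc in simp)
    qed (use m in simp)
    have "?x d \<in> Y" if "d \<le> k" for d using that
    proof (induction d)
      case 0
      show ?case using down[of m] by simp
    next
      case (Suc d)
      then show ?case using ad(1)[of d] Y(1) unfolding nbr_closed_def by auto
    qed
    then show ?thesis unfolding Z_def by auto
  qed
  moreover have "Z \<subseteq> V"
  proof -
    have "?x m \<in> V" if "m \<le> k" for m using adj_V[OF adj_sym[OF adn[OF that]]] .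
    then show ?thesis unfolding Z_def by auto
  qed
  moreover have "3 \<le> card Z" unfolding Z_def using card_image[OF inj] k by simp
  moreover have "\<forall>x\<in>Z. card {y. adj x y} = 2" unfolding Z_def using card2 by auto
  moreover have "\<exists>x\<in>Z. \<exists>y\<in>Z. adj x y \<and> (x \<in> S \<longleftrightarrow> y \<in> S)" for S
  proof (rule ccontr)
    assume no: "\<not> ?thesis"
    have Zm: "?x m \<in> Z" if "m \<le> k" for m unfolding Z_def using that by auto
    \<comment> \<open>If every edge crossed \<open>S\<close>, membership in \<open>S\<close> would
      alternate along the cycle; as \<open>k\<close> is even, both ends of the closing edge would be
      on the same side.\<close>
    have flip: "?x m \<in> S \<longleftrightarrow> (even m \<longleftrightarrow> u \<in> S)" if "m \<le> k" for m using that
    proof (induction m)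
      case (Suc m)
      then show ?case using no ad(1)[of m] Zm[of m] Zm[of "Suc m"] by auto
    qed simp
    from flip[of k] k(2) have "?x k \<in> S \<longleftrightarrow> u \<in> S" by simp
    then show False using no ad(2) Zm[of k] Zm[of 0] x0 by auto
  qed
  moreover have "{x \<in> Z. f x = c} = {u}"
  proof -
    have "f (?x m) \<noteq> c" if "0 < m" "m \<le> k" for m
      using fx[of "m - 1"] that c2 by (auto simp: alt_def)
    then have "?x m = u" if "m \<le> k" "f (?x m) = c" for m using that x0 by (cases "m = 0") auto
    moreover have "u \<in> Z" unfolding Z_def using x0 by (metis atMost_iff imageI le0)
    ultimately show ?thesis using u unfolding Z_def by auto
  qed
  ultimately show ?thesis unfolding obstruction_def using c2 by (intro exI[of _ Z]) auto
qed

text \<open>Turns failure of the search into structure: \<open>runs\<close> is what is known once no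
  pair of closed walks has met a free colour. With one colour the neighbourhood has a single vertex,
  with two the cycle is odd, and with more the neighbours are pairwise adjacent.\<close>

theorem blockedI:
  assumes sat: "saturated f u" and u: "f u = c" "u \<in> V" and c1: "1 \<le> c"
    and runs: "\<And>i j k l. i < c \<Longrightarrow> j < c \<Longrightarrow> k < c \<Longrightarrow> l < c \<Longrightarrow> i \<noteq> j \<Longrightarrow> k \<noteq> l \<Longrightarrow>
      \<exists>f'. cycle_run f u i j f' \<and> (\<exists>f''. cycle_run f' u k l f'')"
  shows "blocked f u"
proof (cases "c = 2")
  case True
  then obtain K where K: "returns f u 0 1 K"
    using runs[of 0 1 0 1] unfolding cycle_run_def by auto
  then show ?thesis
    using obstruction_odd_cycle[OF True K u] saturated_unique[OF sat]
    unfolding blocked_def inj_on_def by blast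
next
  case False
  have "adj a b" if "adj u a" "adj u b" "a \<noteq> b" for a b
  proof (cases "c = 1")
    case True
    then show ?thesis
      using saturated_less[OF sat that(1)] saturated_less[OF sat that(2)]
        saturated_unique[OF sat that(1,2)] that(3) by simp
  next
    case c: False
    then show ?thesis
      using saturated_nbrs_adjacent[OF sat u(1) _ runs that] c1 False by linarith
  qed
  then have "obstruction (insert u {y. adj u y})"
    using obstruction_clique[OF sat u(2) False] by blast
  moreover have "{x \<in> insert u {y. adj u y}. f x = c} = {u}"
    using saturated_less[OF sat] u by fastforce
  moreover have "inj_on f {y. adj u y}"
    using saturated_unique[OF sat] unfolding inj_on_def by auto
  ultimately show ?thesis unfolding blocked_def by blast
qed

end

section \<open>Density of partitions in terms of the complement\<close>

lemma card_Int_partition_on: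
  assumes "partition_on V P" "finite V" "Z \<subseteq> V"
  shows "(\<Sum>S\<in>P. card (S \<inter> Z)) = card Z"
proof -
  have "finite P" using assms finite_elements by blast
  have fin: "\<And>S. S \<in> P \<Longrightarrow> finite (S \<inter> Z)"
    using assms by (meson finite_Int finite_subset)
  have "disjoint P" using assms partition_onD2 by blast
  then have "card (\<Union>S\<in>P. S \<inter> Z) = (\<Sum>S\<in>P. card (S \<inter> Z))"
    using \<open>finite P\<close> fin by (intro card_UN_disjoint) (auto simp: disjoint_def)
  moreover have "(\<Union>S\<in>P. S \<inter> Z) = Z" using partition_onD1[OF assms(1)] assms(3) by auto
  ultimately show ?thesis by simp
qed

locale complement_graph = bounded_degree V adj c
  for V :: "'a set" and adj :: "'a \<Rightarrow> 'a \<Rightarrow> bool" and c :: nat +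
  fixes E :: "'a set set"
  assumes simple: "simple_graph V E"
    and adj_iff: "adj x y \<longleftrightarrow> x \<in> V \<and> y \<in> V \<and> x \<noteq> y \<and> {x, y} \<notin> E"
begin

text \<open>Ordered pairs count every non-edge twice, which matches the factor 2 in front of the
  densities below.\<close>

definition adj_pairs :: "'a set \<Rightarrow> ('a \<times> 'a) set" where
  "adj_pairs S = {(x, y). x \<in> S \<and> y \<in> S \<and> adj x y}"

lemma finite_adj_pairs: "finite (adj_pairs S)"
proof -
  have "adj_pairs S \<subseteq> V \<times> V" unfolding adj_pairs_def using adj_iff by auto
  then show ?thesis using finite_V finite_subset by blast
qed

text \<open>The ordered pairs from \<open>S\<close> are the diagonal, two for each edge inside
  \<open>S\<close>, and \<open>adj_pairs S\<close>.\<close>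

lemma density_eq:
  assumes "S \<subseteq> V" "S \<noteq> {}"
  shows "2 * density E S = real (card S) - 1 - real (card (adj_pairs S)) / real (card S)"
proof -
  have finS: "finite S" using assms finite_V finite_subset by blast
  have E2: "\<And>e. e \<in> E \<Longrightarrow> card e = 2" and "E \<subseteq> Pow V"
    using simple unfolding simple_graph_def by auto
  then have finE: "finite E" using finite_V by (meson finite_Pow_iff finite_subset)
  define Q where "Q = {(x, y). x \<in> S \<and> y \<in> S \<and> {x, y} \<in> E}"
  have QU: "Q = (\<Union>e\<in>{e \<in> E. e \<subseteq> S}. {(x, y). {x, y} = e})" unfolding Q_def by auto
  have c2: "card {(x, y). {x, y} = e} = 2 \<and> finite {(x, y). {x, y} = e}" if e: "e \<in> E" for e
  proof -
    obtain a b where ab: "e = {a, b}" "a \<noteq> b" using E2[OF e] by (auto simp: card_2_iff)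
    have "{(x, y). {x, y} = e} = {(a, b), (b, a)}" using ab by (auto simp: doubleton_eq_iff)
    then show ?thesis using ab by simp
  qed
  have "card Q = (\<Sum>e\<in>{e \<in> E. e \<subseteq> S}. card {(x, y). {x, y} = e})"
    unfolding QU using finE c2 by (intro card_UN_disjoint) auto
  also have "\<dots> = (\<Sum>e\<in>{e \<in> E. e \<subseteq> S}. 2)" using c2 by (intro sum.cong) auto
  finally have cQ: "card Q = 2 * card {e \<in> E. e \<subseteq> S}" by simp
  have irr: "{x, x} \<notin> E" for x using E2[of "{x, x}"] by auto
  have dec: "S \<times> S = (\<lambda>x. (x, x)) ` S \<union> (Q \<union> adj_pairs S)"
    unfolding Q_def adj_pairs_def using adj_iff assms by auto
  have finQ: "finite Q" unfolding Q_def by (rule finite_subset[of _ "S \<times> S"]) (use finS in auto)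
  have "card S * card S = card ((\<lambda>x. (x, x)) ` S \<union> (Q \<union> adj_pairs S))"
    using dec card_cartesian_product by metis
  also have "\<dots> = card ((\<lambda>x. (x, x)) ` S) + card (Q \<union> adj_pairs S)"
    using finS finQ finite_adj_pairs irr adj_irrefl
    by (intro card_Un_disjoint) (auto simp: Q_def adj_pairs_def)
  also have "card (Q \<union> adj_pairs S) = card Q + card (adj_pairs S)"
    using finQ finite_adj_pairs adj_iff by (intro card_Un_disjoint) (auto simp: Q_def adj_pairs_def)
  also have "card ((\<lambda>x. (x, x)) ` S) = card S" by (intro card_image) (auto simp: inj_on_def)
  finally have "card S * card S = card S + (2 * card {e \<in> E. e \<subseteq> S} + card (adj_pairs S))"
    using cQ by simp
  then have "real (card S) * real (card S) =
      real (card S) + (2 * real (card {e \<in> E. e \<subseteq> S}) + real (card (adj_pairs S)))"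
    by (metis of_nat_add of_nat_mult of_nat_numeral)
  moreover have "card S \<noteq> 0" using assms finS by simp
  ultimately show ?thesis unfolding density_def by (simp add: field_simps)
qed

lemma partition_density_eq:
  assumes "partition_on V P"
  shows "2 * partition_density E P =
    real (card V) - real (card P) - (\<Sum>S\<in>P. real (card (adj_pairs S)) / real (card S))"
proof -
  have "2 * partition_density E P = (\<Sum>S\<in>P. 2 * density E S)"
    unfolding partition_density_def by (simp add: sum_distrib_left)
  also have "\<dots> = (\<Sum>S\<in>P. real (card S) - 1 - real (card (adj_pairs S)) / real (card S))"
    using assms partition_onD1 partition_onD3 by (intro sum.cong refl density_eq) auto
  also have "\<dots> = real (\<Sum>S\<in>P. card S) - real (card P) - (\<Sum>S\<in>P. real (card (adj_pairs S)) / real (card S))"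
    by (simp add: sum_subtractf)
  also have "(\<Sum>S\<in>P. card S) = (\<Sum>S\<in>P. card (S \<inter> V))"
    using assms partition_onD1 by (intro sum.cong) (auto intro: arg_cong[where f = card])
  also have "\<dots> = card V" using card_Int_partition_on[OF assms finite_V] by simp
  finally show ?thesis .
qed

lemma partition_density_nonneg: "0 \<le> partition_density E P"
  unfolding partition_density_def density_def by (simp add: sum_nonneg)

lemma adj_pairs_ge_sum:
  assumes "finite U" "disjoint_family_on Z U"
  shows "(\<Sum>u\<in>U. card (adj_pairs (S \<inter> Z u))) \<le> card (adj_pairs S)"
proof -
  have "card (\<Union>u\<in>U. adj_pairs (S \<inter> Z u)) = (\<Sum>u\<in>U. card (adj_pairs (S \<inter> Z u)))"
  proof (rule card_UN_disjoint)
    show "\<forall>u\<in>U. \<forall>v\<in>U. u \<noteq> v \<longrightarrow> adj_pairs (S \<inter> Z u) \<inter> adj_pairs (S \<inter> Z v) = {}"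
      using assms(2) by (fastforce simp: disjoint_family_on_def adj_pairs_def)
  qed (use assms(1) finite_adj_pairs in auto)
  moreover have "(\<Union>u\<in>U. adj_pairs (S \<inter> Z u)) \<subseteq> adj_pairs S" by (auto simp: adj_pairs_def)
  ultimately show ?thesis using card_mono[OF finite_adj_pairs] by metis
qed

lemma card_pos_part:
  assumes "partition_on V P" "S \<in> P"
  shows "0 < card S" "card S \<le> card V"
  using assms finite_V partition_onD1 partition_onD3
  by (metis Union_upper card_gt_0_iff finite_subset, metis Union_upper card_mono)

lemma upper_bound:
  assumes P: "partition_on V P" and "V \<noteq> {}"
  shows "2 * partition_density E P \<le> real (card V) - 1"
proof -
  have "finite P" using P finite_V finite_elements by blast
  moreover have "P \<noteq> {}" using P assms(2) partition_onD1 by blast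
  ultimately have "1 \<le> card P" by (simp add: Suc_leI card_gt_0_iff)
  moreover have "0 \<le> (\<Sum>S\<in>P. real (card (adj_pairs S)) / real (card S))" by (simp add: sum_nonneg)
  ultimately show ?thesis using partition_density_eq[OF P] by linarith
qed

lemma card_adj_pairs_clique:
  assumes "\<And>x y. x \<in> S \<Longrightarrow> y \<in> S \<Longrightarrow> x \<noteq> y \<Longrightarrow> adj x y" "finite S"
  shows "real (card (adj_pairs S)) = (real (card S))\<^sup>2 - real (card S)"
proof -
  have "S \<times> S = (\<lambda>x. (x, x)) ` S \<union> adj_pairs S"
    unfolding adj_pairs_def using assms by auto
  then have "card S * card S = card ((\<lambda>x. (x, x)) ` S \<union> adj_pairs S)"
    using card_cartesian_product by metis
  also have "\<dots> = card ((\<lambda>x. (x, x)) ` S) + card (adj_pairs S)"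
    using assms finite_adj_pairs adj_irrefl
    by (intro card_Un_disjoint) (auto simp: adj_pairs_def)
  also have "card ((\<lambda>x. (x, x)) ` S) = card S" by (intro card_image) (auto simp: inj_on_def)
  finally have "real (card S) * real (card S) = real (card S) + real (card (adj_pairs S))"
    by (metis of_nat_add of_nat_mult)
  then show ?thesis by (simp add: power2_eq_square)
qed

text \<open>The tangent-line bound \<open>a\<^sup>2 / s \<ge> 2 l a - l\<^sup>2 s\<close> with slope \<open>l = r / n\<close> linearises the
  contribution of each clique; it is sharp for the partition with a single part.\<close>

lemma upper_bound_cliques:
  assumes P: "partition_on V P" and "V \<noteq> {}"
    and U: "finite U" "disjoint_family_on Z U"
    and Z: "\<And>u. u \<in> U \<Longrightarrow> Z u \<subseteq> V" "\<And>u. u \<in> U \<Longrightarrow> card (Z u) = r"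
    and clique: "\<And>u x y. u \<in> U \<Longrightarrow> x \<in> Z u \<Longrightarrow> y \<in> Z u \<Longrightarrow> x \<noteq> y \<Longrightarrow> adj x y"
  shows "2 * partition_density E P \<le>
    real (card V) - 1 - real (card U) * real r * (real r - 1) / real (card V)"
proof -
  define n where "n = real (card V)"
  define l where "l = real r / n"
  have n0: "0 < n" unfolding n_def using assms(2) finite_V by (simp add: card_gt_0_iff)
  let ?a = "\<lambda>S u. real (card (S \<inter> Z u))"
  have finP: "finite P" using P finite_V finite_elements by blast
  have part: "2 * density E S \<le> real (card S) - (\<Sum>u\<in>U. 2 * l * ?a S u - l\<^sup>2 * real (card S))
      - (real (card S) - (\<Sum>u\<in>U. ?a S u)) / n" if "S \<in> P" for S
  proof -
    define s where "s = real (card S)"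
    have SV: "S \<subseteq> V" "S \<noteq> {}" using P that partition_onD1 partition_onD3 by auto
    have finS: "finite S" using SV finite_V finite_subset by blast
    have s: "0 < s" "s \<le> n" using card_pos_part[OF P that] unfolding s_def n_def by auto
    have "(\<Sum>u\<in>U. (?a S u)\<^sup>2 - ?a S u) = (\<Sum>u\<in>U. real (card (adj_pairs (S \<inter> Z u))))"
      using clique finS by (intro sum.cong refl card_adj_pairs_clique[symmetric]) auto
    also have "\<dots> \<le> real (card (adj_pairs S))"
      using adj_pairs_ge_sum[OF U, of S] by (metis of_nat_le_iff of_nat_sum)
    finally have D: "(\<Sum>u\<in>U. (?a S u)\<^sup>2 - ?a S u) \<le> real (card (adj_pairs S))" .
    have "(\<Sum>u\<in>U. card (S \<inter> Z u)) = card (\<Union>u\<in>U. S \<inter> Z u)"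
      using U finS by (intro card_UN_disjoint[symmetric]) (auto simp: disjoint_family_on_def)
    also have "\<dots> \<le> card S" using finS by (intro card_mono) auto
    finally have "(\<Sum>u\<in>U. ?a S u) \<le> s" unfolding s_def by (metis of_nat_le_iff of_nat_sum)
    \<comment> \<open>The disjoint cliques fit into \<open>S\<close>, so the numerator is
      nonnegative and the denominator may grow to \<open>n\<close>. To make use of this, the
      constant 1 and the linear part of the clique terms are combined below into this one
      fraction.\<close>
    then have w: "(s - (\<Sum>u\<in>U. ?a S u)) / n \<le> (s - (\<Sum>u\<in>U. ?a S u)) / s"
      using s n0 by (intro divide_left_mono) auto
    have tangent: "2 * l * ?a S u - l\<^sup>2 * s \<le> (?a S u)\<^sup>2 / s" for u
    proof -
      have "0 \<le> (?a S u - l * s)\<^sup>2 / s" using s by simp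
      also have "\<dots> = (?a S u)\<^sup>2 / s - (2 * l * ?a S u - l\<^sup>2 * s)"
        using s by (simp add: power2_diff field_simps power2_eq_square)
      finally show ?thesis by simp
    qed
    have "2 * density E S = s - 1 - real (card (adj_pairs S)) / s"
      using density_eq[OF SV] unfolding s_def .
    also have "\<dots> \<le> s - 1 - (\<Sum>u\<in>U. (?a S u)\<^sup>2 - ?a S u) / s"
      using D s by (simp add: divide_right_mono)
    also have "\<dots> = s - (\<Sum>u\<in>U. (?a S u)\<^sup>2 / s) - (s - (\<Sum>u\<in>U. ?a S u)) / s"
      using s by (simp add: sum_subtractf diff_divide_distrib sum_divide_distrib)
    also have "\<dots> \<le> s - (\<Sum>u\<in>U. 2 * l * ?a S u - l\<^sup>2 * s) - (s - (\<Sum>u\<in>U. ?a S u)) / n"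
      using w sum_mono[of U "\<lambda>u. 2 * l * ?a S u - l\<^sup>2 * s" "\<lambda>u. (?a S u)\<^sup>2 / s"] tangent by simp
    finally show ?thesis unfolding s_def .
  qed
  have Sn: "(\<Sum>S\<in>P. real (card S)) = n"
  proof -
    have "(\<Sum>S\<in>P. card S) = (\<Sum>S\<in>P. card (S \<inter> V))"
      using P partition_onD1 by (intro sum.cong) (auto intro: arg_cong[where f = card])
    also have "\<dots> = card V" using card_Int_partition_on[OF P finite_V] by simp
    finally show ?thesis unfolding n_def by (metis of_nat_sum)
  qed
  have Sa: "(\<Sum>S\<in>P. \<Sum>u\<in>U. ?a S u) = real (card U) * real r"
  proof -
    have "(\<Sum>S\<in>P. \<Sum>u\<in>U. ?a S u) = (\<Sum>u\<in>U. \<Sum>S\<in>P. ?a S u)" by (rule sum.swap)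
    also have "\<dots> = (\<Sum>u\<in>U. real r)"
      using card_Int_partition_on[OF P finite_V Z(1)] Z(2)
      by (intro sum.cong refl) (metis of_nat_sum)
    finally show ?thesis by simp
  qed
  have "2 * partition_density E P = (\<Sum>S\<in>P. 2 * density E S)"
    unfolding partition_density_def by (simp add: sum_distrib_left)
  also have "\<dots> \<le> (\<Sum>S\<in>P. real (card S) - (\<Sum>u\<in>U. 2 * l * ?a S u - l\<^sup>2 * real (card S))
      - (real (card S) - (\<Sum>u\<in>U. ?a S u)) / n)"
    using part by (intro sum_mono)
  also have "\<dots> = (\<Sum>S\<in>P. real (card S) - (2 * l * (\<Sum>u\<in>U. ?a S u) - real (card U) * l\<^sup>2 * real (card S))
      - (real (card S) - (\<Sum>u\<in>U. ?a S u)) / n)"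
    by (intro sum.cong refl) (simp add: sum_subtractf sum_distrib_left)
  also have "\<dots> = n - (2 * l * (real (card U) * real r) - real (card U) * l\<^sup>2 * n)
      - (n - real (card U) * real r) / n"
    by (simp add: sum_subtractf sum_distrib_left[symmetric] sum_divide_distrib[symmetric] Sa Sn)
  also have "\<dots> = n - 1 - real (card U) * real r * (real r - 1) / n"
    using n0 unfolding l_def by (simp add: field_simps power2_eq_square)
  finally show ?thesis unfolding n_def .
qed

text \<open>The alternatives belong to one, two, and at least three parts. A single part contains
  all edges of each cycle, at least three, hence six ordered pairs; two parts leave at least one
  edge of each odd cycle uncut; three parts may cut every edge, and then only the number of parts is
  charged.\<close>

lemma upper_bound_odd_cycles:
  assumes P: "partition_on V P" and "V \<noteq> {}"
    and U: "finite U" "disjoint_family_on Z U"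
    and Z: "\<And>u. u \<in> U \<Longrightarrow> obstruction (Z u)" and c2: "c = 2"
  shows "2 * partition_density E P \<le> real (card V) - 1 - 6 * real (card U) / real (card V) \<or>
    2 * partition_density E P \<le> real (card V) - 2 - 2 * real (card U) / real (card V) \<or>
    2 * partition_density E P \<le> real (card V) - 3"
proof -
  define n where "n = real (card V)"
  have n0: "0 < n" unfolding n_def using assms(2) finite_V by (simp add: card_gt_0_iff)
  have finP: "finite P" using P finite_V finite_elements by blast
  have "P \<noteq> {}" using P assms(2) partition_onD1 by blast
  then have k: "1 \<le> card P" using finP by (simp add: Suc_leI card_gt_0_iff)
  have obs: "Z u \<subseteq> V" "nbr_closed (Z u)" "3 \<le> card (Z u)" "\<forall>x\<in>Z u. card {y. adj x y} = 2"
    "\<exists>x\<in>Z u. \<exists>y\<in>Z u. adj x y \<and> (x \<in> S \<longleftrightarrow> y \<in> S)" if "u \<in> U" for u S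
    using Z[OF that] c2 unfolding obstruction_def by simp_all
  consider "card P = 1" | "card P = 2" | "3 \<le> card P" using k by linarith
  then show ?thesis
  proof cases
    case 1
    then obtain S where PS: "P = {S}" by (auto simp: card_1_singleton_iff)
    then have PV: "P = {V}" using partition_onD1[OF P] by simp
    have "6 \<le> card (adj_pairs (V \<inter> Z u))" if "u \<in> U" for u
    proof -
      have "adj_pairs (V \<inter> Z u) = Sigma (Z u) (\<lambda>x. {y. adj x y})"
        using obs(1,2)[OF that] unfolding adj_pairs_def nbr_closed_def by auto
      moreover have "finite (Z u)" using obs(1)[OF that] finite_V finite_subset by blast
      ultimately have "card (adj_pairs (V \<inter> Z u)) = 2 * card (Z u)"
        using finite_nbrs obs(4)[OF that] by (simp add: card_SigmaI)
      then show ?thesis using obs(3)[OF that] by simp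
    qed
    then have "(\<Sum>u\<in>U. 6) \<le> (\<Sum>u\<in>U. card (adj_pairs (V \<inter> Z u)))" by (rule sum_mono)
    also have "\<dots> \<le> card (adj_pairs V)" by (rule adj_pairs_ge_sum[OF U])
    finally have "6 * real (card U) \<le> real (card (adj_pairs V))" by simp
    then have "6 * real (card U) / n \<le> real (card (adj_pairs V)) / n"
      using n0 by (simp add: divide_right_mono)
    then show ?thesis using partition_density_eq[OF P] unfolding PV n_def by simp
  next
    case 2
    then obtain S T where PST: "P = {S, T}" "S \<noteq> T" by (auto simp: card_2_iff)
    have ST: "S \<union> T = V" "S \<inter> T = {}"
      using partition_onD1[OF P] partition_onD2[OF P] PST by (auto simp: disjoint_def)
    have "2 \<le> card (adj_pairs (S \<inter> Z u)) + card (adj_pairs (T \<inter> Z u))" if u: "u \<in> U" for u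
    proof -
      obtain x y where xy: "x \<in> Z u" "y \<in> Z u" "adj x y" "x \<in> S \<longleftrightarrow> y \<in> S" using obs(5)[OF u] by blast
      have "x \<noteq> y" using xy adj_irrefl by auto
      have two: "2 \<le> card (adj_pairs W)" if "x \<in> W" "y \<in> W" for W
      proof -
        have "{(x, y), (y, x)} \<subseteq> adj_pairs W" using that xy adj_sym by (auto simp: adj_pairs_def)
        then have "card {(x, y), (y, x)} \<le> card (adj_pairs W)" by (rule card_mono[OF finite_adj_pairs])
        then show ?thesis using \<open>x \<noteq> y\<close> by simp
      qed
      have "x \<in> V" "y \<in> V" using xy(1,2) obs(1)[OF u] by auto
      then have "(x \<in> S \<and> y \<in> S) \<or> (x \<in> T \<and> y \<in> T)" using ST xy(4) by auto
      then show ?thesis using two[of "S \<inter> Z u"] two[of "T \<inter> Z u"] xy(1,2) by auto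
    qed
    then have "(\<Sum>u\<in>U. 2) \<le> (\<Sum>u\<in>U. card (adj_pairs (S \<inter> Z u)) + card (adj_pairs (T \<inter> Z u)))"
      by (rule sum_mono)
    also have "\<dots> \<le> card (adj_pairs S) + card (adj_pairs T)"
      using adj_pairs_ge_sum[OF U, of S] adj_pairs_ge_sum[OF U, of T] by (simp add: sum.distrib)
    finally have "2 * real (card U) \<le> real (card (adj_pairs S)) + real (card (adj_pairs T))" by simp
    then have "2 * real (card U) / n \<le> (real (card (adj_pairs S)) + real (card (adj_pairs T))) / n"
      using n0 by (simp add: divide_right_mono)
    also have "\<dots> \<le> real (card (adj_pairs S)) / card S + real (card (adj_pairs T)) / card T"
      unfolding add_divide_distrib
      using card_pos_part[OF P, of S] card_pos_part[OF P, of T] PST n0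
      by (intro add_mono divide_left_mono) (auto simp: n_def)
    finally show ?thesis using partition_density_eq[OF P] PST unfolding n_def by simp
  next
    case 3
    moreover have "0 \<le> (\<Sum>S\<in>P. real (card (adj_pairs S)) / real (card S))" by (simp add: sum_nonneg)
    moreover have "3 \<le> real (card P)" using 3 by simp
    ultimately show ?thesis using partition_density_eq[OF P] by linarith
  qed
qed

section \<open>Partial colourings and the density of their classes\<close>

definition proper :: "('a \<Rightarrow> nat) \<Rightarrow> bool" where
  "proper f \<longleftrightarrow> (\<forall>x. f x \<le> c) \<and> (\<forall>x y. adj x y \<longrightarrow> f x = f y \<longrightarrow> f x = c)"

definition colour_classes :: "('a \<Rightarrow> nat) \<Rightarrow> 'a set set" where
  "colour_classes g = (\<lambda>v. {u \<in> V. g u = g v}) ` V"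

lemma partition_on_colour_classes: "partition_on V (colour_classes g)"
proof (rule partition_onI)
  show "\<Union> (colour_classes g) = V" unfolding colour_classes_def by auto
  show "{} \<notin> colour_classes g" unfolding colour_classes_def by auto
  show "disjnt p q" if "p \<in> colour_classes g" "q \<in> colour_classes g" "p \<noteq> q" for p q
    using that unfolding colour_classes_def disjnt_def by auto
qed

text \<open>Every uncoloured vertex creates at most one conflict when it joins the colour class \<open>L\<close>,
  and the conflicts are cheap because \<open>L\<close> is large.\<close>

lemma lower_bound:
  assumes f: "proper f" and "V \<noteq> {}"
    and blk: "\<And>u. u \<in> V \<Longrightarrow> f u = c \<Longrightarrow> blocked f u"
    and L: "L < c" "\<And>i. i < c \<Longrightarrow> card {x \<in> V. f x = i} \<le> card {x \<in> V. f x = L}"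
  defines "g \<equiv> \<lambda>x. if f x = c then L else f x"
    and "U \<equiv> {u \<in> V. f u = c}"
  shows "2 * partition_density E (colour_classes g) \<ge>
    real (card V) - real c - 2 * real (card U) * real c / real (card V)"
proof -
  define n where "n = card V"
  have n0: "0 < n" unfolding n_def using assms(2) finite_V by (simp add: card_gt_0_iff)
  have finU: "finite U" unfolding U_def using finite_V by simp
  define C where "C i = {x \<in> V. g x = i}" for i
  let ?P = "colour_classes g"
  have P: "partition_on V ?P" by (rule partition_on_colour_classes)
  have gc: "g x < c" for x using f L(1) unfolding g_def proper_def by (auto simp: less_le)
  have PC: "?P \<subseteq> C ` {..<c}" unfolding colour_classes_def C_def using gc by auto
  then have cP: "card ?P \<le> c" using card_mono[OF _ PC] card_image_le[of "{..<c}" C] by simp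
  have fL: "{x \<in> V. f x = L} \<inter> U = {}" using L(1) unfolding U_def by auto
  have CL: "C L = {x \<in> V. f x = L} \<union> U"
    using L(1) unfolding C_def g_def U_def by auto
  have Ci: "C i = {x \<in> V. f x = i}" if "i < c" "i \<noteq> L" for i
    using that unfolding C_def g_def by auto
  have cCL: "card (C L) = card {x \<in> V. f x = L} + card U"
    unfolding CL using finite_V finU fL by (intro card_Un_disjoint) auto
  have le: "card (C i) \<le> card (C L)" if "i < c" for i
    using Ci[OF that] L(2)[OF that] cCL by (cases "i = L") auto
  \<comment> \<open>After filling, \<open>C L\<close> is the largest of at most \<open>c\<close>
    classes that cover \<open>V\<close>, so it has at least \<open>n / c\<close> vertices.\<close>
  have "n = card (\<Union>i\<in>{..<c}. C i)"
    unfolding n_def C_def using gc by (intro arg_cong[where f = card]) auto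
  also have "\<dots> = (\<Sum>i<c. card (C i))"
    using finite_V by (intro card_UN_disjoint) (auto simp: C_def)
  also have "\<dots> \<le> (\<Sum>i<c. card (C L))" using le by (intro sum_mono) auto
  finally have large: "n \<le> c * card (C L)" by simp
  then have CL0: "0 < card (C L)" using n0 by (cases "card (C L)") auto
  have zero: "card (adj_pairs S) = 0" if "S \<in> ?P" "S \<noteq> C L" for S
  proof -
    have "S \<in> C ` {..<c}" using that(1) PC by blast
    then obtain i where i: "i < c" "S = C i" by auto
    then have "S = {x \<in> V. f x = i}" using Ci that by auto
    then have "adj_pairs S = {}" using f i(1) unfolding adj_pairs_def proper_def by fastforce
    then show ?thesis by simp
  qed
  have pairs: "adj_pairs (C L) \<subseteq>
    (\<Union>u\<in>U. {u} \<times> {y. adj u y \<and> f y = L}) \<union> (\<Union>u\<in>U. {y. adj u y \<and> f y = L} \<times> {u})"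
  proof
    fix p assume "p \<in> adj_pairs (C L)"
    then obtain x y where p: "p = (x, y)" "x \<in> C L" "y \<in> C L" "adj x y"
      unfolding adj_pairs_def by auto
    \<comment> \<open>The component of \<open>u\<close> has no other uncoloured vertex, so two
      given-up vertices are never adjacent and each conflict has an end of original colour
      \<open>L\<close>.\<close>
    have nU: "f z = L" if "u \<in> U" "adj u z" "z \<in> C L" for u z
    proof -
      have "u \<in> V" "f u = c" using that(1) unfolding U_def by auto
      from blk[OF this] obtain W where W: "obstruction W" "{x \<in> W. f x = c} = {u}"
        unfolding blocked_def by blast
      then have "u \<in> W" "z \<in> W" using that(2) unfolding obstruction_def nbr_closed_def by auto
      have "z \<noteq> u" using that(2) adj_irrefl by auto
      then have "f z \<noteq> c" using W(2) \<open>z \<in> W\<close> by auto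
      then show ?thesis using that(3) unfolding CL U_def by auto
    qed
    have "x \<in> U \<or> y \<in> U"
    proof (rule ccontr)
      assume "\<not> ?thesis"
      then have "f x = L" "f y = L" using p(2,3) unfolding CL by auto
      then show False using f p(4) L(1) unfolding proper_def by fastforce
    qed
    then show "p \<in> (\<Union>u\<in>U. {u} \<times> {y. adj u y \<and> f y = L}) \<union> (\<Union>u\<in>U. {y. adj u y \<and> f y = L} \<times> {u})"
      using nU[of x y] nU[of y x] p adj_sym by auto
  qed
  have one: "card {y. adj u y \<and> f y = L} \<le> 1" if "u \<in> U" for u
  proof -
    have "inj_on f {y. adj u y}" using blk that unfolding U_def blocked_def by auto
    then have "\<And>x y. x \<in> {y. adj u y \<and> f y = L} \<Longrightarrow> y \<in> {y. adj u y \<and> f y = L} \<Longrightarrow> x = y"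
      unfolding inj_on_def by auto
    then show ?thesis using card_le_Suc0_iff_eq[of "{y. adj u y \<and> f y = L}"] finite_nbrs[of u]
      by (simp add: finite_subset[of _ "{y. adj u y}"])
  qed
  have finL: "finite {y. adj u y \<and> f y = L}" for u
    using finite_nbrs[of u] by (rule finite_subset[rotated]) auto
  have b1: "card (\<Union>u\<in>U. {u} \<times> {y. adj u y \<and> f y = L}) \<le> card U"
  proof -
    have "card (\<Union>u\<in>U. {u} \<times> {y. adj u y \<and> f y = L}) \<le> (\<Sum>u\<in>U. card ({u} \<times> {y. adj u y \<and> f y = L}))"
      using finU by (rule card_UN_le)
    also have "\<dots> \<le> (\<Sum>u\<in>U. 1)" using one by (intro sum_mono) (simp add: card_cartesian_product)
    finally show ?thesis by simp
  qed
  have b2: "card (\<Union>u\<in>U. {y. adj u y \<and> f y = L} \<times> {u}) \<le> card U"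
  proof -
    have "card (\<Union>u\<in>U. {y. adj u y \<and> f y = L} \<times> {u}) \<le> (\<Sum>u\<in>U. card ({y. adj u y \<and> f y = L} \<times> {u}))"
      using finU by (rule card_UN_le)
    also have "\<dots> \<le> (\<Sum>u\<in>U. 1)" using one by (intro sum_mono) (simp add: card_cartesian_product)
    finally show ?thesis by simp
  qed
  have "card (adj_pairs (C L)) \<le>
      card ((\<Union>u\<in>U. {u} \<times> {y. adj u y \<and> f y = L}) \<union> (\<Union>u\<in>U. {y. adj u y \<and> f y = L} \<times> {u}))"
    using finU finL by (intro card_mono pairs) auto
  also have "\<dots> \<le> card (\<Union>u\<in>U. {u} \<times> {y. adj u y \<and> f y = L}) + card (\<Union>u\<in>U. {y. adj u y \<and> f y = L} \<times> {u})"
    by (rule card_Un_le)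
  finally have DL: "card (adj_pairs (C L)) \<le> 2 * card U" using b1 b2 by simp
  have "C L \<noteq> {}" using CL0 by auto
  then have CLP: "C L \<in> ?P" unfolding colour_classes_def C_def by auto
  have "finite ?P" using finite_V unfolding colour_classes_def by simp
  then have "(\<Sum>S\<in>?P. real (card (adj_pairs S)) / real (card S)) = real (card (adj_pairs (C L))) / real (card (C L))"
    using zero CLP by (subst sum.remove[of _ "C L"]) auto
  also have "\<dots> \<le> real (2 * card U) / real (card (C L))"
    using DL by (intro divide_right_mono) (simp_all only: of_nat_le_iff of_nat_0_le_iff)
  also have "\<dots> \<le> 2 * real (card U) * real c / real n"
  proof -
    have "real n \<le> real c * real (card (C L))" using large by (metis of_nat_le_iff of_nat_mult)
    then have "2 * real (card U) * real n \<le> 2 * real (card U) * (real c * real (card (C L)))"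
      by (intro mult_left_mono) auto
    then show ?thesis using n0 CL0 by (simp add: field_simps)
  qed
  finally show ?thesis using partition_density_eq[OF P] cP unfolding n_def by simp
qed

text \<open>If the components of \<open>u\<close> and \<open>v\<close> met, minimality would put
  \<open>u\<close> into \<open>Z v\<close>, whose only uncoloured vertex is
  \<open>v\<close>.\<close>

lemma blocked_family:
  assumes "\<And>u. u \<in> U \<Longrightarrow> f u = c \<and> blocked f u"
  shows "\<exists>Z. disjoint_family_on Z U \<and> (\<forall>u\<in>U. obstruction (Z u))"
proof -
  have "\<forall>u\<in>U. \<exists>Z. obstruction Z \<and> {x \<in> Z. f x = c} = {u}" using assms unfolding blocked_def by blast
  then obtain Z where Z: "\<And>u. u \<in> U \<Longrightarrow> obstruction (Z u) \<and> {x \<in> Z u. f x = c} = {u}" by metis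
  have "Z u \<inter> Z v = {}" if "u \<in> U" "v \<in> U" "u \<noteq> v" for u v
  proof (rule ccontr)
    assume "Z u \<inter> Z v \<noteq> {}"
    moreover have "nbr_closed (Z v)" using Z[OF that(2)] unfolding obstruction_def by simp
    moreover have "\<forall>Y. nbr_closed Y \<longrightarrow> Y \<inter> Z u \<noteq> {} \<longrightarrow> Z u \<subseteq> Y"
      using Z[OF that(1)] unfolding obstruction_def by simp
    ultimately have "Z u \<subseteq> Z v" by (metis inf_commute)
    moreover have "u \<in> Z u \<and> f u = c" using Z[OF that(1)] by auto
    ultimately have "u \<in> {x \<in> Z v. f x = c}" by auto
    then show False using Z[OF that(2)] that(3) by auto
  qed
  then show ?thesis using Z unfolding disjoint_family_on_def by blast
qed

text \<open>Cross-multiplied against the ratio (n - 1) / (n - c), the claim says that the loss of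
  the upper bound weighted with n - c is at least the loss of the lower bound weighted with n - 1.
  The abstract \<open>R\<close> dominates this ratio; \<open>1 \<le> R\<close> moreover makes it
  nonnegative where the optimum vanishes.\<close>

theorem approximation:
  assumes f: "proper f" and "V \<noteq> {}"
    and blk: "\<And>u. u \<in> V \<Longrightarrow> f u = c \<Longrightarrow> blocked f u"
    and L: "L < c" "\<And>i. i < c \<Longrightarrow> card {x \<in> V. f x = i} \<le> card {x \<in> V. f x = L}"
    and R: "1 \<le> R" "real (card V) - 1 \<le> R * (real (card V) - real c)"
    and Q: "partition_on V Q"
  shows "partition_density E Q \<le>
    R * partition_density E (colour_classes (\<lambda>x. if f x = c then L else f x))"
proof -
  define n where "n = real (card V)"
  define U where "U = {u \<in> V. f u = c}"
  define t where "t = real (card U)"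
  define X where "X = 2 * partition_density E (colour_classes (\<lambda>x. if f x = c then L else f x))"
  define Y where "Y = 2 * partition_density E Q"
  have n1: "1 \<le> n" unfolding n_def using assms(2) finite_V by (simp add: card_gt_0_iff Suc_leI)
  have finU: "finite U" unfolding U_def using finite_V by simp
  have X: "n - real c - 2 * t * real c / n \<le> X"
    using lower_bound[OF f \<open>V \<noteq> {}\<close> blk L] unfolding n_def t_def U_def X_def by simp
  have X0: "0 \<le> X" unfolding X_def using partition_density_nonneg by simp
  have Y1: "Y \<le> n - 1" unfolding Y_def n_def by (rule upper_bound[OF Q \<open>V \<noteq> {}\<close>])
  have R': "n - 1 \<le> R * (n - real c)" using R(2) unfolding n_def .
  have "Y \<le> R * X"
  proof (cases "U = {}")
    case True
    then have "n - real c \<le> X" using X unfolding t_def by simp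
    then have "R * (n - real c) \<le> R * X" using R(1) by (intro mult_left_mono) auto
    then show ?thesis using Y1 R' by linarith
  next
    case False
    obtain Z where Z: "disjoint_family_on Z U" "\<And>u. u \<in> U \<Longrightarrow> obstruction (Z u)"
      using blocked_family[of U f] blk unfolding U_def by blast
    have ZV: "Z u \<subseteq> V" "finite (Z u)" if "u \<in> U" for u
      using Z(2)[OF that] finite_V finite_subset unfolding obstruction_def by blast+
    have Zc: "c + 1 \<le> card (Z u)" if "u \<in> U" for u
      using Z(2)[OF that] unfolding obstruction_def by (auto split: if_splits)
    have "(\<Sum>u\<in>U. c + 1) \<le> (\<Sum>u\<in>U. card (Z u))" using Zc by (intro sum_mono)
    also have "\<dots> = card (\<Union>u\<in>U. Z u)"
      using finU ZV Z(1) by (intro card_UN_disjoint[symmetric]) (auto simp: disjoint_family_on_def)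
    also have "\<dots> \<le> card V" using ZV finite_V by (intro card_mono) auto
    finally have "card U * (c + 1) \<le> card V" by simp
    then have "real (card U * (c + 1)) \<le> n" unfolding n_def by (rule of_nat_mono)
    then have tc: "t * (real c + 1) \<le> n" unfolding t_def by (simp add: algebra_simps)
    have t1: "1 \<le> t" unfolding t_def using False finU by (simp add: card_gt_0_iff Suc_leI)
    have cn: "real c + 1 \<le> n" 
    proof -
      have "1 * (real c + 1) \<le> t * (real c + 1)" using t1 by (intro mult_right_mono) auto
      also note tc
      finally show ?thesis by simp
    qed
    have c1: "1 \<le> real c" using L(1) by simp
    have RX: "(n - 1) * X \<le> R * (n - real c) * X" using R' X0 by (rule mult_right_mono)
    have enough: "Y \<le> R * X" if "(n - real c) * Y \<le> (n - 1) * X"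
    proof -
      have "(n - real c) * Y \<le> (n - real c) * (R * X)" using that RX by (simp add: mult_ac)
      then show ?thesis using cn by (simp add: mult_le_cancel_left_pos)
    qed
    have Xn: "(n - 1) * (n - real c - 2 * t * real c / n) \<le> (n - 1) * X"
      using X n1 by (intro mult_left_mono) auto
    have clique_case: ?thesis
      if cl: "\<And>u x y. u \<in> U \<Longrightarrow> x \<in> Z u \<Longrightarrow> y \<in> Z u \<Longrightarrow> x \<noteq> y \<Longrightarrow> adj x y"
        and cd: "\<And>u. u \<in> U \<Longrightarrow> card (Z u) = c + 1"
    proof -
      have Y: "Y \<le> n - 1 - t * (real c + 1) * real c / n"
      proof -
        have "Y \<le> n - 1 - t * real (c + 1) * (real (c + 1) - 1) / n"
          unfolding Y_def n_def t_def
          by (rule upper_bound_cliques[OF Q \<open>V \<noteq> {}\<close> finU Z(1) ZV(1) cd cl])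
        then show ?thesis by (simp add: add.commute)
      qed
      show ?thesis
      proof (cases "real c + 2 \<le> n")
        case True
        \<comment> \<open>This product is exactly the difference of the two sides of
          \<open>prod\<close>, and \<open>prod\<close> compares the losses per unit of
          \<open>T\<close>.\<close>
        have "0 \<le> (real c - 1) * (n - 2 - real c)" using True c1 by simp
        then have prod: "2 * (n - 1) \<le> (n - real c) * (real c + 1)" by (simp add: algebra_simps)
        define T where "T = t * real c / n"
        have "0 \<le> T" using t1 c1 n1 unfolding T_def by simp
        with prod have "T * (2 * (n - 1)) \<le> T * ((n - real c) * (real c + 1))"
          by (rule mult_left_mono)
        then have "(n - real c) * (n - 1 - T * (real c + 1)) \<le> (n - 1) * (n - real c - 2 * T)"
          by (simp add: algebra_simps)
        moreover have "t * (real c + 1) * real c / n = T * (real c + 1)" "2 * t * real c / n = 2 * T"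
          unfolding T_def by simp_all
        ultimately have "(n - real c) * (n - 1 - t * (real c + 1) * real c / n)
            \<le> (n - 1) * (n - real c - 2 * t * real c / n)"
          by simp
        moreover have "(n - real c) * Y \<le> (n - real c) * (n - 1 - t * (real c + 1) * real c / n)"
          using Y cn by (intro mult_left_mono) auto
        ultimately show ?thesis using enough Xn by linarith
      next
        \<comment> \<open>Now one clique of the complement fills \<open>V\<close>, so G is edgeless;
          accordingly the upper bound drops to 0.\<close>
        case False
        then have "\<not> real (c + 2) \<le> real (card V)" unfolding n_def by simp
        then have "\<not> c + 2 \<le> card V" by (simp only: of_nat_le_iff not_False_eq_True)
        moreover have "c + 1 \<le> card V"
          using cn unfolding n_def by (metis of_nat_1 of_nat_add of_nat_le_iff)
        ultimately have "card V = c + 1" by linarith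
        then have n: "n = real c + 1" unfolding n_def by simp
        then have "t * (real c + 1) * real c / n = t * real c" by simp
        moreover have "1 * real c \<le> t * real c" using t1 by (intro mult_right_mono) auto
        ultimately have "Y \<le> 0" using Y n by simp
        then show ?thesis using X0 R(1) by (meson mult_nonneg_nonneg order_trans zero_le_one)
      qed
    qed
    show ?thesis
    proof (cases "c = 2")
      case False
      then show ?thesis using Z(2) unfolding obstruction_def by (intro clique_case) (metis, metis)
    next
      case True
      show ?thesis
      proof (cases "card V = 3")
        \<comment> \<open>On three vertices the odd cycle is a triangle and counts as a clique. The
          first odd-cycle bound is strong enough only from \<open>n = 4\<close> on.\<close>
        case True
        have Z3: "card (Z u) = 3" if "u \<in> U" for u
          using Zc[OF that] card_mono[OF finite_V ZV(1)[OF that]] True \<open>c = 2\<close> by simp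
        have "adj x y" if u: "u \<in> U" and xy: "x \<in> Z u" "y \<in> Z u" "x \<noteq> y" for u x y
        proof -
          have "nbr_closed (Z u)" "card {y. adj x y} = 2"
            using Z(2)[OF u] xy(1) \<open>c = 2\<close> unfolding obstruction_def by auto
          then have "{y. adj x y} \<subseteq> Z u - {x}" using xy(1) adj_irrefl unfolding nbr_closed_def by auto
          moreover have "card (Z u - {x}) = 2" using Z3[OF u] xy(1) ZV(2)[OF u] by simp
          ultimately have "{y. adj x y} = Z u - {x}"
            using \<open>card {y. adj x y} = 2\<close> ZV(2)[OF u] by (intro card_subset_eq) auto
          then show ?thesis using xy by auto
        qed
        then show ?thesis using Z3 \<open>c = 2\<close> by (intro clique_case) auto
      next
        case n3: False
        have t3: "3 * t \<le> n" using tc \<open>c = 2\<close> by simp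
        have "3 \<le> card V" using cn \<open>c = 2\<close> unfolding n_def by simp
        then have n4: "4 \<le> n" using n3 unfolding n_def by simp
        have Xn: "(n - 1) * (n - 2 - 4 * t / n) \<le> (n - 1) * X" using Xn \<open>c = 2\<close> by simp
        have tn: "0 \<le> t / n" "t / n \<le> 1 / 3" using t1 n1 t3 by (auto simp: field_simps)
        \<comment> \<open>For \<open>6 \<le> n\<close> this follows from
          \<open>3 * t \<le> n\<close>; for smaller \<open>n\<close> the integrality of
          \<open>t\<close> leaves at most one given-up vertex.\<close>
        have tt: "2 * t \<le> n - 2"
        proof (cases "6 \<le> n")
          case False
          then have "t < 2" using t3 by linarith
          then have "card U < 2" unfolding t_def by simp
          then have "t \<le> 1" unfolding t_def by simp
          then show ?thesis using n4 by simp
        qed (use t3 in linarith)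
        have A: "(n - 2) * B \<le> (n - 1) * (n - 2 - 4 * t / n) \<Longrightarrow> Y \<le> B \<Longrightarrow> ?thesis" for B
        proof -
          assume "(n - 2) * B \<le> (n - 1) * (n - 2 - 4 * t / n)" "Y \<le> B"
          moreover then have "(n - 2) * Y \<le> (n - 2) * B" using n4 by (intro mult_left_mono) auto
          ultimately show ?thesis using enough Xn \<open>c = 2\<close> by simp
        qed
        from upper_bound_odd_cycles[OF Q \<open>V \<noteq> {}\<close> finU Z \<open>c = 2\<close>]
        consider "Y \<le> n - 1 - 6 * t / n" | "Y \<le> n - 2 - 2 * t / n" | "Y \<le> n - 3"
          unfolding Y_def n_def t_def by blast
        then show ?thesis
        proof cases
          case 1
          define T where "T = t / n"
          have "T * (4 * (n - 1)) \<le> T * (6 * (n - 2))"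
            using tn n4 unfolding T_def by (intro mult_left_mono) auto
          then have "(n - 2) * (n - 1 - 6 * T) \<le> (n - 1) * (n - 2 - 4 * T)"
            by (simp add: algebra_simps)
          then show ?thesis unfolding T_def by (intro A[OF _ 1]) simp
        next
          case 2
          have "(n - 2) * (n - 2 - 2 * t / n) = (n - 2) * (n - 2) - 2 * t + 4 * (t / n)"
            using n1 by (simp add: field_simps)
          moreover have "(n - 1) * (n - 2 - 4 * t / n) = (n - 1) * (n - 2) - 4 * t + 4 * (t / n)"
            using n1 by (simp add: field_simps)
          moreover have "(n - 1) * (n - 2) = (n - 2) * (n - 2) + (n - 2)" by (simp add: algebra_simps)
          ultimately show ?thesis using tt by (intro A[OF _ 2]) linarith
        next
          case 3
          have "(n - 1) * (n - 2 - 4 * t / n) = (n - 1) * (n - 2) - 4 * t + 4 * (t / n)"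
            using n1 by (simp add: field_simps)
          also have "(n - 1) * (n - 2) = (n - 2) * (n - 3) + 2 * (n - 2)" by (simp add: algebra_simps)
          finally show ?thesis using tt tn(1) by (intro A[OF _ 3]) simp
        qed
      qed
    qed
  qed
  then show ?thesis unfolding X_def Y_def by simp
qed

end

section \<open>Programs with bounded loops\<close>

text \<open>All loops count up to the fixed value of \<open>n\<close>, so termination and polynomial
  time can be read off the syntax.\<close>

datatype prog =
    Nop
  | Asg string aexp aexp
  | Sq prog prog (infixr ";;" 60)
  | Cnd bexp prog prog
  | For string prog

abbreviation Var :: "string \<Rightarrow> aexp" where
  "Var x \<equiv> Cell x (N 0)"

primrec compile :: "prog \<Rightarrow> com" where
  "compile Nop = Skip"
| "compile (Asg x i a) = Assign x i a"
| "compile (p ;; q) = Seq (compile p) (compile q)"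
| "compile (Cnd b p q) = If b (compile p) (compile q)"
| "compile (For x p) = Seq (Assign x (N 0) (N 0))
     (While (Less (Var x) (Var ''n'')) (Seq (compile p) (Assign x (N 0) (Plus (Var x) (N 1)))))"

definition upd :: "memory \<Rightarrow> string \<Rightarrow> nat \<Rightarrow> nat \<Rightarrow> memory" where
  "upd s x i v = s(x := (s x)(i := v))"

lemma upd_same [simp]: "upd s x i v x = (s x)(i := v)"
  and upd_other [simp]: "y \<noteq> x \<Longrightarrow> upd s x i v y = s y"
  by (simp_all add: upd_def)

primrec den :: "prog \<Rightarrow> memory \<Rightarrow> memory" where
  "den Nop s = s"
| "den (Asg x i a) s = upd s x (aval i s) (aval a s)"
| "den (p ;; q) s = den q (den p s)"
| "den (Cnd b p q) s = (if bval b s then den p s else den q s)"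
| "den (For x p) s = ((\<lambda>s. upd (den p s) x 0 (den p s x 0 + 1)) ^^ s ''n'' 0) (upd s x 0 0)"

declare den.simps(5) [simp del]

primrec writes :: "prog \<Rightarrow> string set" where
  "writes Nop = {}"
| "writes (Asg x i a) = {x}"
| "writes (p ;; q) = writes p \<union> writes q"
| "writes (Cnd b p q) = writes p \<union> writes q"
| "writes (For x p) = insert x (writes p)"

text \<open>With counter and bound protected from the body, the compiled while loop makes exactly
  the rounds that \<open>den\<close> iterates.\<close>

primrec wf_prog :: "prog \<Rightarrow> bool" where
  "wf_prog Nop \<longleftrightarrow> True"
| "wf_prog (Asg x i a) \<longleftrightarrow> x \<noteq> ''n''"
| "wf_prog (p ;; q) \<longleftrightarrow> wf_prog p \<and> wf_prog q"
| "wf_prog (Cnd b p q) \<longleftrightarrow> wf_prog p \<and> wf_prog q"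
| "wf_prog (For x p) \<longleftrightarrow> wf_prog p \<and> x \<notin> writes p \<and> x \<noteq> ''n''"

lemma wf_prog_n: "wf_prog p \<Longrightarrow> ''n'' \<notin> writes p"
  by (induction p) auto

lemma den_frame: "x \<notin> writes p \<Longrightarrow> den p s x = s x"
proof (induction p arbitrary: s)
  case (For y p)
  have "((\<lambda>s. upd (den p s) y 0 (den p s y 0 + 1)) ^^ k) s' x = s' x" for k s'
    using For by (induction k) auto
  then show ?case using For.prems by (simp add: den.simps(5))
qed auto

lemma den_For:
  assumes "wf_prog (For x p)"
    and init: "I 0 (upd s x 0 0)"
    and step: "\<And>k s'. k < s ''n'' 0 \<Longrightarrow> s' x 0 = k \<Longrightarrow> s' ''n'' 0 = s ''n'' 0 \<Longrightarrow> I k s' \<Longrightarrow>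
      I (Suc k) (upd (den p s') x 0 (Suc k))"
  shows "I (s ''n'' 0) (den (For x p) s)"
proof -
  have wf: "x \<notin> writes p" "x \<noteq> ''n''" "''n'' \<notin> writes p"
    using assms(1) wf_prog_n by auto
  let ?it = "\<lambda>k. ((\<lambda>s. upd (den p s) x 0 (den p s x 0 + 1)) ^^ k) (upd s x 0 0)"
  have "I k (?it k) \<and> ?it k x 0 = k \<and> ?it k ''n'' 0 = s ''n'' 0" if "k \<le> s ''n'' 0" for k
    using that
  proof (induction k)
    case 0
    then show ?case using init wf by simp
  next
    case (Suc k)
    then have IH: "I k (?it k)" "?it k x 0 = k" "?it k ''n'' 0 = s ''n'' 0" by auto
    have "?it (Suc k) = upd (den p (?it k)) x 0 (Suc k)"
      using IH(2) den_frame[OF wf(1)] by simp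
    then show ?case
      using step[OF _ IH(2,3,1)] Suc.prems IH(3) wf den_frame[OF wf(3)] by simp
  qed
  then show ?thesis by (simp add: den.simps(5))
qed

text \<open>The nesting depth is a constant of the program: sequencing and branching add
  polynomials, and a loop multiplies by \<open>n\<close>. Since \<open>''n''\<close> is never
  written, all these polynomials are evaluated at the same number.\<close>

lemma exec_compile:
  "wf_prog p \<Longrightarrow> \<exists>q :: nat poly. \<forall>s. \<exists>t \<le> poly q (s ''n'' 0). exec (compile p) s t (den p s)"
proof (induction p)
  case Nop
  have "exec Skip s 1 s" for s by (rule exec_Skip)
  then show ?case by (intro exI[of _ "[:1:]"]) auto
next
  case (Asg x i a)
  have "exec (Assign x i a) s (1 + acost i + acost a) (upd s x (aval i s) (aval a s))" for s
    unfolding upd_def by (rule exec_Assign)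
  then show ?case by (intro exI[of _ "[:1 + acost i + acost a:]"]) auto
next
  case (Sq p q)
  then obtain P Q :: "nat poly" where
    P: "\<And>s. \<exists>t \<le> poly P (s ''n'' 0). exec (compile p) s t (den p s)" and
    Q: "\<And>s. \<exists>t \<le> poly Q (s ''n'' 0). exec (compile q) s t (den q s)" by auto
  have n: "den p s ''n'' 0 = s ''n'' 0" for s
    using Sq.prems wf_prog_n by (simp add: den_frame)
  have "\<exists>t \<le> poly (P + Q) (s ''n'' 0). exec (compile (p ;; q)) s t (den (p ;; q) s)" for s
  proof -
    obtain t u where tu: "t \<le> poly P (s ''n'' 0)" "exec (compile p) s t (den p s)"
      "u \<le> poly Q (den p s ''n'' 0)" "exec (compile q) (den p s) u (den q (den p s))"
      using P Q by metis
    then have "exec (compile (p ;; q)) s (t + u) (den (p ;; q) s)" by (auto intro: exec_Seq)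
    moreover have "t + u \<le> poly (P + Q) (s ''n'' 0)" using tu(1,3) n by simp
    ultimately show ?thesis by blast
  qed
  then show ?case by blast
next
  case (Cnd b p q)
  then obtain P Q :: "nat poly" where
    P: "\<And>s. \<exists>t \<le> poly P (s ''n'' 0). exec (compile p) s t (den p s)" and
    Q: "\<And>s. \<exists>t \<le> poly Q (s ''n'' 0). exec (compile q) s t (den q s)" by auto
  have "\<exists>t \<le> poly ([:1 + bcost b:] + P + Q) (s ''n'' 0). exec (compile (Cnd b p q)) s t (den (Cnd b p q) s)" for s
  proof (cases "bval b s")
    case True
    obtain t where t: "t \<le> poly P (s ''n'' 0)" "exec (compile p) s t (den p s)" using P by metis
    have "exec (compile (Cnd b p q)) s (1 + bcost b + t) (den (Cnd b p q) s)"
      using exec_IfTrue[OF True t(2)] True by simp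
    then show ?thesis using t(1) by (intro exI[of _ "1 + bcost b + t"]) simp
  next
    case False
    obtain t where t: "t \<le> poly Q (s ''n'' 0)" "exec (compile q) s t (den q s)" using Q by metis
    have "exec (compile (Cnd b p q)) s (1 + bcost b + t) (den (Cnd b p q) s)"
      using exec_IfFalse[OF False t(2)] False by simp
    then show ?thesis using t(1) by (intro exI[of _ "1 + bcost b + t"]) simp
  qed
  then show ?case by blast
next
  case (For x p)
  then obtain P :: "nat poly" where
    P: "\<And>s. \<exists>t \<le> poly P (s ''n'' 0). exec (compile p) s t (den p s)" by auto
  have wf: "x \<notin> writes p" "x \<noteq> ''n''" "''n'' \<notin> writes p"
    using For.prems wf_prog_n by auto
  define st where "st s = upd (den p s) x 0 (den p s x 0 + 1)" for s
  define test where "test = Less (Var x) (Var ''n'')"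
  define body where "body = Seq (compile p) (Assign x (N 0) (Plus (Var x) (N 1)))"
  have st: "st s ''n'' 0 = s ''n'' 0" "st s x 0 = Suc (s x 0)" for s
    using wf unfolding st_def by (simp_all add: den_frame)
  have body: "\<exists>t \<le> poly P (s ''n'' 0) + 6. exec body s t (st s)" for s
  proof -
    obtain t where t: "t \<le> poly P (s ''n'' 0)" "exec (compile p) s t (den p s)" using P by metis
    have "exec (Assign x (N 0) (Plus (Var x) (N 1))) (den p s) 6 (st s)"
      using exec_Assign[of x "N 0" "Plus (Var x) (N 1)" "den p s"]
      unfolding st_def upd_def by (simp add: numeral_eq_Suc)
    then have "exec body s (t + 6) (st s)" unfolding body_def using t(2) by (auto intro!: exec_Seq)
    then show ?thesis using t(1) by (intro exI[of _ "t + 6"]) simp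
  qed
  \<comment> \<open>Each round pays 6 for the test and 6 for incrementing the counter on top of the
    body; the final 6 is the failing test.\<close>
  have loop: "\<exists>t \<le> m * (poly P (s ''n'' 0) + 12) + 6. exec (While test body) s t ((st ^^ m) s)"
    if "s x 0 + m = s ''n'' 0" for m s
    using that
  proof (induction m arbitrary: s)
    case 0
    then have "exec (While test body) s (1 + bcost test) s"
      by (intro exec_WhileFalse) (simp add: test_def)
    then show ?case by (intro exI[of _ "1 + bcost test"]) (simp add: test_def)
  next
    case (Suc m)
    have b: "bval test s" using Suc.prems by (simp add: test_def)
    obtain t where t: "t \<le> poly P (s ''n'' 0) + 6" "exec body s t (st s)" using body by metis
    obtain u where u: "u \<le> m * (poly P (st s ''n'' 0) + 12) + 6"
      "exec (While test body) (st s) u ((st ^^ m) (st s))"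
      using Suc.IH[of "st s"] Suc.prems st by auto
    have "exec (While test body) s (1 + bcost test + t + u) ((st ^^ Suc m) s)"
      using exec_WhileTrue[OF b t(2) u(2)] by (simp add: funpow_swap1)
    moreover have "1 + bcost test + t + u \<le> Suc m * (poly P (s ''n'' 0) + 12) + 6"
      using t(1) u(1) st by (simp add: test_def)
    ultimately show ?case by blast
  qed
  \<comment> \<open>The 9 consists of 3 steps for initialising the counter and 6 for the failing
    test.\<close>
  have "\<exists>t \<le> poly (pCons 9 (P + [:12:])) (s ''n'' 0). exec (compile (For x p)) s t (den (For x p) s)" for s
  proof -
    obtain t where
      t: "t \<le> s ''n'' 0 * (poly P (s ''n'' 0) + 12) + 6"
      "exec (While test body) (upd s x 0 0) t ((st ^^ (s ''n'' 0)) (upd s x 0 0))"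
      using loop[of "upd s x 0 0" "s ''n'' 0"] wf by auto
    have "exec (Assign x (N 0) (N 0)) s 3 (upd s x 0 0)"
      using exec_Assign[of x "N 0" "N 0" s] unfolding upd_def by (simp add: numeral_eq_Suc)
    from exec_Seq[OF this t(2)] have "exec (compile (For x p)) s (3 + t) (den (For x p) s)"
      unfolding test_def body_def st_def by (simp add: den.simps(5))
    then show ?thesis using t(1) by (intro exI[of _ "3 + t"]) simp
  qed
  then show ?case by blast
qed

section \<open>Counting and searching loops\<close>

lemma count_loop:
  assumes "cnt \<noteq> y" "cnt \<noteq> ''n''" "y \<noteq> ''n''"
    and B: "\<And>s' k. k < s ''n'' 0 \<Longrightarrow> s' y 0 = k \<Longrightarrow> (\<And>z. z \<noteq> y \<Longrightarrow> z \<noteq> cnt \<Longrightarrow> s' z = s z) \<Longrightarrow>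
      bval B s' \<longleftrightarrow> P k"
  shows "den (For y (Cnd B (Asg cnt (N 0) (Plus (Var cnt) (N 1))) Nop)) s cnt 0 =
    s cnt 0 + card {k. k < s ''n'' 0 \<and> P k}"
proof -
  let ?I = "\<lambda>k s'. (\<forall>z. z \<noteq> y \<longrightarrow> z \<noteq> cnt \<longrightarrow> s' z = s z) \<and> s' cnt 0 = s cnt 0 + card {j. j < k \<and> P j}"
  have ins: "card {j. j < Suc k \<and> P j} = card {j. j < k \<and> P j} + (if P k then 1 else 0)" for k
  proof -
    have "{j. j < Suc k \<and> P j} = (if P k then insert k {j. j < k \<and> P j} else {j. j < k \<and> P j})"
      by (auto simp: less_Suc_eq)
    then show ?thesis by simp
  qed
  have "?I (s ''n'' 0) (den (For y (Cnd B (Asg cnt (N 0) (Plus (Var cnt) (N 1))) Nop)) s)"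
    using assms(1-3)
    by (intro den_For[where I = ?I]) (auto simp: B ins)
  then show ?thesis by simp
qed

text \<open>The loop keeps the last match. When the token is moved, saturation makes the match
  unique.\<close>

lemma search_loop:
  assumes "x \<noteq> y" "x \<noteq> ''n''" "y \<noteq> ''n''"
    and B: "\<And>s' k. k < s ''n'' 0 \<Longrightarrow> s' y 0 = k \<Longrightarrow> (\<And>z. z \<noteq> y \<Longrightarrow> z \<noteq> x \<Longrightarrow> s' z = s z) \<Longrightarrow>
      bval B s' \<longleftrightarrow> P k"
    and ex: "k < s ''n'' 0" "P k"
  shows "den (For y (Cnd B (Asg x (N 0) (Var y)) Nop)) s x 0 < s ''n'' 0 \<and>
    P (den (For y (Cnd B (Asg x (N 0) (Var y)) Nop)) s x 0)"
proof -
  let ?I = "\<lambda>k s'. (\<forall>z. z \<noteq> y \<longrightarrow> z \<noteq> x \<longrightarrow> s' z = s z) \<and>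
    ((\<exists>j<k. P j) \<longrightarrow> s' x 0 < k \<and> P (s' x 0))"
  have "?I (s ''n'' 0) (den (For y (Cnd B (Asg x (N 0) (Var y)) Nop)) s)"
    using assms(1-3)
    by (intro den_For[where I = ?I]) (auto simp: B less_Suc_eq)
  then show ?thesis using ex by blast
qed

section \<open>The algorithm and its correctness\<close>

context complement_graph
begin

text \<open>The last clause says that nothing happens outside the component of the start vertex \<open>u\<close>;
  it protects the obstructions found earlier.\<close>

definition token_inv :: "('a \<Rightarrow> nat) \<Rightarrow> 'a \<Rightarrow> ('a \<Rightarrow> nat) \<Rightarrow> 'a \<Rightarrow> bool \<Rightarrow> bool" where
  "token_inv f0 u f w finished \<longleftrightarrow> proper f \<and>
     {x \<in> V. f x = c} = (if finished then {} else {w}) \<union> ({x \<in> V. f0 x = c} - {u}) \<and>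
     (\<not> finished \<longrightarrow> w \<in> V \<and> \<not> (f0 w = c \<and> w \<noteq> u)) \<and>
     (\<forall>Z. nbr_closed Z \<longrightarrow> u \<notin> Z \<longrightarrow> (\<forall>x\<in>Z. f x = f0 x) \<and> (\<not> finished \<longrightarrow> w \<notin> Z))"

lemma token_inv_init: "proper f \<Longrightarrow> u \<in> V \<Longrightarrow> f u = c \<Longrightarrow> token_inv f u f u False"
  unfolding token_inv_def by auto

lemma token_inv_token: "token_inv f0 u f w False \<Longrightarrow> w \<in> V \<and> f w = c"
  unfolding token_inv_def by auto

lemma token_inv_colour:
  assumes T: "token_inv f0 u f w False" and i: "i < c" and free: "\<And>v. adj w v \<Longrightarrow> f v \<noteq> i"
  shows "token_inv f0 u (f(w := i)) w' True"
  unfolding token_inv_def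
proof (intro conjI allI impI)
  show "proper (f(w := i))"
    using T i free adj_sym adj_irrefl unfolding token_inv_def proper_def by auto
  show "{x \<in> V. (f(w := i)) x = c} = (if True then {} else {w'}) \<union> ({x \<in> V. f0 x = c} - {u})"
  proof -
    have "{x \<in> V. (f(w := i)) x = c} = {x \<in> V. f x = c} - {w}" using i by auto
    then show ?thesis using T unfolding token_inv_def by auto
  qed
qed (use T in \<open>auto simp: token_inv_def\<close>)

text \<open>By saturation \<open>v\<close> is the only neighbour of \<open>w\<close> with colour
  \<open>i\<close>, so \<open>w\<close> may take this colour as soon as \<open>v\<close> gives it
  up. The token travels along an edge and therefore never enters a closed set that avoids
  \<open>u\<close>.\<close>

lemma token_inv_move:
  assumes T: "token_inv f0 u f w False" and sat: "saturated f w"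
    and i: "i < c" and v: "adj w v" "f v = i"
  shows "token_inv f0 u (f(w := i, v := c)) v False"
proof -
  have wv: "w \<noteq> v" using v adj_irrefl by auto
  have vV: "v \<in> V" using v adj_V by auto
  have P: "proper f" and U: "{x \<in> V. f x = c} = {w} \<union> ({x \<in> V. f0 x = c} - {u})"
    and wV: "w \<in> V" "\<not> (f0 w = c \<and> w \<noteq> u)"
    and fr: "\<And>Z. nbr_closed Z \<Longrightarrow> u \<notin> Z \<Longrightarrow> (\<forall>x\<in>Z. f x = f0 x) \<and> w \<notin> Z"
    using T unfolding token_inv_def by auto
  have only: "x = v" if "adj w x" "f x = i" for x using saturated_unique[OF sat that(1) v(1)] v that by simp
  have "proper (f(w := i, v := c))"
    unfolding proper_def
  proof (intro conjI allI impI)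
    fix x show "(f(w := i, v := c)) x \<le> c" using P i unfolding proper_def by auto
  next
    fix x y assume xy: "adj x y" "(f(w := i, v := c)) x = (f(w := i, v := c)) y"
    show "(f(w := i, v := c)) x = c"
    proof (rule ccontr)
      assume nc: "(f(w := i, v := c)) x \<noteq> c"
      then have "x \<noteq> v" "y \<noteq> v" using xy(2) by auto
      moreover have "x \<noteq> y" using xy(1) adj_irrefl by auto
      ultimately consider "x = w" "f y = i" | "y = w" "f x = i" | "f x = f y" "f x \<noteq> c"
        using xy(2) nc by (auto split: if_splits)
      then show False
      proof cases
        case 1
        then show False using only[of y] xy(1) \<open>y \<noteq> v\<close> by auto
      next
        case 2
        then show False using only[of x] adj_sym[OF xy(1)] \<open>x \<noteq> v\<close> by auto
      next
        case 3
        then show False using P xy(1) unfolding proper_def by auto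
      qed
    qed
  qed
  have fvc: "f v \<noteq> c" using v i by simp
  then have nB: "\<not> (f0 v = c \<and> v \<noteq> u)" using U vV by auto
  have "{x \<in> V. (f(w := i, v := c)) x = c} = insert v ({x \<in> V. f x = c} - {w})"
    using wv vV i by auto
  also have "\<dots> = {v} \<union> ({x \<in> V. f0 x = c} - {u})" unfolding U using wV by auto
  finally have unc: "{x \<in> V. (f(w := i, v := c)) x = c} = {v} \<union> ({x \<in> V. f0 x = c} - {u})" .
  have "(\<forall>x\<in>Z. (f(w := i, v := c)) x = f0 x) \<and> v \<notin> Z" if Z: "nbr_closed Z" "u \<notin> Z" for Z
  proof -
    have "w \<notin> Z" using fr Z by auto
    then have "v \<notin> Z" using Z adj_sym[OF v(1)] unfolding nbr_closed_def by auto
    then show ?thesis using fr[OF Z] \<open>w \<notin> Z\<close> by auto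
  qed
  then show ?thesis
    unfolding token_inv_def using \<open>proper (f(w := i, v := c))\<close> unc vV nB by simp
qed

text \<open>The component that witnesses \<open>blocked f0 x\<close> has \<open>x\<close> as its
  only uncoloured vertex, hence avoids \<open>u\<close> and is not touched.\<close>

lemma blocked_frozen:
  assumes T: "token_inv f0 u f w True" and u: "f0 u = c" "u \<in> V" and b: "blocked f0 x" and "x \<noteq> u"
  shows "blocked f x"
proof -
  obtain Z where Z: "obstruction Z" "{y \<in> Z. f0 y = c} = {x}" and inj: "inj_on f0 {y. adj x y}"
    using b unfolding blocked_def by auto
  have cl: "nbr_closed Z" using Z(1) unfolding obstruction_def by simp
  moreover have "u \<notin> Z" using Z(2) u \<open>x \<noteq> u\<close> by auto
  ultimately have eq: "\<And>y. y \<in> Z \<Longrightarrow> f y = f0 y" using T unfolding token_inv_def by auto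
  have "x \<in> Z" using Z(2) by auto
  then have "{y. adj x y} \<subseteq> Z" using cl unfolding nbr_closed_def by auto
  then have "inj_on f {y. adj x y}" using inj eq by (auto simp: inj_on_def subset_iff)
  moreover have "{y \<in> Z. f y = c} = {y \<in> Z. f0 y = c}" using eq by (intro Collect_cong) auto
  ultimately show ?thesis using Z unfolding blocked_def by auto
qed

end

section \<open>The program text\<close>

definition co_adj :: "nat \<Rightarrow> nat set set \<Rightarrow> nat \<Rightarrow> nat \<Rightarrow> bool" where
  "co_adj n E x y \<longleftrightarrow> x < n \<and> y < n \<and> x \<noteq> y \<and> {x, y} \<notin> E"

text \<open>There is no multiplication, so row offsets of the adjacency matrix are tabulated.\<close>

definition rows :: prog where
  "rows = For ''x'' (Asg ''row'' (Plus (Var ''x'') (N 1)) (Plus (Cell ''row'' (Var ''x'')) (Var ''n'')))"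

definition co_adj_test :: "string \<Rightarrow> string \<Rightarrow> bexp" where
  "co_adj_test x y = And (Not (Eq (Var x) (Var y)))
     (Eq (Cell ''adj'' (Plus (Cell ''row'' (Var x)) (Var y))) (N 0))"

definition count_if :: "bexp \<Rightarrow> prog" where
  "count_if b = Asg ''cnt'' (N 0) (N 0) ;;
     For ''y'' (Cnd b (Asg ''cnt'' (N 0) (Plus (Var ''cnt'') (N 1))) Nop)"

definition max_degree :: prog where
  "max_degree = Asg ''c'' (N 0) (N 1) ;;
     For ''x'' (count_if (co_adj_test ''x'' ''y'') ;;
       Cnd (Less (Var ''c'') (Var ''cnt'')) (Asg ''c'' (N 0) (Var ''cnt'')) Nop)"

definition uncolour_all :: prog where
  "uncolour_all = For ''x'' (Asg ''part'' (Var ''x'') (Var ''c''))"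

text \<open>The value \<open>c\<close> of \<open>free\<close> signals that no colour is
  free.\<close>

definition find_free :: prog where
  "find_free = Asg ''free'' (N 0) (Var ''c'') ;;
     For ''x'' (Cnd (Less (Var ''x'') (Var ''c''))
       (count_if (And (co_adj_test ''w'' ''y'') (Eq (Cell ''part'' (Var ''y'')) (Var ''x''))) ;;
        Cnd (Eq (Var ''cnt'') (N 0)) (Asg ''free'' (N 0) (Var ''x'')) Nop) Nop)"

definition try_colour :: prog where
  "try_colour = find_free ;;
     Cnd (Less (Var ''free'') (Var ''c''))
       (Asg ''part'' (Var ''w'') (Var ''free'') ;; Asg ''done'' (N 0) (N 1)) Nop"

text \<open>\<open>a\<close> holds the colour of the next move; exchanging it with \<open>b\<close>
  produces the alternation of \<open>walk\<close>.\<close>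

definition shift_token :: prog where
  "shift_token =
     For ''y'' (Cnd (And (co_adj_test ''w'' ''y'') (Eq (Cell ''part'' (Var ''y'')) (Var ''a'')))
       (Asg ''nxt'' (N 0) (Var ''y'')) Nop) ;;
     Asg ''part'' (Var ''w'') (Var ''a'') ;; Asg ''part'' (Var ''nxt'') (Var ''c'') ;;
     Asg ''w'' (N 0) (Var ''nxt'') ;;
     Asg ''t'' (N 0) (Var ''a'') ;; Asg ''a'' (N 0) (Var ''b'') ;; Asg ''b'' (N 0) (Var ''t'')"

definition not_done :: bexp where
  "not_done = Eq (Var ''done'') (N 0)"

definition move_token :: prog where
  "move_token = Cnd not_done (try_colour ;; Cnd not_done shift_token Nop) Nop"

text \<open>The first move is made outside the loop, because the loop recognises the end of the walk
  by \<open>w = u\<close>. The \<open>n\<close> further rounds are enough by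
  \<open>returns_within\<close>.\<close>

definition cycle_token :: "string \<Rightarrow> string \<Rightarrow> prog" where
  "cycle_token i j = Asg ''a'' (N 0) (Var i) ;; Asg ''b'' (N 0) (Var j) ;; move_token ;;
     For ''z'' (Cnd (Eq (Var ''w'') (Var ''u'')) Nop move_token)"

definition distinct_colours :: "string \<Rightarrow> string \<Rightarrow> bexp" where
  "distinct_colours i j = And (And (Less (Var i) (Var ''c'')) (Less (Var j) (Var ''c'')))
     (Not (Eq (Var i) (Var j)))"

text \<open>Each cycle is walked twice, which restores the colouring, so that all pairs of walks are tried
  from the same state.\<close>

definition try_cycles :: prog where
  "try_cycles = Cnd (And (distinct_colours ''i'' ''j'') (distinct_colours ''k'' ''l''))
     (cycle_token ''i'' ''j'' ;; cycle_token ''k'' ''l'' ;;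
      cycle_token ''k'' ''l'' ;; cycle_token ''i'' ''j'') Nop"

definition colour_vertex :: prog where
  "colour_vertex = Asg ''w'' (N 0) (Var ''u'') ;; Asg ''done'' (N 0) (N 0) ;; try_colour ;;
     For ''i'' (For ''j'' (For ''k'' (For ''l'' try_cycles)))"

definition largest_class :: prog where
  "largest_class = Asg ''best'' (N 0) (N 0) ;; Asg ''size'' (N 0) (N 0) ;;
     For ''x'' (Cnd (Less (Var ''x'') (Var ''c''))
       (count_if (Eq (Cell ''part'' (Var ''y'')) (Var ''x'')) ;;
        Cnd (Less (Var ''size'') (Var ''cnt''))
          (Asg ''size'' (N 0) (Var ''cnt'') ;; Asg ''best'' (N 0) (Var ''x'')) Nop) Nop)"

definition fill_class :: prog where
  "fill_class = For ''x'' (Cnd (Eq (Cell ''part'' (Var ''x'')) (Var ''c''))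
     (Asg ''part'' (Var ''x'') (Var ''best'')) Nop)"

definition main_prog :: prog where
  "main_prog = rows ;; max_degree ;; uncolour_all ;; For ''u'' colour_vertex ;; largest_class ;; fill_class"

section \<open>Written variables and well-formedness\<close>

lemma writes_prog:
  "writes (count_if b) = {''cnt'', ''y''}"
  "writes find_free = {''free'', ''x'', ''cnt'', ''y''}"
  "writes try_colour = {''free'', ''x'', ''cnt'', ''y'', ''part'', ''done''}"
  "writes shift_token = {''y'', ''nxt'', ''part'', ''w'', ''t'', ''a'', ''b''}"
  "writes move_token = {''free'', ''x'', ''cnt'', ''y'', ''part'', ''done'', ''nxt'', ''w'', ''t'', ''a'', ''b''}"
  "writes (cycle_token i j) = {''free'', ''x'', ''cnt'', ''y'', ''part'', ''done'', ''nxt'', ''w'', ''t'', ''a'', ''b'', ''z''}"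
  "writes try_cycles = {''free'', ''x'', ''cnt'', ''y'', ''part'', ''done'', ''nxt'', ''w'', ''t'', ''a'', ''b'', ''z''}"
  "writes colour_vertex = {''free'', ''x'', ''cnt'', ''y'', ''part'', ''done'', ''nxt'', ''w'', ''t'', ''a'', ''b'', ''z'',
     ''i'', ''j'', ''k'', ''l''}"
proof -
  show count_if: "writes (count_if b) = {''cnt'', ''y''}" for b by (auto simp: count_if_def)
  show find_free: "writes find_free = {''free'', ''x'', ''cnt'', ''y''}"
    by (auto simp: find_free_def count_if)
  show try_colour: "writes try_colour = {''free'', ''x'', ''cnt'', ''y'', ''part'', ''done''}"
    by (auto simp: try_colour_def find_free)
  show shift_token: "writes shift_token = {''y'', ''nxt'', ''part'', ''w'', ''t'', ''a'', ''b''}"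
    by (auto simp: shift_token_def)
  show move_token: "writes move_token =
      {''free'', ''x'', ''cnt'', ''y'', ''part'', ''done'', ''nxt'', ''w'', ''t'', ''a'', ''b''}"
    by (auto simp: move_token_def try_colour shift_token)
  show cycle_token: "writes (cycle_token i j) =
      {''free'', ''x'', ''cnt'', ''y'', ''part'', ''done'', ''nxt'', ''w'', ''t'', ''a'', ''b'', ''z''}" for i j
    by (auto simp: cycle_token_def move_token)
  show try_cycles: "writes try_cycles =
      {''free'', ''x'', ''cnt'', ''y'', ''part'', ''done'', ''nxt'', ''w'', ''t'', ''a'', ''b'', ''z''}"
    by (simp add: try_cycles_def cycle_token)
  show "writes colour_vertex =
      {''free'', ''x'', ''cnt'', ''y'', ''part'', ''done'', ''nxt'', ''w'', ''t'', ''a'', ''b'', ''z'',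
       ''i'', ''j'', ''k'', ''l''}"
    by (auto simp: colour_vertex_def try_cycles try_colour)
qed

lemma wf_parts:
  "wf_prog (count_if b)" "wf_prog find_free" "wf_prog move_token" "wf_prog (cycle_token i j)"
  "wf_prog try_cycles" "wf_prog colour_vertex"
proof -
  show count_if: "wf_prog (count_if b)" for b by (simp add: count_if_def)
  show find_free: "wf_prog find_free" by (simp add: find_free_def count_if writes_prog)
  show move_token: "wf_prog move_token"
    by (simp add: move_token_def try_colour_def shift_token_def find_free)
  show cycle_token: "wf_prog (cycle_token i j)" for i j
    by (simp add: cycle_token_def move_token writes_prog)
  show try_cycles: "wf_prog try_cycles" by (simp add: try_cycles_def cycle_token)
  show "wf_prog colour_vertex"
    by (simp add: colour_vertex_def try_colour_def find_free try_cycles writes_prog)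
qed

lemma wf_main_prog: "wf_prog main_prog"
  by (simp add: main_prog_def rows_def max_degree_def uncolour_all_def largest_class_def fill_class_def
      wf_parts writes_prog)

section \<open>Reading the complement from the input\<close>

definition inputs :: "nat \<Rightarrow> nat set set \<Rightarrow> memory \<Rightarrow> bool" where
  "inputs n E s \<longleftrightarrow> s ''n'' 0 = n \<and> (\<forall>x<n. s ''row'' x = x * n) \<and> s ''adj'' = graph_input n E ''adj''"

lemma inputs_upd [simp]:
  "x \<noteq> ''n'' \<Longrightarrow> x \<noteq> ''row'' \<Longrightarrow> x \<noteq> ''adj'' \<Longrightarrow> inputs n E (upd s x i v) \<longleftrightarrow> inputs n E s"
  by (simp add: inputs_def)

lemma inputs_den:
  "''n'' \<notin> writes p \<Longrightarrow> ''row'' \<notin> writes p \<Longrightarrow> ''adj'' \<notin> writes p \<Longrightarrow>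
    inputs n E (den p s) \<longleftrightarrow> inputs n E s"
  by (simp add: inputs_def den_frame)

lemma inputs_cong:
  "s' ''n'' = s ''n'' \<Longrightarrow> s' ''row'' = s ''row'' \<Longrightarrow> s' ''adj'' = s ''adj'' \<Longrightarrow> inputs n E s' \<longleftrightarrow> inputs n E s"
  by (simp add: inputs_def)

lemma inputs_n: "inputs n E s \<Longrightarrow> s ''n'' 0 = n"
  by (simp add: inputs_def)

lemma co_adj_test:
  assumes "inputs n E s" "s x 0 < n" "s y 0 < n"
  shows "bval (co_adj_test x y) s \<longleftrightarrow> co_adj n E (s x 0) (s y 0)"
proof -
  let ?k = "s x 0 * n + s y 0"
  have d: "?k div n = s x 0" "?k mod n = s y 0" using assms(3) by auto
  \<comment> \<open>Outside the \<open>n * n\<close> matrix the input is 0, which would be taken for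
    a non-edge.\<close>
  have "?k < Suc (s x 0) * n" using assms(3) by simp
  also have "\<dots> \<le> n * n" using assms(2) by (intro mult_le_mono1) simp
  finally have "?k < n * n" .
  then show ?thesis
    using assms d unfolding co_adj_test_def co_adj_def inputs_def graph_input_def by auto
qed

lemma count_if:
  assumes "inputs n E s"
    and "\<And>s' k. k < n \<Longrightarrow> s' ''y'' 0 = k \<Longrightarrow> (\<And>z. z \<noteq> ''y'' \<Longrightarrow> z \<noteq> ''cnt'' \<Longrightarrow> s' z = s z) \<Longrightarrow>
      inputs n E s' \<Longrightarrow> bval b s' \<longleftrightarrow> P k"
  shows "den (count_if b) s ''cnt'' 0 = card {k. k < n \<and> P k}"
proof -
  let ?s = "upd s ''cnt'' 0 0"
  have "den (count_if b) s ''cnt'' 0 = ?s ''cnt'' 0 + card {k. k < ?s ''n'' 0 \<and> P k}"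
    unfolding count_if_def den.simps(2,3) aval.simps
  proof (rule count_loop)
    fix s' :: memory and k
    assume k: "k < ?s ''n'' 0" "s' ''y'' 0 = k" and eq: "\<And>z. z \<noteq> ''y'' \<Longrightarrow> z \<noteq> ''cnt'' \<Longrightarrow> s' z = ?s z"
    have "s' z = s z" if "z \<noteq> ''y''" "z \<noteq> ''cnt''" for z using eq[OF that] that by simp
    then show "bval b s' \<longleftrightarrow> P k"
      using k assms inputs_n[OF assms(1)] inputs_cong[of s' s] by auto
  qed auto
  then show ?thesis using inputs_n[OF assms(1)] by simp
qed

section \<open>Correctness of single token moves\<close>

locale token_program = complement_graph "{..<n}" "co_adj n E" c E for n E c +
  assumes c_pos: "1 \<le> c" and c_le: "c \<le> n"
begin

abbreviation "adj \<equiv> co_adj n E"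

abbreviation ready :: "memory \<Rightarrow> bool" where
  "ready s \<equiv> inputs n E s \<and> s ''c'' 0 = c"

lemma find_free:
  assumes s: "ready s" "s ''w'' 0 < n"
  defines "s' \<equiv> den find_free s"
  shows "if s' ''free'' 0 < c then \<forall>v. adj (s ''w'' 0) v \<longrightarrow> s ''part'' v \<noteq> s' ''free'' 0
    else saturated (s ''part'') (s ''w'' 0)"
proof -
  let ?w = "s ''w'' 0" and ?f = "s ''part''"
  let ?b = "And (co_adj_test ''w'' ''y'') (Eq (Cell ''part'' (Var ''y'')) (Var ''x''))"
  let ?p = "Cnd (Less (Var ''x'') (Var ''c''))
       (count_if ?b ;; Cnd (Eq (Var ''cnt'') (N 0)) (Asg ''free'' (N 0) (Var ''x'')) Nop) Nop"
  let ?s = "upd s ''free'' 0 c"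
  let ?I = "\<lambda>k s'. (\<forall>z. z \<notin> {''x'', ''y'', ''cnt'', ''free''} \<longrightarrow> s' z = s z) \<and>
    (if s' ''free'' 0 < c then \<forall>v. adj ?w v \<longrightarrow> ?f v \<noteq> s' ''free'' 0
     else \<forall>i<k. i < c \<longrightarrow> (\<exists>v. adj ?w v \<and> ?f v = i))"
  have "?I (?s ''n'' 0) (den (For ''x'' ?p) ?s)"
  proof (rule den_For[where I = ?I])
    show "wf_prog (For ''x'' ?p)" by (simp add: wf_parts writes_prog)
    show "?I 0 (upd ?s ''x'' 0 0)" by simp
    fix k s1 assume k: "k < ?s ''n'' 0" "s1 ''x'' 0 = k" "s1 ''n'' 0 = ?s ''n'' 0" and I: "?I k s1"
    have kn: "k < n" using k inputs_n[of n E s] s by simp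
    have eq: "\<And>z. z \<notin> {''x'', ''y'', ''cnt'', ''free''} \<Longrightarrow> s1 z = s z" using I by blast
    have in1: "inputs n E s1" using s eq inputs_cong[of s1 s] by simp
    define C where "C = card {v. v < n \<and> adj ?w v \<and> ?f v = k}"
    have cnt: "den (count_if ?b) s1 ''cnt'' 0 = C"
      unfolding C_def
    proof (rule count_if[OF in1])
      fix s2 :: memory and v
      assume v: "v < n" "s2 ''y'' 0 = v" "inputs n E s2"
        and eq2: "\<And>z. z \<noteq> ''y'' \<Longrightarrow> z \<noteq> ''cnt'' \<Longrightarrow> s2 z = s1 z"
      show "bval ?b s2 \<longleftrightarrow> adj ?w v \<and> ?f v = k"
        using co_adj_test[OF v(3), of "''w''" "''y''"] v s(2) eq2 eq k(2) by simp
    qed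
    have C: "C = 0 \<longleftrightarrow> (\<forall>v. adj ?w v \<longrightarrow> ?f v \<noteq> k)"
      unfolding C_def by (auto simp: co_adj_def)
    have fr: "den (count_if ?b) s1 z = s1 z" if "z \<noteq> ''cnt''" "z \<noteq> ''y''" for z
      using that by (simp add: den_frame writes_prog)
    have c1: "s1 ''c'' 0 = c" using eq s by simp
    have ex: "(\<exists>v. adj ?w v \<and> ?f v = k)" if "C \<noteq> 0" using C that by blast
    have d: "den ?p s1 = (if k < c then (if C = 0 then upd (den (count_if ?b) s1) ''free'' 0 k else den (count_if ?b) s1) else s1)"
      using k(2) c1 cnt fr[of "''x''"] by simp
    show "?I (Suc k) (upd (den ?p s1) ''x'' 0 (Suc k))"
    proof (intro conjI)
      show "\<forall>z. z \<notin> {''x'', ''y'', ''cnt'', ''free''} \<longrightarrow> upd (den ?p s1) ''x'' 0 (Suc k) z = s z"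
        unfolding d using fr eq by auto
      have "den ?p s1 ''free'' 0 = (if k < c \<and> C = 0 then k else s1 ''free'' 0)"
        unfolding d using fr by simp
      then show "if upd (den ?p s1) ''x'' 0 (Suc k) ''free'' 0 < c
        then \<forall>v. adj ?w v \<longrightarrow> ?f v \<noteq> upd (den ?p s1) ''x'' 0 (Suc k) ''free'' 0
        else \<forall>i<Suc k. i < c \<longrightarrow> (\<exists>v. adj ?w v \<and> ?f v = i)"
        using I C ex by (auto simp: less_Suc_eq)
    qed
  qed
  moreover have "s' = den (For ''x'' ?p) ?s" unfolding s'_def find_free_def using s by simp
  ultimately show ?thesis
    using inputs_n[of n E s] s c_le unfolding saturated_def by (auto split: if_splits)
qed

lemma try_colour:
  assumes s: "ready s" "s ''w'' 0 < n"
  defines "s' \<equiv> den try_colour s"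
  shows "(saturated (s ''part'') (s ''w'' 0) \<and> s' ''part'' = s ''part'' \<and> s' ''done'' = s ''done'') \<or>
    (\<exists>i<c. (\<forall>v. adj (s ''w'' 0) v \<longrightarrow> s ''part'' v \<noteq> i) \<and>
      s' ''part'' = (s ''part'')(s ''w'' 0 := i) \<and> s' ''done'' 0 = 1)"
proof -
  let ?t = "den find_free s"
  have fr: "?t z = s z" if "z \<notin> {''free'', ''x'', ''cnt'', ''y''}" for z
    using that by (simp add: den_frame writes_prog)
  have eq: "s' = (if ?t ''free'' 0 < c then upd (upd ?t ''part'' (s ''w'' 0) (?t ''free'' 0)) ''done'' 0 1 else ?t)"
    unfolding s'_def try_colour_def using s fr by simp
  show ?thesis
  proof (cases "?t ''free'' 0 < c")
    case True
    have "s' ''part'' = (s ''part'')(s ''w'' 0 := ?t ''free'' 0)" "s' ''done'' 0 = 1"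
      using True fr[of "''part''"] unfolding eq by (auto simp: fun_eq_iff)
    moreover have "\<forall>v. adj (s ''w'' 0) v \<longrightarrow> s ''part'' v \<noteq> ?t ''free'' 0"
      using find_free[OF s] True by simp
    ultimately show ?thesis using True by blast
  next
    case False
    then show ?thesis using find_free[OF s] fr[of "''part''"] fr[of "''done''"] eq by simp
  qed
qed

text \<open>The program searches for the next vertex while \<open>move\<close> chooses it by
  \<open>SOME\<close>; the two agree because a saturated vertex has just one neighbour of the
  required colour.\<close>

lemma move_token:
  assumes s: "ready s" "s ''w'' 0 < n" "s ''done'' 0 = 0" "s ''a'' 0 < c"
  defines "s' \<equiv> den move_token s"
  shows "(saturated (s ''part'') (s ''w'' 0) \<and> s' ''done'' 0 = 0 \<and>
      (s' ''part'', s' ''w'' 0) = move (s ''a'' 0) (s ''part'', s ''w'' 0) \<and>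
      s' ''a'' 0 = s ''b'' 0 \<and> s' ''b'' 0 = s ''a'' 0) \<or>
    (\<exists>i<c. (\<forall>v. adj (s ''w'' 0) v \<longrightarrow> s ''part'' v \<noteq> i) \<and>
      s' ''part'' = (s ''part'')(s ''w'' 0 := i) \<and> s' ''done'' 0 = 1)"
proof -
  let ?w = "s ''w'' 0" and ?f = "s ''part''" and ?a = "s ''a'' 0"
  let ?t = "den try_colour s"
  have fr: "?t z = s z" if "z \<notin> {''free'', ''x'', ''cnt'', ''y'', ''part'', ''done''}" for z
    using that by (simp add: den_frame writes_prog)
  have s': "s' = (if ?t ''done'' 0 = 0 then den shift_token ?t else ?t)"
    unfolding s'_def move_token_def not_done_def using s by simp
  from try_colour[OF s(1,2)] show ?thesis
  proof (elim disjE)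
    assume "\<exists>i<c. (\<forall>v. adj ?w v \<longrightarrow> ?f v \<noteq> i) \<and> ?t ''part'' = ?f(?w := i) \<and> ?t ''done'' 0 = 1"
    then show ?thesis unfolding s' by auto
  next
    assume A: "saturated ?f ?w \<and> ?t ''part'' = ?f \<and> ?t ''done'' = s ''done''"
    let ?b = "And (co_adj_test ''w'' ''y'') (Eq (Cell ''part'' (Var ''y'')) (Var ''a''))"
    let ?q = "den (For ''y'' (Cnd ?b (Asg ''nxt'' (N 0) (Var ''y'')) Nop)) ?t"
    have int: "inputs n E ?t" using s(1) by (subst inputs_den) (auto simp: writes_prog)
    obtain v where v: "adj ?w v" "?f v = ?a" using A s(4) unfolding saturated_def by blast
    have vn: "v < n" using v by (simp add: co_adj_def)
    have "?q ''nxt'' 0 < ?t ''n'' 0 \<and> (adj ?w (?q ''nxt'' 0) \<and> ?f (?q ''nxt'' 0) = ?a)"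
    proof (rule search_loop)
      show "v < ?t ''n'' 0" using vn inputs_n[OF int] by simp
      show "adj ?w v \<and> ?f v = ?a" using v by simp
      fix s2 :: memory and k
      assume k: "k < ?t ''n'' 0" "s2 ''y'' 0 = k" and eq2: "\<And>z. z \<noteq> ''y'' \<Longrightarrow> z \<noteq> ''nxt'' \<Longrightarrow> s2 z = ?t z"
      have in2: "inputs n E s2" using int eq2 inputs_cong[of s2 ?t] by simp
      show "bval ?b s2 \<longleftrightarrow> adj ?w k \<and> ?f k = ?a"
        using co_adj_test[OF in2, of "''w''" "''y''"] k s(2) eq2 fr A inputs_n[OF int] by simp
    qed auto
    then have "?q ''nxt'' 0 = v"
      using saturated_unique[of ?f ?w] A v by auto
    moreover have "?q ''w'' = s ''w''" "?q ''a'' = s ''a''" "?q ''b'' = s ''b''" "?q ''c'' = s ''c''"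
      "?q ''part'' = ?f" "?q ''done'' = ?t ''done''"
      using A fr[of "''w''"] fr[of "''a''"] fr[of "''b''"] fr[of "''c''"] by (simp_all add: den_frame)
    moreover define q where "q = ?q"
    ultimately have q: "q ''nxt'' 0 = v" "q ''w'' 0 = ?w" "q ''a'' 0 = ?a" "q ''b'' 0 = s ''b'' 0"
      "q ''c'' 0 = c" "q ''part'' = ?f" "q ''done'' = ?t ''done''"
      using s(1) by simp_all
    define s1 where "s1 = upd (upd q ''part'' ?w ?a) ''part'' v c"
    have s1: "den (Asg ''part'' (Var ''w'') (Var ''a'') ;; Asg ''part'' (Var ''nxt'') (Var ''c'')) q = s1"
      unfolding s1_def using q by simp
    define s2 where "s2 = upd (upd (upd (upd s1 ''w'' 0 v) ''t'' 0 ?a) ''a'' 0 (s ''b'' 0)) ''b'' 0 ?a"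
    have s2: "den (Asg ''w'' (N 0) (Var ''nxt'') ;; Asg ''t'' (N 0) (Var ''a'') ;;
        Asg ''a'' (N 0) (Var ''b'') ;; Asg ''b'' (N 0) (Var ''t'')) s1 = s2"
    proof -
      have "s1 ''nxt'' 0 = v" "s1 ''a'' 0 = ?a" "s1 ''b'' 0 = s ''b'' 0"
        unfolding s1_def using q by simp_all
      then show ?thesis unfolding s2_def by simp
    qed
    have "den shift_token ?t = s2"
      using s1 s2 unfolding shift_token_def q_def[symmetric] den.simps(3) by simp
    then have "den shift_token ?t ''part'' = ?f(?w := ?a, v := c) \<and> den shift_token ?t ''w'' 0 = v \<and>
        den shift_token ?t ''a'' 0 = s ''b'' 0 \<and> den shift_token ?t ''b'' 0 = ?a \<and>
        den shift_token ?t ''done'' = ?t ''done''"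
      unfolding s2_def s1_def using q by (auto simp: fun_eq_iff)
    then show ?thesis
      unfolding s' using A s(3) move_eq[of ?f ?w v ?a] v by simp
  qed
qed

section \<open>The search from one start vertex\<close>

definition state_inv :: "(nat \<Rightarrow> nat) \<Rightarrow> nat \<Rightarrow> memory \<Rightarrow> bool" where
  "state_inv f0 u s \<longleftrightarrow> ready s \<and> s ''u'' 0 = u \<and> s ''done'' 0 \<le> 1 \<and>
     token_inv f0 u (s ''part'') (s ''w'' 0) (s ''done'' 0 = 1)"

lemma state_inv_upd:
  assumes "x \<notin> {''n'', ''row'', ''adj'', ''c'', ''u'', ''done'', ''part'', ''w''}"
  shows "state_inv f0 u (upd s x i v) \<longleftrightarrow> state_inv f0 u s"
  using assms by (auto simp: state_inv_def)

lemma state_inv_token: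
  assumes "state_inv f0 u s" "s ''done'' 0 = 0"
  shows "ready s" "s ''w'' 0 < n" "s ''part'' (s ''w'' 0) = c"
    "token_inv f0 u (s ''part'') (s ''w'' 0) False"
  using assms token_inv_token[of f0 u "s ''part''" "s ''w'' 0"] unfolding state_inv_def by auto

lemma move_token_done: "s ''done'' 0 \<noteq> 0 \<Longrightarrow> den move_token s = s"
  by (simp add: move_token_def not_done_def)

lemma move_token_inv:
  assumes I: "state_inv f0 u s" and d: "s ''done'' 0 = 0" and a: "s ''a'' 0 < c"
  defines "s' \<equiv> den move_token s"
  shows "state_inv f0 u s'"
    and "s' ''done'' 0 = 0 \<Longrightarrow> saturated (s ''part'') (s ''w'' 0) \<and>
      (s' ''part'', s' ''w'' 0) = move (s ''a'' 0) (s ''part'', s ''w'' 0) \<and>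
      s' ''a'' 0 = s ''b'' 0 \<and> s' ''b'' 0 = s ''a'' 0"
proof -
  note st = state_inv_token[OF I d]
  have r: "ready s'" "s' ''u'' = s ''u''"
    using st(1) unfolding s'_def by (simp_all add: inputs_den den_frame writes_prog)
  note mv = move_token[OF st(1,2) d a, folded s'_def]
  show "s' ''done'' 0 = 0 \<Longrightarrow> saturated (s ''part'') (s ''w'' 0) \<and>
      (s' ''part'', s' ''w'' 0) = move (s ''a'' 0) (s ''part'', s ''w'' 0) \<and>
      s' ''a'' 0 = s ''b'' 0 \<and> s' ''b'' 0 = s ''a'' 0"
    using mv by auto
  from mv show "state_inv f0 u s'"
  proof (elim disjE)
    assume A: "saturated (s ''part'') (s ''w'' 0) \<and> s' ''done'' 0 = 0 \<and>
      (s' ''part'', s' ''w'' 0) = move (s ''a'' 0) (s ''part'', s ''w'' 0) \<and>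
      s' ''a'' 0 = s ''b'' 0 \<and> s' ''b'' 0 = s ''a'' 0"
    then obtain v where v: "adj (s ''w'' 0) v" "s ''part'' v = s ''a'' 0"
      using a unfolding saturated_def by blast
    then have "s' ''part'' = (s ''part'')(s ''w'' 0 := s ''a'' 0, v := c)" "s' ''w'' 0 = v"
      using A move_eq[of "s ''part''" "s ''w'' 0" v "s ''a'' 0"] by simp_all
    then show ?thesis
      using token_inv_move[OF st(4) _ a v] A r I unfolding state_inv_def by simp
  next
    assume "\<exists>i<c. (\<forall>v. adj (s ''w'' 0) v \<longrightarrow> s ''part'' v \<noteq> i) \<and>
      s' ''part'' = (s ''part'')(s ''w'' 0 := i) \<and> s' ''done'' 0 = 1"
    then show ?thesis
      using token_inv_colour[OF st(4)] r I unfolding state_inv_def by auto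
  qed
qed

text \<open>If the token is still uncoloured, it was on a saturated vertex before every move, and
  \<open>returns_within\<close> forces it back to \<open>u\<close>. The condition on
  \<open>y\<close> is due to \<open>a\<close> being overwritten before \<open>y\<close> is
  read.\<close>

lemma cycle_token:
  assumes I: "state_inv f0 u s" and d: "s ''done'' 0 = 0" "s ''w'' 0 = u"
    and ij: "s x 0 < c" "s y 0 < c" "s x 0 \<noteq> s y 0" and y: "y \<noteq> ''a''" and u: "u < n"
  defines "s' \<equiv> den (cycle_token x y) s"
  shows "state_inv f0 u s'"
    and "s' ''done'' 0 = 0 \<Longrightarrow> s' ''w'' 0 = u \<and> cycle_run (s ''part'') u (s x 0) (s y 0) (s' ''part'')"
proof -
  define f where "f = s ''part''"
  define i where "i = s x 0"
  define j where "j = s y 0"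
  have ij': "i < c" "j < c" "i \<noteq> j" using ij unfolding i_def j_def by auto
  have fu: "f u = c" using state_inv_token[OF I d(1)] d(2) unfolding f_def by simp
  let ?s0 = "upd (upd s ''a'' 0 i) ''b'' 0 j"
  let ?s1 = "den move_token ?s0"
  let ?p = "Cnd (Eq (Var ''w'') (Var ''u'')) Nop move_token"
  have s': "s' = den (For ''z'' ?p) ?s1"
    unfolding s'_def cycle_token_def i_def j_def using y by simp
  \<comment> \<open>\<open>k\<close> is the number of moves made so far. Away from \<open>u\<close>
    it is \<open>Suc z\<close>, counting the move before the loop; once the token is home,
    \<open>k\<close> stays at the first return time.\<close>
  let ?J = "\<lambda>z s'. state_inv f0 u s' \<and> (s' ''done'' 0 = 0 \<longrightarrow>
    (\<exists>k\<ge>1. (\<forall>m<k. saturated_at f u i j m) \<and> (\<forall>m. 0 < m \<longrightarrow> m < k \<longrightarrow> tok f u i j m \<noteq> u) \<and>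
       walk f u i j k = (s' ''part'', s' ''w'' 0) \<and> s' ''a'' 0 = alt i j k \<and> s' ''b'' 0 = alt i j (Suc k) \<and>
       (s' ''w'' 0 \<noteq> u \<longrightarrow> k = Suc z)))"
  have J0: "?J 0 ?s1"
  proof -
    have I0: "state_inv f0 u ?s0" using I by (simp add: state_inv_upd)
    have a0: "?s0 ''a'' 0 < c" "?s0 ''done'' 0 = 0" using ij' d by simp_all
    show ?thesis
    proof (intro conjI impI)
      show "state_inv f0 u ?s1" by (rule move_token_inv(1)[OF I0 a0(2,1)])
      assume "?s1 ''done'' 0 = 0"
      from move_token_inv(2)[OF I0 a0(2,1) this]
      have "saturated f u" "(?s1 ''part'', ?s1 ''w'' 0) = move i (f, u)"
        "?s1 ''a'' 0 = j" "?s1 ''b'' 0 = i"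
        using d(2) by (simp_all add: f_def)
      then show "\<exists>k\<ge>1. (\<forall>m<k. saturated_at f u i j m) \<and> (\<forall>m. 0 < m \<longrightarrow> m < k \<longrightarrow> tok f u i j m \<noteq> u) \<and>
        walk f u i j k = (?s1 ''part'', ?s1 ''w'' 0) \<and> ?s1 ''a'' 0 = alt i j k \<and> ?s1 ''b'' 0 = alt i j (Suc k) \<and>
        (?s1 ''w'' 0 \<noteq> u \<longrightarrow> k = Suc 0)"
        by (intro exI[of _ "Suc 0"]) (simp add: walk.simps(2) alt_def)
    qed
  qed
  have n1: "?s1 ''n'' 0 = n"
    using J0 inputs_n unfolding state_inv_def by blast
  have "?J (?s1 ''n'' 0) (den (For ''z'' ?p) ?s1)"
  proof (rule den_For[where I = ?J])
    show "wf_prog (For ''z'' ?p)" by (simp add: wf_parts writes_prog)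
    show "?J 0 (upd ?s1 ''z'' 0 0)" using J0 by (simp add: state_inv_upd)
    fix z t assume z: "t ''z'' 0 = z" and J: "?J z t"
    have up: "?J (Suc z) (upd r ''z'' 0 (Suc z)) \<longleftrightarrow> ?J (Suc z) r" for r
      by (simp add: state_inv_upd)
    have tu: "t ''u'' 0 = u" using J unfolding state_inv_def by blast
    have "?J (Suc z) (den ?p t)"
    proof (cases "t ''w'' 0 = u \<or> t ''done'' 0 \<noteq> 0")
      case True
      then have "den ?p t = t" using tu move_token_done by auto
      then show ?thesis using J True by auto
    next
      case False
      then have dt: "t ''done'' 0 = 0" "t ''w'' 0 \<noteq> u" by auto
      have p: "den ?p t = den move_token t" using dt tu by simp
      have It: "state_inv f0 u t" using J by blast
      from J dt obtain k where k: "1 \<le> k" "\<And>m. m < k \<Longrightarrow> saturated_at f u i j m"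
        "\<And>m. 0 < m \<Longrightarrow> m < k \<Longrightarrow> tok f u i j m \<noteq> u"
        "walk f u i j k = (t ''part'', t ''w'' 0)" "t ''a'' 0 = alt i j k" "t ''b'' 0 = alt i j (Suc k)"
        "k = Suc z" by blast
      have a: "t ''a'' 0 < c" using k(5) alt_less ij' by simp
      show ?thesis
        unfolding p
      proof (intro conjI impI)
        show "state_inv f0 u (den move_token t)" by (rule move_token_inv(1)[OF It dt(1) a])
        assume "den move_token t ''done'' 0 = 0"
        note mv = move_token_inv(2)[OF It dt(1) a this]
        have "saturated_at f u i j k" using mv k(4) by simp
        then have "\<forall>m<Suc k. saturated_at f u i j m" using k(2) by (auto simp: less_Suc_eq)
        moreover have "\<forall>m. 0 < m \<longrightarrow> m < Suc k \<longrightarrow> tok f u i j m \<noteq> u"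
          using k(3,4) dt(2) by (auto simp: less_Suc_eq)
        moreover have "walk f u i j (Suc k) = (den move_token t ''part'', den move_token t ''w'' 0)"
          using mv k(4,5) by (simp add: walk.simps(2))
        ultimately show "\<exists>k\<ge>1. (\<forall>m<k. saturated_at f u i j m) \<and> (\<forall>m. 0 < m \<longrightarrow> m < k \<longrightarrow> tok f u i j m \<noteq> u) \<and>
          walk f u i j k = (den move_token t ''part'', den move_token t ''w'' 0) \<and>
          den move_token t ''a'' 0 = alt i j k \<and> den move_token t ''b'' 0 = alt i j (Suc k) \<and>
          (den move_token t ''w'' 0 \<noteq> u \<longrightarrow> k = Suc (Suc z))"
          using mv k(5-7) by (intro exI[of _ "Suc k"]) (simp add: alt_def)
      qed
    qed
    then show "?J (Suc z) (upd (den ?p t) ''z'' 0 (Suc z))" unfolding up .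
  qed
  then have J: "?J n s'" unfolding n1 s' .
  then show "state_inv f0 u s'" by blast
  assume "s' ''done'' 0 = 0"
  with J obtain k where k: "1 \<le> k" "\<And>m. m < k \<Longrightarrow> saturated_at f u i j m"
    "\<And>m. 0 < m \<Longrightarrow> m < k \<Longrightarrow> tok f u i j m \<noteq> u"
    "walk f u i j k = (s' ''part'', s' ''w'' 0)" "s' ''w'' 0 \<noteq> u \<longrightarrow> k = Suc n" by blast
  have w: "s' ''w'' 0 = u"
  proof (rule ccontr)
    assume "s' ''w'' 0 \<noteq> u"
    then have kn: "k = Suc n" using k(5) by simp
    have "\<exists>K\<le>card {..<n}. returns f u i j K"
      using k(2) kn u by (intro returns_within ij' fu) auto
    then obtain K where "K \<le> n" "returns f u i j K" by auto
    then show False using k(3)[of K] kn unfolding returns_def by auto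
  qed
  have "returns f u i j k" unfolding returns_def using k w by auto
  then have "cycle_run f u i j (s' ''part'')" unfolding cycle_run_def using k(4) by (intro exI[of _ k]) simp
  then show "s' ''w'' 0 = u \<and> cycle_run (s ''part'') u (s x 0) (s y 0) (s' ''part'')"
    using w unfolding f_def i_def j_def by simp
qed

lemma cycle_token_done:
  assumes "s ''done'' 0 \<noteq> 0"
  shows "den (cycle_token x y) s ''done'' 0 \<noteq> 0 \<and>
    (state_inv f0 u s \<longrightarrow> state_inv f0 u (den (cycle_token x y) s))"
proof -
  let ?J = "\<lambda>z t. t ''done'' 0 \<noteq> 0 \<and> (state_inv f0 u s \<longrightarrow> state_inv f0 u t)"
  let ?s1 = "upd (upd s ''a'' 0 (s x 0)) ''b'' 0 (upd s ''a'' 0 (s x 0) y 0)"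
  let ?p = "Cnd (Eq (Var ''w'') (Var ''u'')) Nop move_token"
  have "?J (?s1 ''n'' 0) (den (For ''z'' ?p) ?s1)"
    using assms
    by (intro den_For[where I = ?J]) (auto simp: move_token_done wf_parts writes_prog state_inv_upd)
  moreover have "den (cycle_token x y) s = den (For ''z'' ?p) ?s1"
    using assms by (simp add: cycle_token_def move_token_done)
  ultimately show ?thesis by simp
qed

text \<open>An unsuccessful attempt must leave no trace, since \<open>blockedI\<close> speaks of
  walks that all start from the same colouring.\<close>

definition home :: "(nat \<Rightarrow> nat) \<Rightarrow> nat \<Rightarrow> memory \<Rightarrow> bool" where
  "home f0 u s \<longleftrightarrow> state_inv f0 u s \<and> (s ''done'' 0 = 0 \<longrightarrow> s ''w'' 0 = u \<and> s ''part'' = f0)"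

lemma cycle_token_any:
  assumes I: "state_inv f0 u s" and w: "s ''done'' 0 = 0 \<longrightarrow> s ''w'' 0 = u"
    and ij: "s x 0 < c" "s y 0 < c" "s x 0 \<noteq> s y 0" and y: "y \<noteq> ''a''" and u: "u < n"
  defines "s' \<equiv> den (cycle_token x y) s"
  shows "state_inv f0 u s'"
    and "s' ''done'' 0 = 0 \<Longrightarrow> s ''done'' 0 = 0 \<and> s' ''w'' 0 = u \<and>
      cycle_run (s ''part'') u (s x 0) (s y 0) (s' ''part'')"
proof -
  show "state_inv f0 u s'"
    using cycle_token(1)[OF I _ _ ij y u] cycle_token_done[of s x y f0 u] I w unfolding s'_def by blast
  show "s' ''done'' 0 = 0 \<Longrightarrow> s ''done'' 0 = 0 \<and> s' ''w'' 0 = u \<and>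
      cycle_run (s ''part'') u (s x 0) (s y 0) (s' ''part'')"
    using cycle_token(2)[OF I _ _ ij y u] cycle_token_done[of s x y f0 u] w unfolding s'_def by blast
qed

definition run_pair :: "(nat \<Rightarrow> nat) \<Rightarrow> nat \<Rightarrow> nat \<Rightarrow> nat \<Rightarrow> nat \<Rightarrow> nat \<Rightarrow> bool" where
  "run_pair f u i j k l \<longleftrightarrow> (i < c \<and> j < c \<and> k < c \<and> l < c \<and> i \<noteq> j \<and> k \<noteq> l \<longrightarrow>
     (\<exists>f'. cycle_run f u i j f' \<and> (\<exists>f''. cycle_run f' u k l f'')))"

text \<open>If the token survives all four walks, the first two are the pair asked for in
  \<open>run_pair\<close>. By \<open>cycle_run_twice\<close> the third undoes the second, and then
  the fourth undoes the first.\<close>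

lemma try_cycles:
  assumes H: "home f0 u s" and u: "u < n" "f0 u = c"
  defines "s' \<equiv> den try_cycles s"
  shows "home f0 u s'"
    and "s' ''done'' 0 = 0 \<Longrightarrow> s ''done'' 0 = 0 \<and>
      run_pair f0 u (s ''i'' 0) (s ''j'' 0) (s ''k'' 0) (s ''l'' 0)"
proof -
  define i where "i = s ''i'' 0"
  define j where "j = s ''j'' 0"
  define k where "k = s ''k'' 0"
  define l where "l = s ''l'' 0"
  have c: "s ''c'' 0 = c" using H unfolding home_def state_inv_def by blast
  have "home f0 u s' \<and> (s' ''done'' 0 = 0 \<longrightarrow> s ''done'' 0 = 0 \<and> run_pair f0 u i j k l)"
  proof (cases "i < c \<and> j < c \<and> k < c \<and> l < c \<and> i \<noteq> j \<and> k \<noteq> l")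
    case False
    then have "s' = s"
      unfolding s'_def try_cycles_def distinct_colours_def i_def j_def k_def l_def using c by auto
    then show ?thesis using H False unfolding run_pair_def by auto
  next
    case True
    define s1 where "s1 = den (cycle_token ''i'' ''j'') s"
    define s2 where "s2 = den (cycle_token ''k'' ''l'') s1"
    define s3 where "s3 = den (cycle_token ''k'' ''l'') s2"
    have s': "s' = den (cycle_token ''i'' ''j'') s3"
      unfolding s'_def try_cycles_def distinct_colours_def s1_def s2_def s3_def
      using True c unfolding i_def j_def k_def l_def by simp
    have fr: "t ''i'' = s ''i'' \<and> t ''j'' = s ''j'' \<and> t ''k'' = s ''k'' \<and> t ''l'' = s ''l''"
      if "t = s \<or> t = s1 \<or> t = s2 \<or> t = s3" for t
      using that unfolding s1_def s2_def s3_def by (auto simp: den_frame writes_prog)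
    have ij: "t ''i'' 0 = i \<and> t ''j'' 0 = j \<and> t ''k'' 0 = k \<and> t ''l'' 0 = l"
      if "t = s \<or> t = s1 \<or> t = s2 \<or> t = s3" for t
      using fr[OF that] unfolding i_def j_def k_def l_def by simp
    have I0: "state_inv f0 u s" "s ''done'' 0 = 0 \<longrightarrow> s ''w'' 0 = u \<and> s ''part'' = f0"
      using H unfolding home_def by auto
    have R: "state_inv f0 u (den (cycle_token x y) t)"
      "den (cycle_token x y) t ''done'' 0 = 0 \<Longrightarrow> t ''done'' 0 = 0 \<and> den (cycle_token x y) t ''w'' 0 = u \<and>
        cycle_run (t ''part'') u p q (den (cycle_token x y) t ''part'')"
      if "state_inv f0 u t" "t ''done'' 0 = 0 \<Longrightarrow> t ''w'' 0 = u" "t x 0 = p" "t y 0 = q"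
        "p < c" "q < c" "p \<noteq> q" "y \<noteq> ''a''" for x y t p q
      using cycle_token_any[of f0 u t x y] that u(1) by blast+
    have T: "i < c" "j < c" "i \<noteq> j" "k < c" "l < c" "k \<noteq> l" using True by auto
    have str: "''j'' \<noteq> ''a''" "''l'' \<noteq> ''a''" by simp_all
    have I1: "s ''done'' 0 = 0 \<Longrightarrow> s ''w'' 0 = u" using I0(2) by blast
    note ijs = ij[of s, simplified] ij[of s1, simplified] ij[of s2, simplified] ij[of s3, simplified]
    have r1: "state_inv f0 u s1" "s1 ''done'' 0 = 0 \<Longrightarrow> s ''done'' 0 = 0 \<and> s1 ''w'' 0 = u \<and>
        cycle_run (s ''part'') u i j (s1 ''part'')"
      using R[OF I0(1) I1 _ _ T(1-3) str(1), of "''i''"] ijs unfolding s1_def by blast+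
    have w1: "s1 ''done'' 0 = 0 \<Longrightarrow> s1 ''w'' 0 = u" using r1(2) by blast
    have r2: "state_inv f0 u s2" "s2 ''done'' 0 = 0 \<Longrightarrow> s1 ''done'' 0 = 0 \<and> s2 ''w'' 0 = u \<and>
        cycle_run (s1 ''part'') u k l (s2 ''part'')"
      using R[OF r1(1) w1 _ _ T(4-6) str(2), of "''k''"] ijs unfolding s2_def by blast+
    have w2: "s2 ''done'' 0 = 0 \<Longrightarrow> s2 ''w'' 0 = u" using r2(2) by blast
    have r3: "state_inv f0 u s3" "s3 ''done'' 0 = 0 \<Longrightarrow> s2 ''done'' 0 = 0 \<and> s3 ''w'' 0 = u \<and>
        cycle_run (s2 ''part'') u k l (s3 ''part'')"
      using R[OF r2(1) w2 _ _ T(4-6) str(2), of "''k''"] ijs unfolding s3_def by blast+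
    have w3: "s3 ''done'' 0 = 0 \<Longrightarrow> s3 ''w'' 0 = u" using r3(2) by blast
    have r4: "state_inv f0 u s'" "s' ''done'' 0 = 0 \<Longrightarrow> s3 ''done'' 0 = 0 \<and> s' ''w'' 0 = u \<and>
        cycle_run (s3 ''part'') u i j (s' ''part'')"
      using R[OF r3(1) w3 _ _ T(1-3) str(1), of "''i''"] ijs unfolding s' by blast+
    show ?thesis
    proof (cases "s' ''done'' 0 = 0")
      case False
      then show ?thesis using r4(1) unfolding home_def by auto
    next
      case d: True
      have d3: "s3 ''done'' 0 = 0" using r4(2) d by blast
      have d2: "s2 ''done'' 0 = 0" using r3(2) d3 by blast
      have d1: "s1 ''done'' 0 = 0" using r2(2) d2 by blast
      have d0: "s ''done'' 0 = 0" using r1(2) d1 by blast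
      have f: "s ''part'' = f0" using I0 d0 by blast
      have c1: "cycle_run f0 u i j (s1 ''part'')" using r1(2)[OF d1] f by simp
      have c2: "cycle_run (s1 ''part'') u k l (s2 ''part'')" using r2(2)[OF d2] by simp
      have c3: "cycle_run (s2 ''part'') u k l (s3 ''part'')" using r3(2)[OF d3] by simp
      have c4: "cycle_run (s3 ''part'') u i j (s' ''part'')" using r4(2)[OF d] by simp
      have "s1 ''part'' u = c" using state_inv_token(3)[OF r1(1) d1] r1(2)[OF d1] by simp
      then have "s3 ''part'' = s1 ''part''" using cycle_run_twice[OF c2 c3] True by simp
      then have "s' ''part'' = f0" using cycle_run_twice[OF c1] c4 True u(2) by simp
      then have "home f0 u s'" unfolding home_def using r4(1) r4(2)[OF d] by simp
      moreover have "run_pair f0 u i j k l" unfolding run_pair_def using c1 c2 by blast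
      ultimately show ?thesis using d0 by blast
    qed
  qed
  then show "home f0 u s'"
    and "s' ''done'' 0 = 0 \<Longrightarrow> s ''done'' 0 = 0 \<and>
      run_pair f0 u (s ''i'' 0) (s ''j'' 0) (s ''k'' 0) (s ''l'' 0)"
    unfolding i_def j_def k_def l_def by auto
qed

lemma home_upd:
  assumes "x \<notin> {''n'', ''row'', ''adj'', ''c'', ''u'', ''done'', ''part'', ''w''}"
  shows "home f0 u (upd s x i v) \<longleftrightarrow> home f0 u s"
  using assms state_inv_upd[OF assms] unfolding home_def by auto

text \<open>In the nested search, \<open>F\<close> fixes the variables of the enclosing loops.\<close>

lemma unsuccessful_loop:
  assumes wf: "wf_prog (For x p)"
    and x: "x \<notin> {''n'', ''row'', ''adj'', ''c'', ''u'', ''done'', ''part'', ''w''}"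
    and F: "\<And>r v. F (upd r x 0 v) \<longleftrightarrow> F r" "\<And>r. F (den p r) \<longleftrightarrow> F r"
    and body: "\<And>r. home f0 u r \<Longrightarrow> F r \<Longrightarrow>
      home f0 u (den p r) \<and> (den p r ''done'' 0 = 0 \<longrightarrow> r ''done'' 0 = 0 \<and> Q (r x 0))"
    and t: "home f0 u t" "F t"
  shows "home f0 u (den (For x p) t) \<and>
    (den (For x p) t ''done'' 0 = 0 \<longrightarrow> t ''done'' 0 = 0 \<and> (\<forall>k<n. Q k))"
proof -
  let ?J = "\<lambda>k r. home f0 u r \<and> F r \<and> (r ''done'' 0 = 0 \<longrightarrow> t ''done'' 0 = 0 \<and> (\<forall>j<k. Q j))"
  have xd: "x \<noteq> ''done''" using x by simp
  have "?J (t ''n'' 0) (den (For x p) t)"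
  proof (rule den_For[where I = ?J, OF wf])
    show "?J 0 (upd t x 0 0)" using t F(1) home_upd[OF x] xd by auto
    fix k r assume k: "r x 0 = k" and J: "?J k r"
    then have "home f0 u (den p r) \<and> (den p r ''done'' 0 = 0 \<longrightarrow> r ''done'' 0 = 0 \<and> Q k)"
      using body[of r] by auto
    then show "?J (Suc k) (upd (den p r) x 0 (Suc k))"
      using J F home_upd[OF x] xd by (auto simp: less_Suc_eq)
  qed
  moreover have "t ''n'' 0 = n" using t(1) inputs_n unfolding home_def state_inv_def by blast
  ultimately show ?thesis by simp
qed

text \<open>If the token is never coloured, each quadruple was tried from \<open>f0\<close>. The
  loops range below \<open>n\<close>, and \<open>c \<le> n\<close> ensures that they meet every
  quadruple of colours that \<open>blockedI\<close> needs.\<close>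

lemma colour_vertex:
  assumes s: "ready s" "s ''u'' 0 = u" and f0: "s ''part'' = f0" "proper f0" "f0 u = c" and u: "u < n"
  defines "s' \<equiv> den colour_vertex s"
  shows "token_inv f0 u (s' ''part'') (s' ''w'' 0) True \<or> (s' ''part'' = f0 \<and> blocked f0 u)"
proof -
  let ?s0 = "upd (upd s ''w'' 0 u) ''done'' 0 0"
  let ?s1 = "den try_colour ?s0"
  have T0: "token_inv f0 u f0 u False" using token_inv_init f0 u by simp
  have r1: "ready ?s1" "?s1 ''u'' 0 = u" "?s1 ''w'' 0 = u"
    using s by (simp_all add: inputs_den den_frame writes_prog)
  have s0: "ready ?s0" "?s0 ''w'' 0 < n" using s u by simp_all
  have H1: "home f0 u ?s1 \<and> (?s1 ''done'' 0 = 0 \<longrightarrow> saturated f0 u)"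
    using try_colour[OF s0]
  proof (elim disjE)
    assume A: "saturated (?s0 ''part'') (?s0 ''w'' 0) \<and> ?s1 ''part'' = ?s0 ''part'' \<and> ?s1 ''done'' = ?s0 ''done''"
    then show ?thesis using T0 r1 f0 unfolding home_def state_inv_def by simp
  next
    assume "\<exists>i<c. (\<forall>v. adj (?s0 ''w'' 0) v \<longrightarrow> ?s0 ''part'' v \<noteq> i) \<and>
      ?s1 ''part'' = (?s0 ''part'')(?s0 ''w'' 0 := i) \<and> ?s1 ''done'' 0 = 1"
    then obtain i where i: "i < c" "\<And>v. adj u v \<Longrightarrow> f0 v \<noteq> i" "?s1 ''part'' = f0(u := i)" "?s1 ''done'' 0 = 1"
      using f0(1) by auto
    then have "token_inv f0 u (?s1 ''part'') (?s1 ''w'' 0) True"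
      using token_inv_colour[OF T0 i(1,2)] by simp
    then show ?thesis using r1 i(4) unfolding home_def state_inv_def by simp
  qed
  let ?L = "For ''l'' try_cycles" let ?K = "For ''k'' ?L" let ?J = "For ''j'' ?K" let ?I = "For ''i'' ?J"
  have wf: "wf_prog ?L" "wf_prog ?K" "wf_prog ?J" "wf_prog ?I"
    by (simp_all add: wf_parts writes_prog)
  have q: "home f0 u (den try_cycles r) \<and> (den try_cycles r ''done'' 0 = 0 \<longrightarrow>
      r ''done'' 0 = 0 \<and> run_pair f0 u (r ''i'' 0) (r ''j'' 0) (r ''k'' 0) (r ''l'' 0))"
    if "home f0 u r" for r
    using try_cycles[OF that u f0(3)] by blast
  have l: "home f0 u (den ?L t) \<and> (den ?L t ''done'' 0 = 0 \<longrightarrow>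
      t ''done'' 0 = 0 \<and> (\<forall>l<n. run_pair f0 u (t ''i'' 0) (t ''j'' 0) (t ''k'' 0) l))"
    if t: "home f0 u t" for t
  proof (rule unsuccessful_loop[where F = "\<lambda>r. r ''i'' 0 = t ''i'' 0 \<and> r ''j'' 0 = t ''j'' 0 \<and> r ''k'' 0 = t ''k'' 0", OF wf(1)])
    fix r assume "home f0 u r" "r ''i'' 0 = t ''i'' 0 \<and> r ''j'' 0 = t ''j'' 0 \<and> r ''k'' 0 = t ''k'' 0"
    then show "home f0 u (den try_cycles r) \<and> (den try_cycles r ''done'' 0 = 0 \<longrightarrow> r ''done'' 0 = 0 \<and>
        (run_pair f0 u (t ''i'' 0) (t ''j'' 0) (t ''k'' 0) (r ''l'' 0)))"
      using q[of r] by simp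
  qed (use t in \<open>simp_all add: den_frame writes_prog\<close>)
  have k: "home f0 u (den ?K t) \<and> (den ?K t ''done'' 0 = 0 \<longrightarrow>
      t ''done'' 0 = 0 \<and> (\<forall>k<n. \<forall>l<n. run_pair f0 u (t ''i'' 0) (t ''j'' 0) k l))"
    if t: "home f0 u t" for t
  proof (rule unsuccessful_loop[where F = "\<lambda>r. r ''i'' 0 = t ''i'' 0 \<and> r ''j'' 0 = t ''j'' 0", OF wf(2)])
    fix r assume "home f0 u r" "r ''i'' 0 = t ''i'' 0 \<and> r ''j'' 0 = t ''j'' 0"
    then show "home f0 u (den ?L r) \<and> (den ?L r ''done'' 0 = 0 \<longrightarrow> r ''done'' 0 = 0 \<and>
        (\<forall>l<n. run_pair f0 u (t ''i'' 0) (t ''j'' 0) (r ''k'' 0) l))"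
      using l[of r] by simp
  qed (use t in \<open>simp_all add: den_frame writes_prog\<close>)
  have j: "home f0 u (den ?J t) \<and> (den ?J t ''done'' 0 = 0 \<longrightarrow>
      t ''done'' 0 = 0 \<and> (\<forall>j<n. \<forall>k<n. \<forall>l<n. run_pair f0 u (t ''i'' 0) j k l))"
    if t: "home f0 u t" for t
  proof (rule unsuccessful_loop[where F = "\<lambda>r. r ''i'' 0 = t ''i'' 0", OF wf(3)])
    fix r assume "home f0 u r" "r ''i'' 0 = t ''i'' 0"
    then show "home f0 u (den ?K r) \<and> (den ?K r ''done'' 0 = 0 \<longrightarrow> r ''done'' 0 = 0 \<and>
        (\<forall>k<n. \<forall>l<n. run_pair f0 u (t ''i'' 0) (r ''j'' 0) k l))"
      using k[of r] by simp
  qed (use t in \<open>simp_all add: den_frame writes_prog\<close>)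
  have i: "home f0 u (den ?I ?s1) \<and> (den ?I ?s1 ''done'' 0 = 0 \<longrightarrow>
      ?s1 ''done'' 0 = 0 \<and> (\<forall>i<n. \<forall>j<n. \<forall>k<n. \<forall>l<n. run_pair f0 u i j k l))"
  proof (rule unsuccessful_loop[where F = "\<lambda>r. True", OF wf(4)])
    show "home f0 u ?s1" using H1 by blast
    fix r assume "home f0 u r"
    then show "home f0 u (den ?J r) \<and> (den ?J r ''done'' 0 = 0 \<longrightarrow> r ''done'' 0 = 0 \<and>
        (\<forall>j<n. \<forall>k<n. \<forall>l<n. run_pair f0 u (r ''i'' 0) j k l))"
      by (rule j)
  qed simp_all
  have s': "s' = den ?I ?s1" unfolding s'_def colour_vertex_def using s(2) by simp
  have h': "home f0 u s'" unfolding s' using i by blast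
  show ?thesis
  proof (cases "s' ''done'' 0 = 0")
    case False
    then have "s' ''done'' 0 = 1" using h' unfolding home_def state_inv_def by auto
    then show ?thesis using h' unfolding home_def state_inv_def by simp
  next
    case True
    then have A: "?s1 ''done'' 0 = 0" "\<forall>i<n. \<forall>j<n. \<forall>k<n. \<forall>l<n. run_pair f0 u i j k l"
      using i unfolding s' by blast+
    have "\<exists>f'. cycle_run f0 u i j f' \<and> (\<exists>f''. cycle_run f' u k l f'')"
      if "i < c" "j < c" "k < c" "l < c" "i \<noteq> j" "k \<noteq> l" for i j k l
      using A(2) that c_le unfolding run_pair_def by (meson less_le_trans)
    then have "blocked f0 u"
      using blockedI[of f0 u] H1 A(1) f0(3) u c_pos by auto
    then show ?thesis using h' True unfolding home_def by simp
  qed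
qed

text \<open>Vertices from \<open>k\<close> on are still uncoloured and waiting, so being blocked is
  claimed only below \<open>k\<close>. Later tokens preserve it by
  \<open>blocked_frozen\<close>.\<close>

lemma colour_all:
  assumes s: "ready s" "\<And>x. s ''part'' x = (if x < n then c else 0)"
  defines "s' \<equiv> den (For ''u'' colour_vertex) s"
  shows "ready s'" "proper (s' ''part'')"
    and "\<And>x. x < n \<Longrightarrow> s' ''part'' x = c \<Longrightarrow> blocked (s' ''part'') x"
proof -
  let ?I = "\<lambda>k t. ready t \<and> proper (t ''part'') \<and> (\<forall>x<n. k \<le> x \<longrightarrow> t ''part'' x = c) \<and>
    (\<forall>x<k. t ''part'' x = c \<longrightarrow> blocked (t ''part'') x)"
  have "?I (s ''n'' 0) s'"
    unfolding s'_def
  proof (rule den_For[where I = ?I])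
    show "wf_prog (For ''u'' colour_vertex)" by (simp add: wf_parts writes_prog)
    show "?I 0 (upd s ''u'' 0 0)" using s by (auto simp: proper_def co_adj_def)
    fix k t assume k: "k < s ''n'' 0" "t ''u'' 0 = k" and I: "?I k t"
    have kn: "k < n" using k(1) s(1) inputs_n[of n E s] by simp
    let ?f = "t ''part''" and ?t = "den colour_vertex t"
    have fk: "?f k = c" using I kn by auto
    have r: "ready ?t" using I by (simp add: inputs_den den_frame writes_prog)
    have "token_inv ?f k (?t ''part'') (?t ''w'' 0) True \<or> (?t ''part'' = ?f \<and> blocked ?f k)"
      using I by (intro colour_vertex[OF _ k(2) refl _ fk kn]) auto
    then have "proper (?t ''part'') \<and> (\<forall>x<n. Suc k \<le> x \<longrightarrow> ?t ''part'' x = c) \<and>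
      (\<forall>x<Suc k. ?t ''part'' x = c \<longrightarrow> blocked (?t ''part'') x)"
    proof (elim disjE)
      assume T: "token_inv ?f k (?t ''part'') (?t ''w'' 0) True"
      have U: "{x \<in> {..<n}. ?t ''part'' x = c} = {x \<in> {..<n}. ?f x = c} - {k}"
        using T unfolding token_inv_def by auto
      have "?t ''part'' x = c" if "x < n" "Suc k \<le> x" for x
      proof -
        have "x \<in> {x \<in> {..<n}. ?f x = c} - {k}" using that I by auto
        then show ?thesis unfolding U[symmetric] by auto
      qed
      moreover have "blocked (?t ''part'') x" if "x < Suc k" "?t ''part'' x = c" for x
      proof -
        have "x \<in> {x \<in> {..<n}. ?t ''part'' x = c}" using that kn by auto
        then have "?f x = c" "x \<noteq> k" unfolding U by auto
        then have "blocked ?f x" using I that(1) by auto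
        then show ?thesis using blocked_frozen[OF T fk] kn \<open>x \<noteq> k\<close> by auto
      qed
      moreover have "proper (?t ''part'')" using T unfolding token_inv_def by auto
      ultimately show ?thesis by blast
    next
      assume "?t ''part'' = ?f \<and> blocked ?f k"
      then show ?thesis using I by (auto simp: less_Suc_eq)
    qed
    then show "?I (Suc k) (upd ?t ''u'' 0 (Suc k))" using r by simp
  qed
  then show "ready s'" "proper (s' ''part'')"
    and "\<And>x. x < n \<Longrightarrow> s' ''part'' x = c \<Longrightarrow> blocked (s' ''part'') x"
    using s(1) inputs_n[of n E s] by auto
qed

section \<open>Choosing and filling the largest class\<close>

lemma largest_class:
  assumes s: "ready s"
  defines "s' \<equiv> den largest_class s"
  shows "s' ''best'' 0 < c"
    and "\<And>i. i < c \<Longrightarrow> card {x. x < n \<and> s ''part'' x = i} \<le> card {x. x < n \<and> s ''part'' x = s' ''best'' 0}"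
proof -
  let ?f = "s ''part''"
  let ?b = "Eq (Cell ''part'' (Var ''y'')) (Var ''x'')"
  let ?q = "Cnd (Less (Var ''size'') (Var ''cnt''))
          (Asg ''size'' (N 0) (Var ''cnt'') ;; Asg ''best'' (N 0) (Var ''x'')) Nop"
  let ?p = "Cnd (Less (Var ''x'') (Var ''c'')) (count_if ?b ;; ?q) Nop"
  let ?s = "upd (upd s ''best'' 0 0) ''size'' 0 0"
  let ?card = "\<lambda>i. card {x. x < n \<and> ?f x = i}"
  \<comment> \<open>Only an inequality holds between \<open>size\<close> and the class
    \<open>best\<close>, because the initial value 0 need not be the size of class 0.\<close>
  let ?I = "\<lambda>k t. (\<forall>z. z \<notin> {''x'', ''y'', ''cnt'', ''best'', ''size''} \<longrightarrow> t z = s z) \<and>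
    t ''best'' 0 < c \<and> t ''size'' 0 \<le> ?card (t ''best'' 0) \<and> (\<forall>i<k. i < c \<longrightarrow> ?card i \<le> t ''size'' 0)"
  have "?I (?s ''n'' 0) (den (For ''x'' ?p) ?s)"
  proof (rule den_For[where I = ?I])
    show "wf_prog (For ''x'' ?p)" by (simp add: wf_parts writes_prog)
    show "?I 0 (upd ?s ''x'' 0 0)" using c_pos by simp
    fix k t assume k: "t ''x'' 0 = k" and I: "?I k t"
    have eq: "\<And>z. z \<notin> {''x'', ''y'', ''cnt'', ''best'', ''size''} \<Longrightarrow> t z = s z" using I by blast
    have t: "inputs n E t" "t ''c'' 0 = c" "t ''part'' = ?f"
      using s eq[of "''c''"] eq[of "''part''"] inputs_cong[of t s] eq[of "''n''"] eq[of "''row''"] eq[of "''adj''"]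
      by simp_all
    let ?t = "den (count_if ?b) t"
    have cnt: "?t ''cnt'' 0 = ?card k"
      by (rule count_if[OF t(1)]) (use t k in simp)
    have fr: "?t z = t z" if "z \<noteq> ''cnt''" "z \<noteq> ''y''" for z
      using that by (simp add: den_frame writes_prog)
    have x: "?t ''x'' 0 = k" using fr[of "''x''"] k by simp
    have sb: "?t ''size'' = t ''size''" "?t ''best'' = t ''best''" using fr by simp_all
    have d: "den ?p t = (if k < c then (if t ''size'' 0 < ?card k
        then upd (upd ?t ''size'' 0 (?card k)) ''best'' 0 k else ?t) else t)"
      using k t(2) cnt x sb by simp
    have "?I (Suc k) (den ?p t)"
    proof (cases "k < c")
      case False
      then show ?thesis using I unfolding d by (auto simp: less_Suc_eq)
    next
      case kc: True
      show ?thesis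
      proof (cases "t ''size'' 0 < ?card k")
        case True
        have "\<forall>i<k. i < c \<longrightarrow> ?card i \<le> ?card k" using I True by (meson le_trans less_imp_le)
        moreover have "\<forall>z. z \<notin> {''x'', ''y'', ''cnt'', ''best'', ''size''} \<longrightarrow> ?t z = s z" using fr eq by auto
        ultimately show ?thesis using kc True unfolding d by (auto simp: less_Suc_eq)
      next
        case False
        moreover have "\<forall>z. z \<notin> {''x'', ''y'', ''cnt'', ''best'', ''size''} \<longrightarrow> ?t z = s z" using fr eq by auto
        ultimately show ?thesis using kc I sb unfolding d by (auto simp: less_Suc_eq)
      qed
    qed
    then show "?I (Suc k) (upd (den ?p t) ''x'' 0 (Suc k))" by simp
  qed
  moreover have "s' = den (For ''x'' ?p) ?s" unfolding s'_def largest_class_def by simp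
  moreover have "?s ''n'' 0 = n" using s inputs_n[of n E s] by simp
  ultimately have J: "?I n s'" by simp
  then show "s' ''best'' 0 < c" by blast
  show "?card i \<le> ?card (s' ''best'' 0)" if "i < c" for i
  proof -
    have "?card i \<le> s' ''size'' 0" using J that c_le by auto
    also have "\<dots> \<le> ?card (s' ''best'' 0)" using J by blast
    finally show ?thesis .
  qed
qed

lemma fill_class:
  assumes s: "ready s" and L: "s ''best'' 0 \<noteq> c" and x: "x < n"
  shows "den fill_class s ''part'' x = (if s ''part'' x = c then s ''best'' 0 else s ''part'' x)"
proof -
  let ?p = "Cnd (Eq (Cell ''part'' (Var ''x'')) (Var ''c'')) (Asg ''part'' (Var ''x'') (Var ''best'')) Nop"
  let ?I = "\<lambda>k t. t ''c'' 0 = c \<and> t ''best'' 0 = s ''best'' 0 \<and>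
    (\<forall>x. t ''part'' x = (if x < k \<and> s ''part'' x = c then s ''best'' 0 else s ''part'' x))"
  have "?I (s ''n'' 0) (den (For ''x'' ?p) s)"
    using s by (intro den_For[where I = ?I]) (auto simp: less_Suc_eq)
  then show ?thesis unfolding fill_class_def using x s inputs_n[of n E s] by simp
qed

end

section \<open>Preprocessing, and assembly of the result\<close>

lemma rows:
  "inputs n E (den rows (graph_input n E))" "den rows (graph_input n E) ''part'' = (\<lambda>_. 0)"
proof -
  let ?s = "graph_input n E"
  let ?p = "Asg ''row'' (Plus (Var ''x'') (N 1)) (Plus (Cell ''row'' (Var ''x'')) (Var ''n''))"
  \<comment> \<open>The offset of row \<open>k\<close> is in place before round \<open>k\<close>,
    since cell 0 starts out as 0; hence \<open>x \<le> k\<close>.\<close>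
  let ?I = "\<lambda>k t. (\<forall>z. z \<noteq> ''x'' \<longrightarrow> z \<noteq> ''row'' \<longrightarrow> t z = ?s z) \<and> (\<forall>x\<le>k. t ''row'' x = x * n)"
  have n: "?s ''n'' 0 = n" by (simp add: graph_input_def)
  have "?I (?s ''n'' 0) (den (For ''x'' ?p) ?s)"
  proof (rule den_For[where I = ?I])
    show "wf_prog (For ''x'' ?p)" by simp
    show "?I 0 (upd ?s ''x'' 0 0)" by (simp add: graph_input_def)
    fix k t assume k: "t ''x'' 0 = k" and I: "?I k t"
    have "t ''n'' 0 = n" using I n by simp
    then show "?I (Suc k) (upd (den ?p t) ''x'' 0 (Suc k))" using k I by (auto simp: le_Suc_eq)
  qed
  then have J: "?I n (den rows ?s)" unfolding rows_def n .
  then show "inputs n E (den rows ?s)" unfolding inputs_def using n by simp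
  show "den rows ?s ''part'' = (\<lambda>_. 0)" using J by (simp add: graph_input_def)
qed

lemma max_degree:
  assumes s: "inputs n E s"
  defines "s' \<equiv> den max_degree s" and "deg \<equiv> \<lambda>x. card {y. y < n \<and> co_adj n E x y}"
  shows "inputs n E s'" "s' ''part'' = s ''part''" "1 \<le> s' ''c'' 0" "\<And>x. x < n \<Longrightarrow> deg x \<le> s' ''c'' 0"
    "s' ''c'' 0 = 1 \<or> (\<exists>x<n. s' ''c'' 0 = deg x)"
proof -
  let ?b = "co_adj_test ''x'' ''y''"
  let ?p = "count_if ?b ;; Cnd (Less (Var ''c'') (Var ''cnt'')) (Asg ''c'' (N 0) (Var ''cnt'')) Nop"
  let ?s = "upd s ''c'' 0 1"
  let ?I = "\<lambda>k t. inputs n E t \<and> t ''part'' = s ''part'' \<and> 1 \<le> t ''c'' 0 \<and> (\<forall>x<k. deg x \<le> t ''c'' 0) \<and>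
    (t ''c'' 0 = 1 \<or> (\<exists>x<n. t ''c'' 0 = deg x))"
  have "?I (?s ''n'' 0) (den (For ''x'' ?p) ?s)"
  proof (rule den_For[where I = ?I])
    show "wf_prog (For ''x'' ?p)" by (simp add: wf_parts writes_prog)
    show "?I 0 (upd ?s ''x'' 0 0)" using s by simp
    fix k t assume kn: "k < ?s ''n'' 0" and k: "t ''x'' 0 = k" and I: "?I k t"
    have kn: "k < n" using kn s inputs_n[of n E s] by simp
    let ?t = "den (count_if ?b) t"
    have cnt: "?t ''cnt'' 0 = deg k"
      unfolding deg_def
    proof (rule count_if)
      show "inputs n E t" using I by blast
      fix r :: memory and y assume y: "y < n" "r ''y'' 0 = y" "inputs n E r"
        and eq: "\<And>z. z \<noteq> ''y'' \<Longrightarrow> z \<noteq> ''cnt'' \<Longrightarrow> r z = t z"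
      show "bval ?b r \<longleftrightarrow> co_adj n E k y"
        using co_adj_test[OF y(3), of "''x''" "''y''"] y eq[of "''x''"] k kn by simp
    qed
    have fr: "?t ''c'' = t ''c''" "?t ''part'' = t ''part''" by (simp_all add: den_frame writes_prog)
    have inp: "inputs n E ?t" using I by (simp add: inputs_den writes_prog)
    have d: "den ?p t = (if t ''c'' 0 < deg k then upd ?t ''c'' 0 (deg k) else ?t)"
      using cnt fr by simp
    have "?I (Suc k) (den ?p t)"
    proof (cases "t ''c'' 0 < deg k")
      case True
      then have "\<forall>x<Suc k. deg x \<le> deg k" using I by (auto simp: less_Suc_eq intro: le_trans)
      then show ?thesis unfolding d using True inp fr I kn by auto
    next
      case False
      then show ?thesis unfolding d using inp fr I by (auto simp: less_Suc_eq)
    qed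
    then show "?I (Suc k) (upd (den ?p t) ''x'' 0 (Suc k))" by simp
  qed
  moreover have "s' = den (For ''x'' ?p) ?s" unfolding s'_def max_degree_def by simp
  moreover have "?s ''n'' 0 = n" using s inputs_n[of n E s] by simp
  ultimately have "?I n s'" by simp
  then show "inputs n E s'" "s' ''part'' = s ''part''" "1 \<le> s' ''c'' 0" "\<And>x. x < n \<Longrightarrow> deg x \<le> s' ''c'' 0"
    "s' ''c'' 0 = 1 \<or> (\<exists>x<n. s' ''c'' 0 = deg x)" by blast+
qed

lemma uncolour_all:
  assumes s: "inputs n E s" "s ''part'' = (\<lambda>_. 0)"
  shows "den uncolour_all s ''part'' x = (if x < n then s ''c'' 0 else 0)"
proof -
  let ?p = "Asg ''part'' (Var ''x'') (Var ''c'')"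
  let ?I = "\<lambda>k t. t ''c'' 0 = s ''c'' 0 \<and> (\<forall>x. t ''part'' x = (if x < k then s ''c'' 0 else 0))"
  have "?I (s ''n'' 0) (den (For ''x'' ?p) s)"
    using s by (intro den_For[where I = ?I]) (auto simp: less_Suc_eq)
  then show ?thesis unfolding uncolour_all_def using s inputs_n[of n E s] by simp
qed

lemma degree_in_eq:
  assumes "simple_graph {..<n} E" "x < n"
  shows "degree_in E x + card {y. y < n \<and> co_adj n E x y} + 1 = n"
proof -
  have E: "\<And>e. e \<in> E \<Longrightarrow> e \<subseteq> {..<n} \<and> card e = 2" using assms(1) unfolding simple_graph_def by auto
  let ?N = "{y. {x, y} \<in> E}" and ?M = "{y. y < n \<and> co_adj n E x y}"
  have "{e \<in> E. x \<in> e} = (\<lambda>y. {x, y}) ` ?N"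
  proof (intro equalityI subsetI)
    fix e assume e: "e \<in> {e \<in> E. x \<in> e}"
    then have "card e = 2" using E by blast
    then obtain a b where "e = {a, b}" "a \<noteq> b" by (auto simp: card_2_iff)
    then show "e \<in> (\<lambda>y. {x, y}) ` ?N" using e by (auto simp: insert_commute)
  qed auto
  moreover have "inj_on (\<lambda>y. {x, y}) ?N" by (auto simp: inj_on_def doubleton_eq_iff)
  ultimately have "degree_in E x = card ?N" unfolding degree_in_def by (simp add: card_image)
  moreover have "{x, x} \<notin> E" using E[of "{x, x}"] by auto
  then have un: "?N \<union> ?M = {..<n} - {x}"
    using E assms(2) by (auto simp: co_adj_def)
  have "card ({..<n} - {x}) = n - 1" using assms(2) by simp
  moreover have "finite (?N \<union> ?M)" unfolding un by simp
  then have "card (?N \<union> ?M) = card ?N + card ?M"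
    by (intro card_Un_disjoint) (auto simp: co_adj_def)
  ultimately show ?thesis using un assms(2) by simp
qed

lemma opt_density_le:
  assumes "finite V" "\<And>P. partition_on V P \<Longrightarrow> partition_density E P \<le> B"
  shows "opt_density V E \<le> B"
proof -
  have "{P. partition_on V P} \<subseteq> Pow (Pow V)" by (auto simp: partition_on_def)
  then have fin: "finite {P. partition_on V P}"
    using assms(1) by (meson finite_Pow_iff finite_subset)
  obtain P where P: "partition_on V P"
    using partition_on_space[of V] partition_on_empty by (cases "V = {}") auto
  have "{partition_density E P |P. partition_on V P} = partition_density E ` {P. partition_on V P}" by auto
  then show ?thesis
    unfolding opt_density_def using fin P assms(2) by (intro Max.boundedI) auto
qed

text \<open>\<open>max 1\<close> makes a difference only for complete graphs: there the minimum
  degree plus 1 is n, and the quotient lies below 1, the least possible ratio. Multiplying out the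
  ratio keeps the claim meaningful for density 0, as in edgeless graphs.\<close>

theorem theorem26:
  "\<exists>(c :: com) (p :: nat poly). \<forall>(n :: nat) (E :: nat set set).
     n \<ge> 1 \<and> simple_graph {..<n} E \<longrightarrow>
     (\<exists>t s. exec c (graph_input n E) t s \<and> t \<le> poly p n \<and>
        partition_on {..<n} (output_partition n s) \<and>
        opt_density {..<n} E
          \<le> max 1 ((real n - 1) / (real (min_degree {..<n} E) + 1))
             * partition_density E (output_partition n s))"
proof -
  obtain p :: "nat poly" where p: "\<And>s. \<exists>t \<le> poly p (s ''n'' 0). exec (compile main_prog) s t (den main_prog s)"
    using exec_compile[OF wf_main_prog] by blast
  show ?thesis
  proof (rule exI[of _ "compile main_prog"], rule exI[of _ p], intro allI impI)
    fix n :: nat and E :: "nat set set"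
    assume nE: "n \<ge> 1 \<and> simple_graph {..<n} E"
    then have n1: "n \<ge> 1" and simple: "simple_graph {..<n} E" by auto
    let ?in = "graph_input n E" and ?adj = "co_adj n E"
    let ?s1 = "den rows ?in"
    let ?s2 = "den max_degree ?s1"
    let ?s3 = "den uncolour_all ?s2"
    let ?s4 = "den (For ''u'' colour_vertex) ?s3"
    let ?s5 = "den largest_class ?s4"
    let ?s = "den fill_class ?s5"
    define c where "c = ?s2 ''c'' 0"
    define deg where "deg x = card {y. y < n \<and> ?adj x y}" for x
    note md = max_degree[OF rows(1)[of n E], folded c_def deg_def]
    have deg_n: "deg x + 1 \<le> n" if "x < n" for x
      using degree_in_eq[OF simple that] unfolding deg_def by simp
    have c_le: "c \<le> n" using md(5) deg_n n1 by (metis add_leD1)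
    have nb: "{y. ?adj x y} = {y. y < n \<and> ?adj x y}" for x by (auto simp: co_adj_def)
    have deg_c: "card {y. ?adj x y} \<le> c" for x
    proof (cases "x < n")
      case True
      then show ?thesis using md(4)[OF True] unfolding nb deg_def by simp
    next
      case False
      then have "{y. ?adj x y} = {}" by (auto simp: co_adj_def)
      then show ?thesis by simp
    qed
    interpret token_program n E c
      by unfold_locales
        (use simple md(3) c_le deg_c in \<open>auto simp: co_adj_def insert_commute\<close>)
    have r3: "ready ?s3" "?s3 ''part'' x = (if x < n then c else 0)" for x
    proof -
      have "writes uncolour_all = {''x'', ''part''}" by (auto simp: uncolour_all_def)
      then show "ready ?s3" using md(1) unfolding c_def by (simp add: inputs_den den_frame)
      show "?s3 ''part'' x = (if x < n then c else 0)"
        using md(1,2) rows(2)[of n E] unfolding c_def by (simp add: uncolour_all)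
    qed
    note ca = colour_all[OF r3]
    have r5: "ready ?s5" "?s5 ''part'' = ?s4 ''part''"
      using ca(1) by (simp_all add: inputs_den den_frame largest_class_def writes_prog)
    note lc = largest_class[OF ca(1)]
    define f where "f = ?s4 ''part''"
    define L where "L = ?s5 ''best'' 0"
    define g where "g x = (if f x = c then L else f x)" for x
    have sg: "?s ''part'' x = g x" if "x < n" for x
      using fill_class[OF r5(1) _ that] lc(1) r5(2) unfolding g_def f_def L_def by simp
    have out: "output_partition n ?s = colour_classes g"
      unfolding output_partition_def colour_classes_def
    proof (rule image_cong)
      fix v assume "v \<in> {..<n}"
      then show "{u. u < n \<and> ?s ''part'' u = ?s ''part'' v} = {u \<in> {..<n}. g u = g v}"
        using sg by auto
    qed simp
    define R where "R = max 1 ((real n - 1) / (real (min_degree {..<n} E) + 1))"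
    have R1: "1 \<le> R" unfolding R_def by simp
    \<comment> \<open>Unless \<open>c = 1\<close>, where \<open>1 \<le> R\<close> suffices,
      \<open>c\<close> is the complement degree of some vertex \<open>x\<close>; then
      \<open>n - c\<close> is the degree of \<open>x\<close> in G plus 1 and so at least the
      denominator of the quotient.\<close>
    have R2: "real n - 1 \<le> R * (real n - real c)"
      using md(5)
    proof (elim disjE exE conjE)
      assume "c = 1"
      then show ?thesis using mult_right_mono[OF R1, of "real n - 1"] n1 by simp
    next
      fix x assume x: "x < n" "c = deg x"
      have "min_degree {..<n} E \<le> degree_in E x" unfolding min_degree_def using x(1) by (intro Min_le) auto
      then have "min_degree {..<n} E + 1 \<le> n - c" "c < n"
        using degree_in_eq[OF simple x(1)] x(2) unfolding deg_def by auto
      then have d: "real (min_degree {..<n} E) + 1 \<le> real n - real c" by linarith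
      have "real n - 1 = (real n - 1) / (real (min_degree {..<n} E) + 1) * (real (min_degree {..<n} E) + 1)" by simp
      also have "\<dots> \<le> R * (real n - real c)"
        unfolding R_def using d n1 by (intro mult_mono) auto
      finally show ?thesis .
    qed
    have approx: "partition_density E Q \<le> R * partition_density E (colour_classes g)"
      if "partition_on {..<n} Q" for Q
      unfolding g_def
    proof (rule approximation)
      show "proper f" using ca(2) unfolding f_def .
      show "{..<n} \<noteq> {}" using n1 by (simp add: lessThan_empty_iff)
      show "blocked f u" if "u \<in> {..<n}" "f u = c" for u using ca(3) that unfolding f_def by auto
      show "L < c" using lc(1) unfolding L_def .
      show "card {x \<in> {..<n}. f x = i} \<le> card {x \<in> {..<n}. f x = L}" if "i < c" for i
        using lc(2)[OF that] unfolding f_def L_def by simp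
      show "1 \<le> R" by (rule R1)
      show "real (card {..<n}) - 1 \<le> R * (real (card {..<n}) - real c)" using R2 by simp
      show "partition_on {..<n} Q" by (rule that)
    qed
    have s: "den main_prog ?in = ?s" unfolding main_prog_def by simp
    obtain t where "t \<le> poly p (?in ''n'' 0)" "exec (compile main_prog) ?in t ?s" using p[of ?in] s by auto
    moreover have "?in ''n'' 0 = n" by (simp add: graph_input_def)
    moreover have "partition_on {..<n} (output_partition n ?s)"
      unfolding out by (rule partition_on_colour_classes)
    moreover have "opt_density {..<n} E \<le> R * partition_density E (output_partition n ?s)"
      unfolding out using approx by (intro opt_density_le) auto
    ultimately show "\<exists>t s. exec (compile main_prog) (graph_input n E) t s \<and> t \<le> poly p n \<and>
        partition_on {..<n} (output_partition n s) \<and>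
        opt_density {..<n} E
          \<le> max 1 ((real n - 1) / (real (min_degree {..<n} E) + 1))
             * partition_density E (output_partition n s)"
      unfolding R_def by auto
  qed
qed

end
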